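(* Let $N$ be a positive integer and let $t_1,t_2,s_1,s_2$ be non-negative integers with $t_2<N$, $s_2<N$ and $t_1+t_2=s_1+s_2$. If a subspace $\mathcal{C}\subseteq(\mathbb{C}^q)^{\otimes N}$ is a $(t_1,t_2)$-insdel code, then $\mathcal{C}$ is also an $(s_1,s_2)$-insdel code.
   Context: Fix an integer $q\ge 2$. For a positive integer $m$ let $[m]=\{1,\dots,m\}$, and let $S(\mathbb{C}^{q\otimes m})$ denote the set of density matrices (positive semidefinite, trace one) on $(\mathbb{C}^q)^{\otimes m}$. Let $|0\rangle,\dots,|q-1\rangle$ be the standard basis of $\mathbb{C}^q$, and for $\bm{x}\in\{0,\dots,q-1\}^m$ write $|\bm{x}\rangle=|x_1\rangle\otimes\cdots\otimes|x_m\rangle$. For $p\in[m+1]$ and $\sigma\in S(\mathbb{C}^q)$, the map $\mathrm{In}^m_{p,\sigma}$ is the linear map from $q^m\times q^m$ matrices to $q^{m+1}\times q^{m+1}$ matrices given on matrix units by $|\bm{x}\rangle\langle\bm{y}|\mapsto |x_1\rangle\langle y_1|\otimes\cdots\otimes|x_{p-1}\rangle\langle y_{p-1}|\otimes\sigma\otimes|x_p\rangle\langle y_p|\otimes\cdots\otimes|x_m\rangle\langle y_m|$ (i.e. $\sigma$ becomes the $p$-th tensor factor). For $p\in[m]$, $\mathrm{Tr}^m_p$ is the partial trace over the $p$-th tensor factor of $(\mathbb{C}^q)^{\otimes m}$. Insertion: for $t\ge1$, a set $P=\{p_1<\dots<p_t\}\subseteq[N+t]$ and a product state $\sigma=\sigma_1\otimes\cdots\otimes\sigma_t$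 with each $\sigma_i\in S(\mathbb{C}^q)$, set $\mathrm{Ins}^N_{P,\sigma}=\mathrm{In}^{N+t-1}_{p_t,\sigma_t}\circ\cdots\circ\mathrm{In}^{N+1}_{p_2,\sigma_2}\circ\mathrm{In}^N_{p_1,\sigma_1}$. A $t$-insertion channel is any map of the form $\mathrm{Ins}^N_t(\rho)=\int\mu(\sigma)\sum_{P\subseteq[N+t],|P|=t}p_\sigma(P)\,\mathrm{Ins}^N_{P,\sigma}(\rho)\,d\sigma$, where the integral ranges over such product states $\sigma$, $\mu$ is a probability measure and each $p_\sigma$ is a probability distribution on $t$-subsets. Deletion: for $1\le t<N$ and $P=\{p_1<\dots<p_t\}\subseteq[N]$, set $\mathrm{Era}^N_P=\mathrm{Tr}^{N-t+1}_{p_1}\circ\cdots\circ\mathrm{Tr}^{N-1}_{p_{t-1}}\circ\mathrm{Tr}^N_{p_t}$. A $t$-deletion channel is any map $\mathrm{Del}^N_t(\rho)=\sum_{|P|=t}p(P)\,\mathrm{Era}^N_P(\rho)$ with $p$ a probability distribution on $t$-subsets of $[N]$. The $0$-insertion and $0$-deletion channels are identity maps. For non-negative integers $t_1,t_2$ with $t_2<N$, a $(t_1,t_2)$-insdel channel is any composition $\mathrm{InsDel}^N_{t_1,t_2}=\mathrm{Ins}^{N-t_2}_{t_1}\circ\mathrm{Del}^N_{t_2}$ of a $t_1$-insertion channel (on $N-t_2$ qudits) with a $t_2$-deletion channel (on $N$ qudits). A subspace $\mathcal{C}\subseteq(\mathbb{C}^q)^{\otimes N}$ is a $(t_1,t_2)$-insdel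 code if for every $(t_1,t_2)$-insdel channel $\mathcal{N}$ there is a quantum channel (completely positive trace-preserving map) $\mathcal{R}$ with $\mathcal{R}(\mathcal{N}(\rho))=\rho$ for every density matrix $\rho$ supported on $\mathcal{C}$. *)

theory Defs
  imports "HOL-Analysis.Analysis" "HOL-Probability.Probability" "HOL-Library.Complex_Order"
begin

text \<open>A q^m x q^m matrix is represented by its entries indexed by words
  x = [x_1,...,x_m] with x_i < q (computational basis |x>); entries at
  non-words are required to be zero (see ops).  Vectors of (C^q)^{\<otimes> m}
  are functions on words.\<close>

type_synonym op = "nat list \<Rightarrow> nat list \<Rightarrow> complex"
type_synonym vec = "nat list \<Rightarrow> complex"

definition words :: "nat \<Rightarrow> nat \<Rightarrow> nat list set" where
  "words q m = {xs. length xs = m \<and> (\<forall>x\<in>set xs. x < q)}"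

definition ops :: "nat \<Rightarrow> nat \<Rightarrow> op set" where
  "ops q m = {A. \<forall>X Y. (X \<notin> words q m \<or> Y \<notin> words q m) \<longrightarrow> A X Y = 0}"

definition trace_on :: "'i set \<Rightarrow> ('i \<Rightarrow> 'i \<Rightarrow> complex) \<Rightarrow> complex" where
  "trace_on I A = (\<Sum>X\<in>I. A X X)"

text \<open>Positive semidefinite: v^* A v \<ge> 0 for all v (complex order: real and nonneg).\<close>
definition psd_on :: "'i set \<Rightarrow> ('i \<Rightarrow> 'i \<Rightarrow> complex) \<Rightarrow> bool" where
  "psd_on I A \<longleftrightarrow> (\<forall>v. 0 \<le> (\<Sum>X\<in>I. \<Sum>Y\<in>I. cnj (v X) * A X Y * v Y))"

definition density_on :: "'i set \<Rightarrow> ('i \<Rightarrow> 'i \<Rightarrow> complex) \<Rightarrow> bool" where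
  "density_on I A \<longleftrightarrow>
     (\<forall>X Y. (X \<notin> I \<or> Y \<notin> I) \<longrightarrow> A X Y = 0) \<and> psd_on I A \<and> trace_on I A = 1"

definition density :: "nat \<Rightarrow> nat \<Rightarrow> op \<Rightarrow> bool" where
  "density q m \<rho> \<longleftrightarrow> density_on (words q m) \<rho>"

definition qudit_state :: "nat \<Rightarrow> (nat \<Rightarrow> nat \<Rightarrow> complex) \<Rightarrow> bool" where
  "qudit_state q \<sigma> \<longleftrightarrow> density_on {..<q} \<sigma>"

definition del_at :: "nat \<Rightarrow> 'a list \<Rightarrow> 'a list" where
  "del_at i xs = take i xs @ drop (Suc i) xs"

definition ins_at :: "nat \<Rightarrow> 'a \<Rightarrow> 'a list \<Rightarrow> 'a list" where
  "ins_at i a xs = take i xs @ a # drop i xs"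

text \<open>In^m_{p,\<sigma>}: sigma becomes the p-th tensor factor (p in [m+1], 1-based).\<close>
definition In_map :: "nat \<Rightarrow> nat \<Rightarrow> nat \<Rightarrow> (nat \<Rightarrow> nat \<Rightarrow> complex) \<Rightarrow> op \<Rightarrow> op" where
  "In_map q m p \<sigma> \<rho> = (\<lambda>X Y.
     if X \<in> words q (Suc m) \<and> Y \<in> words q (Suc m)
     then \<sigma> (X ! (p - 1)) (Y ! (p - 1)) * \<rho> (del_at (p - 1) X) (del_at (p - 1) Y)
     else 0)"

text \<open>Tr^m_p: partial trace over the p-th factor (p in [m], 1-based).\<close>
definition Tr_map :: "nat \<Rightarrow> nat \<Rightarrow> nat \<Rightarrow> op \<Rightarrow> op" where
  "Tr_map q m p \<rho> = (\<lambda>X Y.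
     if X \<in> words q (m - 1) \<and> Y \<in> words q (m - 1)
     then (\<Sum>a<q. \<rho> (ins_at (p - 1) a X) (ins_at (p - 1) a Y))
     else 0)"

fun ins_seq :: "nat \<Rightarrow> nat \<Rightarrow> (nat \<times> (nat \<Rightarrow> nat \<Rightarrow> complex)) list \<Rightarrow> op \<Rightarrow> op" where
  "ins_seq q m [] \<rho> = \<rho>"
| "ins_seq q m ((p, s) # rest) \<rho> = ins_seq q (Suc m) rest (In_map q m p s \<rho>)"

text \<open>Ins^N_{P,\<sigma>} for P = {p_1 < ... < p_t} and \<sigma> = \<sigma>_1 \<otimes> ... \<otimes> \<sigma>_t
  (the product state is given by the list of its factors).\<close>
definition Ins_P :: "nat \<Rightarrow> nat \<Rightarrow> nat set \<Rightarrow> (nat \<Rightarrow> nat \<Rightarrow> complex) list \<Rightarrow> op \<Rightarrow> op" where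
  "Ins_P q N P \<sigma> = ins_seq q N (zip (sorted_list_of_set P) \<sigma>)"

fun era_seq :: "nat \<Rightarrow> nat \<Rightarrow> nat list \<Rightarrow> op \<Rightarrow> op" where
  "era_seq q m [] \<rho> = \<rho>"
| "era_seq q m (p # rest) \<rho> = era_seq q (m - 1) rest (Tr_map q m p \<rho>)"

definition Era_P :: "nat \<Rightarrow> nat \<Rightarrow> nat set \<Rightarrow> op \<Rightarrow> op" where
  "Era_P q N P = era_seq q N (rev (sorted_list_of_set P))"

definition tsubsets :: "nat \<Rightarrow> nat \<Rightarrow> nat set set" where
  "tsubsets n t = {P. P \<subseteq> {1..n} \<and> card P = t}"

text \<open>Data of a t-insertion channel on m qudits: a probability measure \<mu> on
  product states \<sigma> = \<sigma>_1 \<otimes> ... \<otimes> \<sigma>_t (lists of t qudit states), and for each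
  \<sigma> a probability distribution p_\<sigma> on t-subsets of [m+t]; the integrands
  must be integrable so that the integral is meaningful.\<close>
definition ins_chan :: "nat \<Rightarrow> nat \<Rightarrow> nat \<Rightarrow> (nat \<Rightarrow> nat \<Rightarrow> complex) list measure
    \<Rightarrow> ((nat \<Rightarrow> nat \<Rightarrow> complex) list \<Rightarrow> nat set \<Rightarrow> real) \<Rightarrow> op \<Rightarrow> op" where
  "ins_chan q m t \<mu> p \<rho> = (\<lambda>X Y.
     integral\<^sup>L \<mu> (\<lambda>\<sigma>. \<Sum>P\<in>tsubsets (m + t) t. complex_of_real (p \<sigma> P) * Ins_P q m P \<sigma> \<rho> X Y))"

definition ins_params :: "nat \<Rightarrow> nat \<Rightarrow> nat \<Rightarrow> (nat \<Rightarrow> nat \<Rightarrow> complex) list measure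
    \<Rightarrow> ((nat \<Rightarrow> nat \<Rightarrow> complex) list \<Rightarrow> nat set \<Rightarrow> real) \<Rightarrow> bool" where
  "ins_params q m t \<mu> p \<longleftrightarrow>
     prob_space \<mu> \<and>
     (\<forall>\<sigma>\<in>space \<mu>. length \<sigma> = t \<and> (\<forall>s\<in>set \<sigma>. qudit_state q s)) \<and>
     (\<forall>\<sigma>\<in>space \<mu>. (\<forall>P\<in>tsubsets (m + t) t. 0 \<le> p \<sigma> P) \<and> (\<Sum>P\<in>tsubsets (m + t) t. p \<sigma> P) = 1) \<and>
     (\<forall>\<rho>\<in>ops q m. \<forall>X Y. integrable \<mu>
        (\<lambda>\<sigma>. \<Sum>P\<in>tsubsets (m + t) t. complex_of_real (p \<sigma> P) * Ins_P q m P \<sigma> \<rho> X Y))"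

definition del_chan :: "nat \<Rightarrow> nat \<Rightarrow> nat \<Rightarrow> (nat set \<Rightarrow> real) \<Rightarrow> op \<Rightarrow> op" where
  "del_chan q N t p \<rho> = (\<lambda>X Y. \<Sum>P\<in>tsubsets N t. complex_of_real (p P) * Era_P q N P \<rho> X Y)"

definition del_params :: "nat \<Rightarrow> nat \<Rightarrow> (nat set \<Rightarrow> real) \<Rightarrow> bool" where
  "del_params N t p \<longleftrightarrow>
     (\<forall>P\<in>tsubsets N t. 0 \<le> p P) \<and> (\<Sum>P\<in>tsubsets N t. p P) = 1"

text \<open>Positivity of a block operator on C^k \<otimes> (C^q)^{\<otimes> m}, given by blocks G a b (a,b < k).\<close>
definition block_psd :: "nat \<Rightarrow> nat \<Rightarrow> nat \<Rightarrow> (nat \<Rightarrow> nat \<Rightarrow> op) \<Rightarrow> bool" where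
  "block_psd q k m G \<longleftrightarrow> psd_on ({..<k} \<times> words q m) (\<lambda>(a, X) (b, Y). G a b X Y)"

definition qchannel :: "nat \<Rightarrow> nat \<Rightarrow> nat \<Rightarrow> (op \<Rightarrow> op) \<Rightarrow> bool" where
  "qchannel q m n R \<longleftrightarrow>
     (\<forall>A\<in>ops q m. R A \<in> ops q n) \<and>
     (\<forall>A\<in>ops q m. \<forall>B\<in>ops q m. \<forall>a b :: complex.
        R (\<lambda>X Y. a * A X Y + b * B X Y) = (\<lambda>X Y. a * R A X Y + b * R B X Y)) \<and>
     (\<forall>A\<in>ops q m. trace_on (words q n) (R A) = trace_on (words q m) A) \<and>
     (\<forall>k G. (\<forall>a b. G a b \<in> ops q m) \<longrightarrow> block_psd q k m G \<longrightarrow>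
        block_psd q k n (\<lambda>a b. R (G a b)))"

definition is_subspace :: "nat \<Rightarrow> nat \<Rightarrow> vec set \<Rightarrow> bool" where
  "is_subspace q N C \<longleftrightarrow>
     (\<forall>v\<in>C. \<forall>X. X \<notin> words q N \<longrightarrow> v X = 0) \<and> (\<lambda>_. 0) \<in> C \<and>
     (\<forall>v\<in>C. \<forall>w\<in>C. \<forall>a b :: complex. (\<lambda>X. a * v X + b * w X) \<in> C)"

text \<open>\<rho> is supported on C: its range (spanned by its columns) lies in C.\<close>
definition supported_on :: "vec set \<Rightarrow> op \<Rightarrow> bool" where
  "supported_on C \<rho> \<longleftrightarrow> (\<forall>Y. (\<lambda>X. \<rho> X Y) \<in> C)"

definition insdel_code :: "nat \<Rightarrow> nat \<Rightarrow> nat \<Rightarrow> nat \<Rightarrow> vec set \<Rightarrow> bool" where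
  "insdel_code q N t1 t2 C \<longleftrightarrow>
     (\<forall>\<mu> p pd. ins_params q (N - t2) t1 \<mu> p \<and> del_params N t2 pd \<longrightarrow>
        (\<exists>R. qchannel q (N - t2 + t1) N R \<and>
           (\<forall>\<rho>. density q N \<rho> \<and> supported_on C \<rho> \<longrightarrow>
              R (ins_chan q (N - t2) t1 \<mu> p (del_chan q N t2 pd \<rho>)) = \<rho>)))"

end

theory Submission
  imports Defs
begin

text \<open>
  A basis error is a relation between words: it deletes \<open>t2\<close> prescribed letters and then inserts
  \<open>t1\<close> prescribed letters at prescribed positions. A code \<open>C\<close> corrects \<open>(t1, t2)\<close> errors iff
  \<open>\<langle>E c, F d\<rangle> = 0\<close> for all basis errors \<open>E\<close>, \<open>F\<close> and all orthogonal \<open>c\<close>, \<open>d\<close> in \<open>C\<close>.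

  Necessity: a channel recovering the uniform mixture of all basis errors sends every
  \<open>E c c\<^sup>* E\<^sup>*\<close> to a multiple of \<open>c c\<^sup>*\<close>, so orthogonal codewords cannot have overlapping images.
  Sufficiency: the sesquilinear form \<open>\<langle>E c, F d\<rangle>\<close> vanishes on orthogonal pairs, hence is a multiple of
  \<open>\<langle>c, d\<rangle>\<close> (the Knill-Laflamme condition), and orthonormalising the errors gives Kraus operators of
  one recovery that works for all positions and all inserted states at once.

  The condition depends on \<open>t1 + t2\<close> only: the relation \<open>E\<^sup>* F\<close> between two words of length \<open>N\<close> is an
  alignment that deletes \<open>k\<close> letters and inserts \<open>k\<close> letters with \<open>k \<le> t1 + t2\<close>. Conversely every
  alignment with \<open>k = min (t1 + t2) N\<close> arises in this way, because a letter of one word that is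
  missing in the other one can be explained either by a deletion on the first side or by an
  insertion on the second side. Smaller \<open>k\<close> are sums of larger ones: keeping a letter is the sum over
  \<open>b\<close> of deleting \<open>b\<close> and inserting \<open>b\<close>.
\<close>

section \<open>Orthonormal bases and positive forms\<close>

text \<open>The condition is imposed on orthogonal pairs, not as the Knill-Laflamme identity,
  because it then consists of bare equations \<open>... = 0\<close>: no constants have to be carried
  from \<open>(t1, t2)\<close> to \<open>(s1, s2)\<close>, and a sum of errors satisfies it as soon
  as its terms do. The cap \<open>min (t1 + t2) N\<close> is forced: an alignment of two words of
  length \<open>N\<close> cannot delete more than \<open>N\<close> letters. When
  \<open>t1 + t2 > N\<close>, the surplus insertions are spent on identical padding on both sides.
  For necessity one channel is enough, the one in which every basis error has the same positive
  weight; inserting maximally mixed letters makes it a mixture of basis errors. For sufficiency an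
  inserted state need not be diagonal, so cross terms between errors that insert different letters
  appear, and the recovery has to be controlled on pairs of errors. After recovery, every fixed
  pattern of erasures and insertions leaves a scalar multiple of the state. This scalar is never
  computed: trace preservation forces it to be 1.\<close>

definition ip :: "'i set \<Rightarrow> ('i \<Rightarrow> complex) \<Rightarrow> ('i \<Rightarrow> complex) \<Rightarrow> complex" where
  "ip I u v = (\<Sum>x\<in>I. cnj (u x) * v x)"

definition lin_sub :: "'i set \<Rightarrow> ('i \<Rightarrow> complex) set \<Rightarrow> bool" where
  "lin_sub I W \<longleftrightarrow> (\<forall>v\<in>W. \<forall>x. x \<notin> I \<longrightarrow> v x = 0) \<and> (\<lambda>_. 0) \<in> W \<and>
     (\<forall>v\<in>W. \<forall>w\<in>W. \<forall>a b :: complex. (\<lambda>x. a * v x + b * w x) \<in> W)"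

definition orthonormal :: "'i set \<Rightarrow> ('i \<Rightarrow> complex) set \<Rightarrow> bool" where
  "orthonormal I B \<longleftrightarrow> (\<forall>u\<in>B. \<forall>v\<in>B. ip I u v = of_bool (u = v))"

lemma ip_cnj: "cnj (ip I u v) = ip I v u"
  by (simp add: ip_def mult.commute)

lemma ip_lin_right: "ip I u (\<lambda>x. a * v x + b * w x) = a * ip I u v + b * ip I u w"
  by (simp add: ip_def sum.distrib sum_distrib_left algebra_simps)

lemma ip_lin_left: "ip I (\<lambda>x. a * v x + b * w x) u = cnj a * ip I v u + cnj b * ip I w u"
  by (simp add: ip_def sum.distrib sum_distrib_left algebra_simps)

lemma ip_diff_right: "ip I u (\<lambda>x. v x - w x) = ip I u v - ip I u w"
  by (simp add: ip_def sum_subtractf algebra_simps)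

lemma ip_scale_right: "ip I u (\<lambda>x. a * v x) = a * ip I u v"
  by (simp add: ip_def sum_distrib_left algebra_simps)

lemma ip_scale_left: "ip I (\<lambda>x. a * v x) u = cnj a * ip I v u"
  by (simp add: ip_def sum_distrib_left algebra_simps)

lemma ip_sum_right: "ip I u (\<lambda>x. \<Sum>j\<in>J. a j * v j x) = (\<Sum>j\<in>J. a j * ip I u (v j))"
  by (simp add: ip_def sum_distrib_left sum.swap[of _ J] algebra_simps)

lemma ip_sum_left: "ip I (\<lambda>x. \<Sum>j\<in>J. a j * v j x) u = (\<Sum>j\<in>J. cnj (a j) * ip I (v j) u)"
  by (simp add: ip_def sum_distrib_left sum_distrib_right sum.swap[of _ J] algebra_simps)

lemma ip_self: "ip I u u = complex_of_real (\<Sum>x\<in>I. (cmod (u x))\<^sup>2)"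
  by (simp add: ip_def complex_norm_square mult.commute del: of_real_power)

lemma ip_self_eq_0:
  assumes "finite I"
  shows "ip I u u = 0 \<longleftrightarrow> (\<forall>x\<in>I. u x = 0)"
  unfolding ip_self of_real_eq_0_iff using assms by (subst sum_nonneg_eq_0_iff) auto

lemma lin_sub_comb:
  "lin_sub I W \<Longrightarrow> v \<in> W \<Longrightarrow> w \<in> W \<Longrightarrow> (\<lambda>x. a * v x + b * w x) \<in> W"
  by (simp add: lin_sub_def)

lemma lin_sub_sum:
  assumes "lin_sub I W" "finite J" "\<And>j. j \<in> J \<Longrightarrow> v j \<in> W"
  shows "(\<lambda>x. \<Sum>j\<in>J. a j * v j x) \<in> W"
  using assms(2,3)
proof (induction J rule: finite_induct)
  case empty
  then show ?case using assms(1) by (simp add: lin_sub_def)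
next
  case (insert j J)
  then have "v j \<in> W" "(\<lambda>x. \<Sum>j\<in>J. a j * v j x) \<in> W" by auto
  then have "(\<lambda>x. a j * v j x + 1 * (\<Sum>j\<in>J. a j * v j x)) \<in> W"
    by (rule lin_sub_comb[OF assms(1)])
  then show ?case using insert.hyps by simp
qed

text \<open>Bessel's inequality for the coordinate vector at \<open>x\<close> bounds the sum of
  \<open>(cmod (b x))\<^sup>2\<close> over \<open>B\<close> by 1; summing over \<open>x\<close>
  counts every unit vector of \<open>B\<close> once.\<close>

lemma orthonormal_card_le:
  assumes "finite I" "finite B" "orthonormal I B"
  shows "card B \<le> card I"
proof -
  have le1: "(\<Sum>b\<in>B. (cmod (b x))\<^sup>2) \<le> 1" if "x \<in> I" for x
  proof -
    define s where "s = (\<Sum>b\<in>B. (cmod (b x))\<^sup>2)"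
    \<comment> \<open>The orthogonal projection of the coordinate vector at \<open>x\<close> to the
      span of \<open>B\<close>. Its squared norm and its entry at \<open>x\<close> are both
      \<open>s\<close>, whence \<open>s * s \<le> s\<close>.\<close>
    define w where "w = (\<lambda>y. \<Sum>b\<in>B. cnj (b x) * b y)"
    have wx: "w x = complex_of_real s"
      unfolding w_def s_def of_real_sum
      by (intro sum.cong refl) (simp add: complex_norm_square mult.commute del: of_real_power)
    have "ip I w w = (\<Sum>b\<in>B. \<Sum>b'\<in>B. b x * cnj (b' x) * ip I b b')"
      unfolding w_def ip_sum_right ip_sum_left
      by (subst sum.swap) (simp add: sum_distrib_left mult_ac)
    also have "\<dots> = (\<Sum>b\<in>B. \<Sum>b'\<in>B. if b = b' then b x * cnj (b' x) else 0)"
      using assms(3) by (intro sum.cong refl) (auto simp: orthonormal_def)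
    also have "\<dots> = complex_of_real s"
      unfolding s_def of_real_sum using assms(2)
      by (intro sum.cong refl) (simp add: complex_norm_square del: of_real_power)
    finally have "(\<Sum>y\<in>I. (cmod (w y))\<^sup>2) = s" unfolding ip_self of_real_eq_iff .
    moreover have "(cmod (w x))\<^sup>2 \<le> (\<Sum>y\<in>I. (cmod (w y))\<^sup>2)"
      using assms(1) that by (intro member_le_sum) auto
    ultimately have "s * s \<le> s * 1" by (simp add: wx power2_eq_square)
    moreover have "s \<ge> 0" unfolding s_def by (intro sum_nonneg) auto
    ultimately show ?thesis unfolding s_def[symmetric]
      by (metis mult_le_cancel_left_pos less_eq_real_def zero_le_one)
  qed
  have "complex_of_real (\<Sum>x\<in>I. (cmod (b x))\<^sup>2) = complex_of_real 1" if "b \<in> B" for b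
    using assms(3) that unfolding ip_self[symmetric] by (simp add: orthonormal_def)
  then have "(\<Sum>x\<in>I. (cmod (b x))\<^sup>2) = 1" if "b \<in> B" for b
    using that unfolding of_real_eq_iff by blast
  then have "real (card B) = (\<Sum>b\<in>B. \<Sum>x\<in>I. (cmod (b x))\<^sup>2)" by simp
  also have "\<dots> = (\<Sum>x\<in>I. \<Sum>b\<in>B. (cmod (b x))\<^sup>2)" by (rule sum.swap)
  also have "\<dots> \<le> (\<Sum>x\<in>I. 1)" by (intro sum_mono le1)
  finally show ?thesis by simp
qed

text \<open>Cardinalities of orthonormal sets are bounded by \<open>card I\<close>, so one of
  maximal size between \<open>B\<close> and \<open>W\<close> exists. It spans \<open>W\<close>,
  since a nonzero remainder \<open>r\<close> could be normalised and added.\<close>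

lemma orthonormal_basis_extend:
  assumes I: "finite I" and W: "lin_sub I W" and B: "finite B" "orthonormal I B" "B \<subseteq> W"
  obtains B' where "finite B'" "orthonormal I B'" "B \<subseteq> B'" "B' \<subseteq> W"
    "\<And>w. w \<in> W \<Longrightarrow> w = (\<lambda>x. \<Sum>b\<in>B'. ip I b w * b x)"
proof -
  define P where "P = (\<lambda>n. \<exists>B'. finite B' \<and> orthonormal I B' \<and> B \<subseteq> B' \<and> B' \<subseteq> W \<and> card B' = n)"
  have "P (card B)" using B unfolding P_def by blast
  moreover have "\<forall>n. P n \<longrightarrow> n \<le> card I"
    using orthonormal_card_le[OF I] unfolding P_def by blast
  ultimately obtain n where n: "P n" "\<And>m. P m \<Longrightarrow> m \<le> n"
    by (metis GreatestI_nat Greatest_le_nat)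
  then obtain B' where B': "finite B'" "orthonormal I B'" "B \<subseteq> B'" "B' \<subseteq> W" "card B' = n"
    unfolding P_def by blast
  have "w = (\<lambda>x. \<Sum>b\<in>B'. ip I b w * b x)" if "w \<in> W" for w
  proof (rule ccontr)
    define p where "p = (\<lambda>x. \<Sum>b\<in>B'. ip I b w * b x)"
    define r where "r = (\<lambda>x. w x - p x)"
    assume "w \<noteq> (\<lambda>x. \<Sum>b\<in>B'. ip I b w * b x)"
    then obtain y where y: "r y \<noteq> 0" unfolding r_def p_def by auto
    have pW: "p \<in> W" unfolding p_def by (rule lin_sub_sum[OF W B'(1)]) (use B'(4) in blast)
    have "(\<lambda>x. 1 * w x + (-1) * p x) \<in> W"
      by (rule lin_sub_comb[OF W that pW])
    then have rW: "r \<in> W" by (simp add: r_def)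
    then have yI: "y \<in> I" using W y unfolding lin_sub_def by blast
    have orth: "ip I b r = 0" if "b \<in> B'" for b
    proof -
      have "ip I b p = (\<Sum>b'\<in>B'. ip I b' w * ip I b b')"
        unfolding p_def by (rule ip_sum_right)
      also have "\<dots> = (\<Sum>b'\<in>B'. if b = b' then ip I b' w else 0)"
        using B'(2) that by (intro sum.cong refl) (auto simp: orthonormal_def)
      also have "\<dots> = ip I b w" using B'(1) that by simp
      finally show ?thesis unfolding r_def by (simp add: ip_diff_right)
    qed
    define s where "s = (\<Sum>x\<in>I. (cmod (r x))\<^sup>2)"
    have s: "ip I r r = complex_of_real s" unfolding s_def by (rule ip_self)
    have "s \<noteq> 0" using s ip_self_eq_0[OF I, of r] y yI by auto
    moreover have "s \<ge> 0" unfolding s_def by (intro sum_nonneg) auto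
    ultimately have s0: "s > 0" by simp
    define u where "u = (\<lambda>x. complex_of_real (1 / sqrt s) * r x)"
    have uu: "ip I u u = 1"
    proof -
      have "ip I u u = complex_of_real (1 / sqrt s * (1 / sqrt s) * s)"
        unfolding u_def ip_scale_left ip_scale_right s of_real_mult by (simp only: complex_cnj_complex_of_real mult_ac)
      also have "1 / sqrt s * (1 / sqrt s) * s = 1" using s0 by (simp add: field_simps)
      finally show ?thesis by simp
    qed
    have ub: "ip I b u = 0" if "b \<in> B'" for b
      unfolding u_def ip_scale_right using orth[OF that] by simp
    have bu: "ip I u b = 0" if "b \<in> B'" for b
      using ub[OF that] ip_cnj[of I b u] by simp
    have uW: "u \<in> W"
    proof -
      have "(\<lambda>x. complex_of_real (1 / sqrt s) * r x + 0 * r x) \<in> W"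
        by (rule lin_sub_comb[OF W rW rW])
      then show ?thesis by (simp add: u_def)
    qed
    have unB: "u \<notin> B'" using ub uu by force
    have "orthonormal I (insert u B')"
      using B'(2) uu ub bu unB unfolding orthonormal_def by auto
    then have "P (Suc n)" unfolding P_def using B' uW unB
      by (intro exI[of _ "insert u B'"]) auto
    then show False using n(2) by fastforce
  qed
  then show thesis using that B' by blast
qed

definition supp_space :: "'i set \<Rightarrow> ('i \<Rightarrow> complex) set" where
  "supp_space I = {v. \<forall>x. x \<notin> I \<longrightarrow> v x = 0}"

lemma lin_sub_supp_space: "lin_sub I (supp_space I)"
  by (auto simp: lin_sub_def supp_space_def)

text \<open>The completeness relation: expand the coordinate vector at \<open>y\<close> in the basis
  and read off the entry at \<open>x\<close>.\<close>

lemma full_basis_resolution: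
  assumes I: "finite I"
    and B: "\<And>w. w \<in> supp_space I \<Longrightarrow> w = (\<lambda>x. \<Sum>b\<in>B. ip I b w * b x)"
    and "x \<in> I" "y \<in> I"
  shows "(\<Sum>b\<in>B. b x * cnj (b y)) = of_bool (x = y)"
proof -
  define w where "w = (\<lambda>z. complex_of_real (of_bool (z = y)))"
  have "w \<in> supp_space I" using assms by (auto simp: w_def supp_space_def)
  have ipw: "ip I b w = cnj (b y)" for b
  proof -
    have "ip I b w = (\<Sum>x\<in>I. if x = y then cnj (b x) else 0)"
      unfolding ip_def w_def by (intro sum.cong) auto
    also have "\<dots> = cnj (b y)" using assms by simp
    finally show ?thesis .
  qed
  have "w x = (\<Sum>b\<in>B. ip I b w * b x)" using B[OF \<open>w \<in> supp_space I\<close>] by metis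
  then show ?thesis unfolding ipw by (auto simp add: w_def mult.commute)
qed

section \<open>Quadratic forms, trace and positivity\<close>

definition qform :: "'i set \<Rightarrow> ('i \<Rightarrow> 'i \<Rightarrow> complex) \<Rightarrow> ('i \<Rightarrow> complex) \<Rightarrow> complex" where
  "qform I A v = (\<Sum>X\<in>I. \<Sum>Y\<in>I. cnj (v X) * A X Y * v Y)"

lemma psd_on_qform: "psd_on I A \<longleftrightarrow> (\<forall>v. 0 \<le> qform I A v)"
  by (simp add: psd_on_def qform_def)

lemma trace_eq_sum_basis:
  assumes I: "finite I"
    and B: "\<And>w. w \<in> supp_space I \<Longrightarrow> w = (\<lambda>x. \<Sum>b\<in>B. ip I b w * b x)"
  shows "trace_on I A = (\<Sum>b\<in>B. qform I A b)"
proof -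
  have "(\<Sum>b\<in>B. qform I A b) = (\<Sum>X\<in>I. \<Sum>Y\<in>I. A X Y * (\<Sum>b\<in>B. b Y * cnj (b X)))"
    unfolding qform_def
    by (subst sum.swap, intro sum.cong refl, subst sum.swap)
       (simp add: sum_distrib_left mult_ac)
  also have "\<dots> = (\<Sum>X\<in>I. \<Sum>Y\<in>I. if X = Y then A X Y else 0)"
    by (intro sum.cong refl) (auto simp: full_basis_resolution[OF assms])
  also have "\<dots> = trace_on I A" using I by (simp add: trace_on_def)
  finally show ?thesis by simp
qed

text \<open>Complete \<open>d\<close> to an orthonormal basis: the trace is the sum of the diagonal
  values of the form, all nonnegative, and the one at \<open>d\<close> is among them.\<close>

lemma qform_le_trace:
  assumes I: "finite I" and A: "psd_on I A" and d: "d \<in> supp_space I" "ip I d d = 1"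
  shows "qform I A d \<le> trace_on I A"
proof -
  have "orthonormal I {d}" "{d} \<subseteq> supp_space I" using d by (auto simp: orthonormal_def)
  then obtain B where B: "finite B" "{d} \<subseteq> B"
    "\<And>w. w \<in> supp_space I \<Longrightarrow> w = (\<lambda>x. \<Sum>b\<in>B. ip I b w * b x)"
    by (rule orthonormal_basis_extend[OF I lin_sub_supp_space, of "{d}", rotated]) (simp, blast)
  have "trace_on I A = qform I A d + (\<Sum>b\<in>B - {d}. qform I A b)"
    using trace_eq_sum_basis[OF I B(3)] B by (simp add: sum.remove)
  moreover have "0 \<le> (\<Sum>b\<in>B - {d}. qform I A b)"
    using A by (intro sum_nonneg) (auto simp: psd_on_qform)
  ultimately show ?thesis by simp
qed

text \<open>Nonnegativity in the order on complex numbers includes being real. The form is therefore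
  real at the vector with entry 1 at \<open>X\<close> and \<open>s\<close> at \<open>Y\<close>;
  taking \<open>s\<close> among 1, -1, \<open>\<i>\<close>, \<open>-\<i>\<close> compares the
  imaginary and the real parts of the two entries.\<close>

lemma psd_hermitian:
  assumes I: "finite I" and A: "psd_on I A" and XY: "X \<in> I" "Y \<in> I"
  shows "A Y X = cnj (A X Y)"
proof (cases "X = Y")
  case True
  have "qform I A (\<lambda>z. of_bool (z = X)) = (\<Sum>U\<in>I. \<Sum>V\<in>I. if U = X \<and> V = X then A X X else 0)"
    unfolding qform_def by (intro sum.cong refl) auto
  also have "\<dots> = (\<Sum>U\<in>I. if U = X then A X X else 0)"
    using XY I by (intro sum.cong refl) auto
  also have "\<dots> = A X X" using XY I by simp
  finally have "0 \<le> A X X" using A by (metis psd_on_qform)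
  then show ?thesis using True by (simp add: less_eq_complex_def complex_eq_iff)
next
  case False
  have val: "qform I A (\<lambda>z. if z = X then 1 else if z = Y then s else 0)
     = A X X + s * A X Y + cnj s * A Y X + cnj s * s * A Y Y" for s
  proof -
    let ?v = "\<lambda>z. if z = X then 1 else if z = Y then s else 0"
    have r: "(\<Sum>V\<in>I. c * A U V * ?v V) = c * A U X + c * A U Y * s" for c U
    proof -
      have "(\<Sum>V\<in>I. c * A U V * ?v V) = (\<Sum>V\<in>{X, Y}. c * A U V * ?v V)"
        using I XY by (intro sum.mono_neutral_right) auto
      then show ?thesis using False by simp
    qed
    have "qform I A ?v = (\<Sum>U\<in>I. cnj (?v U) * A U X + cnj (?v U) * A U Y * s)"
      unfolding qform_def r ..
    also have "\<dots> = (\<Sum>U\<in>{X, Y}. cnj (?v U) * A U X + cnj (?v U) * A U Y * s)"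
      using I XY by (intro sum.mono_neutral_right) auto
    finally show ?thesis using False by (simp add: algebra_simps)
  qed
  have ge: "0 \<le> A X X + s * A X Y + cnj s * A Y X + cnj s * s * A Y Y" for s
    using A val unfolding psd_on_qform by metis
  have "Im (A X X) + Im (A Y Y) = 0" "Im (A X Y) + Im (A Y X) = 0"
    using ge[of 1] ge[of "-1"] by (auto simp: less_eq_complex_def)
  moreover have "Re (A X Y) - Re (A Y X) = 0"
    using ge[of \<i>] ge[of "-\<i>"] by (auto simp: less_eq_complex_def)
  ultimately show ?thesis by (simp add: complex_eq_iff)
qed

section \<open>Kraus maps and isometries on a code\<close>

text \<open>The Gram matrix of the errors is the same for every \<open>a\<close>, so
  orthonormalising them on one vector \<open>a0\<close> gives coefficients that work for every other
  \<open>a\<close>. Each \<open>f g\<close> is then an isometry on the code, and their ranges are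
  mutually orthogonal.\<close>

lemma knill_laflamme_isometries:
  fixes V :: "'j \<Rightarrow> 'a \<Rightarrow> 'i \<Rightarrow> complex"
  assumes I: "finite I" and J: "finite J"
    and V: "\<And>j a. j \<in> J \<Longrightarrow> a \<in> A \<Longrightarrow> V j a \<in> supp_space I"
    and gram: "\<And>i j a b. i \<in> J \<Longrightarrow> j \<in> J \<Longrightarrow> a \<in> A \<Longrightarrow> b \<in> A \<Longrightarrow>
       ip I (V i a) (V j b) = (if a = b then M i j else 0)"
  obtains G :: "('i \<Rightarrow> complex) set" and f L where
    "finite G"
    "\<And>g h a b. g \<in> G \<Longrightarrow> h \<in> G \<Longrightarrow> a \<in> A \<Longrightarrow> b \<in> A \<Longrightarrow> ip I (f g a) (f h b) = of_bool (g = h \<and> a = b)"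
    "\<And>g a. g \<in> G \<Longrightarrow> a \<in> A \<Longrightarrow> f g a \<in> supp_space I"
    "\<And>j a. j \<in> J \<Longrightarrow> a \<in> A \<Longrightarrow> V j a = (\<lambda>x. \<Sum>g\<in>G. L j g * f g a x)"
proof (cases "A = {}")
  case True
  show thesis by (rule that[of "{}" "\<lambda>_ _ _. 0" "\<lambda>_ _. 0"]) (use True in auto)
next
  case False
  then obtain a0 where a0: "a0 \<in> A" by blast
  define cmb where "cmb = (\<lambda>\<mu> a x. \<Sum>j\<in>J. \<mu> j * V j a x)"
  \<comment> \<open>Inner products of combinations of errors do not depend on \<open>a\<close>;
    hence a linear relation among the errors that holds at \<open>a0\<close> holds at every
    \<open>a\<close>.\<close>
  have ip_cmb: "ip I (cmb \<mu> a) (cmb \<nu> b) = (if a = b then ip I (cmb \<mu> a0) (cmb \<nu> a0) else 0)"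
    if "a \<in> A" "b \<in> A" for \<mu> \<nu> a b
  proof -
    have "ip I (cmb \<mu> a) (cmb \<nu> b) = (if a = b then (\<Sum>j\<in>J. \<nu> j * (\<Sum>i\<in>J. cnj (\<mu> i) * M i j)) else 0)"
      if "a \<in> A" "b \<in> A" for a b
      unfolding cmb_def ip_sum_right ip_sum_left using that by (simp add: gram cong: sum.cong)
    from this[OF that] this[OF a0 a0] show ?thesis by simp
  qed
  have cmb_supp: "cmb \<mu> a \<in> supp_space I" if "a \<in> A" for \<mu> a
    unfolding cmb_def by (rule lin_sub_sum[OF lin_sub_supp_space J V[OF _ that]])
  define W where "W = range (\<lambda>\<mu>. cmb \<mu> a0)"
  have cmb_lin: "(\<lambda>x. s * cmb \<mu> a x + t * cmb \<nu> a x) = cmb (\<lambda>j. s * \<mu> j + t * \<nu> j) a" for s t \<mu> \<nu> a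
    unfolding cmb_def by (simp add: sum.distrib sum_distrib_left algebra_simps)
  have "(\<lambda>_. 0) = cmb (\<lambda>_. 0) a0" by (simp add: cmb_def)
  then have W: "lin_sub I W"
    unfolding lin_sub_def W_def using cmb_supp[OF a0]
    by (auto simp: cmb_lin supp_space_def)
  obtain G where G: "finite G" "orthonormal I G" "G \<subseteq> W"
    "\<And>w. w \<in> W \<Longrightarrow> w = (\<lambda>x. \<Sum>b\<in>G. ip I b w * b x)"
    by (rule orthonormal_basis_extend[OF I W, of "{}"]) (auto simp: orthonormal_def)
  have "\<forall>g\<in>G. \<exists>\<mu>. g = cmb \<mu> a0" using G(3) unfolding W_def by blast
  then obtain \<mu> where \<mu>: "\<And>g. g \<in> G \<Longrightarrow> cmb (\<mu> g) a0 = g" by metis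
  define f where "f = (\<lambda>g. cmb (\<mu> g))"
  define L where "L = (\<lambda>j g. ip I g (V j a0))"
  show thesis
  proof (rule that[of G f L])
    show "finite G" by fact
    show "ip I (f g a) (f h b) = of_bool (g = h \<and> a = b)"
      if "g \<in> G" "h \<in> G" "a \<in> A" "b \<in> A" for g h a b
      using that G(2) unfolding f_def ip_cmb[OF that(3,4)] by (simp add: \<mu> orthonormal_def)
    show "f g a \<in> supp_space I" if "g \<in> G" "a \<in> A" for g a
      unfolding f_def by (rule cmb_supp[OF that(2)])
    show "V j a = (\<lambda>x. \<Sum>g\<in>G. L j g * f g a x)" if j: "j \<in> J" and a: "a \<in> A" for j a
    proof -
      \<comment> \<open>Coefficients of the relation "error \<open>j\<close> minus its expansion".
        It vanishes at \<open>a0\<close> by the choice of \<open>L\<close>, so its norm at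
        \<open>a\<close> is 0 as well.\<close>
      define \<nu> where "\<nu> = (\<lambda>i. of_bool (i = j) - (\<Sum>g\<in>G. L j g * \<mu> g i))"
      have cmb_nu: "cmb \<nu> b = (\<lambda>x. V j b x - (\<Sum>g\<in>G. L j g * f g b x))" for b
      proof
        fix x
        have "cmb \<nu> b x = (\<Sum>i\<in>J. of_bool (i = j) * V i b x) - (\<Sum>i\<in>J. (\<Sum>g\<in>G. L j g * \<mu> g i) * V i b x)"
          unfolding cmb_def \<nu>_def by (simp add: algebra_simps sum_subtractf)
        also have "(\<Sum>i\<in>J. of_bool (i = j) * V i b x) = (\<Sum>i\<in>J. if i = j then V i b x else 0)"
          by (intro sum.cong) auto
        also have "\<dots> = V j b x" using j J by simp
        also have "(\<Sum>i\<in>J. (\<Sum>g\<in>G. L j g * \<mu> g i) * V i b x) = (\<Sum>g\<in>G. L j g * f g b x)"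
          unfolding f_def cmb_def
          by (simp add: sum_distrib_left sum_distrib_right mult.assoc) (rule sum.swap)
        finally show "cmb \<nu> b x = V j b x - (\<Sum>g\<in>G. L j g * f g b x)" .
      qed
      have "V j a0 = cmb (\<lambda>i. of_bool (i = j)) a0"
      proof
        fix x
        have "cmb (\<lambda>i. of_bool (i = j)) a0 x = (\<Sum>i\<in>J. if i = j then V i a0 x else 0)"
          unfolding cmb_def by (intro sum.cong) auto
        then show "V j a0 x = cmb (\<lambda>i. of_bool (i = j)) a0 x" using j J by simp
      qed
      then have "V j a0 \<in> W" unfolding W_def by blast
      then have "V j a0 x = (\<Sum>g\<in>G. L j g * f g a0 x)" for x
        using G(4)[of "V j a0"] unfolding L_def f_def by (simp add: \<mu> fun_eq_iff cong: sum.cong)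
      then have "cmb \<nu> a0 = (\<lambda>_. 0)" unfolding cmb_nu by simp
      then have "ip I (cmb \<nu> a) (cmb \<nu> a) = 0" using ip_cmb[OF a a, of \<nu> \<nu>] by (simp add: ip_def)
      then have "cmb \<nu> a x = 0" for x
        using ip_self_eq_0[OF I, of "cmb \<nu> a"] cmb_supp[OF a, of \<nu>] unfolding supp_space_def by blast
      then show ?thesis unfolding cmb_nu by (simp add: fun_eq_iff)
    qed
  qed
qed

lemma finite_words [simp]: "finite (words q m)"
proof -
  have "words q m = {xs. set xs \<subseteq> {..<q} \<and> length xs = m}" by (auto simp: words_def)
  then show ?thesis by (simp add: finite_lists_length_eq)
qed

definition kraus_map :: "nat \<Rightarrow> nat \<Rightarrow> nat \<Rightarrow> 'k set \<Rightarrow> ('k \<Rightarrow> op) \<Rightarrow> op \<Rightarrow> op" where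
  "kraus_map q m n S K A = (\<lambda>X Y. if X \<in> words q n \<and> Y \<in> words q n then
     (\<Sum>k\<in>S. \<Sum>Z\<in>words q m. \<Sum>Z'\<in>words q m. K k X Z * A Z Z' * cnj (K k Y Z')) else 0)"

lemma sum4_swap:
  "(\<Sum>x\<in>X. \<Sum>y\<in>Y. \<Sum>z\<in>Z. \<Sum>w\<in>W. h x y z w) = (\<Sum>z\<in>Z. \<Sum>w\<in>W. \<Sum>x\<in>X. \<Sum>y\<in>Y. h x y z w)"
proof -
  have "(\<Sum>x\<in>X. \<Sum>y\<in>Y. \<Sum>z\<in>Z. \<Sum>w\<in>W. h x y z w) = (\<Sum>x\<in>X. \<Sum>z\<in>Z. \<Sum>y\<in>Y. \<Sum>w\<in>W. h x y z w)"
    by (intro sum.cong refl) (rule sum.swap)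
  also have "\<dots> = (\<Sum>z\<in>Z. \<Sum>x\<in>X. \<Sum>y\<in>Y. \<Sum>w\<in>W. h x y z w)"
    by (rule sum.swap)
  also have "\<dots> = (\<Sum>z\<in>Z. \<Sum>x\<in>X. \<Sum>w\<in>W. \<Sum>y\<in>Y. h x y z w)"
    by (intro sum.cong refl) (rule sum.swap)
  also have "\<dots> = (\<Sum>z\<in>Z. \<Sum>w\<in>W. \<Sum>x\<in>X. \<Sum>y\<in>Y. h x y z w)"
    by (intro sum.cong refl) (rule sum.swap)
  finally show ?thesis .
qed

lemma sandwich_sum:
  fixes c d :: "'x \<Rightarrow> 'a :: comm_semiring_0"
  shows "(\<Sum>x\<in>X. \<Sum>y\<in>Y. c x * (\<Sum>z\<in>Z. \<Sum>z'\<in>Z. p x z * g z z' * r y z') * d y)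
       = (\<Sum>z\<in>Z. \<Sum>z'\<in>Z. (\<Sum>x\<in>X. c x * p x z) * g z z' * (\<Sum>y\<in>Y. r y z' * d y))"
proof -
  have "(\<Sum>x\<in>X. \<Sum>y\<in>Y. c x * (\<Sum>z\<in>Z. \<Sum>z'\<in>Z. p x z * g z z' * r y z') * d y)
     = (\<Sum>x\<in>X. \<Sum>y\<in>Y. \<Sum>z\<in>Z. \<Sum>z'\<in>Z. (c x * p x z) * g z z' * (r y z' * d y))"
    by (simp add: sum_distrib_left sum_distrib_right mult_ac)
  also have "\<dots> = (\<Sum>z\<in>Z. \<Sum>z'\<in>Z. \<Sum>x\<in>X. \<Sum>y\<in>Y. (c x * p x z) * g z z' * (r y z' * d y))"
    by (rule sum4_swap)
  also have "\<dots> = (\<Sum>z\<in>Z. \<Sum>z'\<in>Z. (\<Sum>x\<in>X. c x * p x z) * g z z' * (\<Sum>y\<in>Y. r y z' * d y))"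
    by (simp only: sum_distrib_left sum_distrib_right)
       (intro sum.cong refl sum.swap)
  finally show ?thesis .
qed

lemma sum3_rotate: "(\<Sum>x\<in>X. \<Sum>y\<in>Y. \<Sum>i\<in>S. h x y i) = (\<Sum>i\<in>S. \<Sum>x\<in>X. \<Sum>y\<in>Y. h x y i)"
proof -
  have "(\<Sum>x\<in>X. \<Sum>y\<in>Y. \<Sum>i\<in>S. h x y i) = (\<Sum>x\<in>X. \<Sum>i\<in>S. \<Sum>y\<in>Y. h x y i)"
    by (intro sum.cong refl) (rule sum.swap)
  also have "\<dots> = (\<Sum>i\<in>S. \<Sum>x\<in>X. \<Sum>y\<in>Y. h x y i)" by (rule sum.swap)
  finally show ?thesis .
qed

lemma sum4_reorder:
  "(\<Sum>a\<in>A. \<Sum>X\<in>S. \<Sum>b\<in>B. \<Sum>Y\<in>T. h a X b Y) = (\<Sum>a\<in>A. \<Sum>b\<in>B. \<Sum>X\<in>S. \<Sum>Y\<in>T. h a X b Y)"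
  by (intro sum.cong refl) (rule sum.swap)

text \<open>The assumption is the usual completeness of the Kraus operators and gives trace
  preservation. For complete positivity, every Kraus operator pulls the test vector back, and the
  form of the image is a sum of values of the form of \<open>G\<close>.\<close>

lemma qchannel_kraus:
  assumes res: "\<And>Z Z'. Z \<in> words q m \<Longrightarrow> Z' \<in> words q m \<Longrightarrow>
      (\<Sum>k\<in>S. \<Sum>X\<in>words q n. K k X Z * cnj (K k X Z')) = of_bool (Z = Z')"
  shows "qchannel q m n (kraus_map q m n S K)"
  unfolding qchannel_def
proof (intro conjI ballI allI impI)
  show "kraus_map q m n S K A \<in> ops q n" for A
    by (auto simp: kraus_map_def ops_def)
  show "kraus_map q m n S K (\<lambda>X Y. a * A X Y + b * B X Y) =
      (\<lambda>X Y. a * kraus_map q m n S K A X Y + b * kraus_map q m n S K B X Y)" for A B a b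
    unfolding kraus_map_def
    by (intro ext) (simp add: sum.distrib sum_distrib_left algebra_simps)
  show "trace_on (words q n) (kraus_map q m n S K A) = trace_on (words q m) A" for A
  proof -
    have "trace_on (words q n) (kraus_map q m n S K A)
        = (\<Sum>X\<in>words q n. \<Sum>k\<in>S. \<Sum>Z\<in>words q m. \<Sum>Z'\<in>words q m. K k X Z * A Z Z' * cnj (K k X Z'))"
      by (simp add: trace_on_def kraus_map_def)
    also have "\<dots> = (\<Sum>Z\<in>words q m. \<Sum>Z'\<in>words q m. \<Sum>X\<in>words q n. \<Sum>k\<in>S. K k X Z * A Z Z' * cnj (K k X Z'))"
      by (rule sum4_swap)
    also have "\<dots> = (\<Sum>Z\<in>words q m. \<Sum>Z'\<in>words q m. A Z Z' * (\<Sum>k\<in>S. \<Sum>X\<in>words q n. K k X Z * cnj (K k X Z')))"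
      by (intro sum.cong refl, subst sum.swap) (simp add: sum_distrib_left mult_ac)
    also have "\<dots> = (\<Sum>Z\<in>words q m. \<Sum>Z'\<in>words q m. if Z = Z' then A Z Z' else 0)"
      by (intro sum.cong refl) (auto simp: res)
    also have "\<dots> = trace_on (words q m) A" by (simp add: trace_on_def)
    finally show ?thesis .
  qed
  show "block_psd q k n (\<lambda>a b. kraus_map q m n S K (G a b))"
    if G: "block_psd q k m G" for k and G :: "nat \<Rightarrow> nat \<Rightarrow> op"
    unfolding block_psd_def psd_on_def
  proof
    fix v :: "nat \<times> nat list \<Rightarrow> complex"
    \<comment> \<open>The pullback of \<open>v\<close> under the adjoint of the \<open>i\<close>-th
      Kraus operator, acting trivially on the block index.\<close>
    define w where "w = (\<lambda>i (a, Z). \<Sum>Y\<in>words q n. cnj (K i Y Z) * v (a, Y))"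
    have "(\<Sum>X\<in>{..<k} \<times> words q n. \<Sum>Y\<in>{..<k} \<times> words q n. cnj (v X) *
        (case X of (a, X) \<Rightarrow> \<lambda>(b, Y). kraus_map q m n S K (G a b) X Y) Y * v Y)
      = (\<Sum>a<k. \<Sum>X\<in>words q n. \<Sum>b<k. \<Sum>Y\<in>words q n. cnj (v (a, X)) *
          (\<Sum>i\<in>S. \<Sum>Z\<in>words q m. \<Sum>Z'\<in>words q m. K i X Z * G a b Z Z' * cnj (K i Y Z')) * v (b, Y))"
      by (simp add: sum.cartesian_product' kraus_map_def)
    also have "\<dots> = (\<Sum>a<k. \<Sum>b<k. \<Sum>X\<in>words q n. \<Sum>Y\<in>words q n. cnj (v (a, X)) *
          (\<Sum>i\<in>S. \<Sum>Z\<in>words q m. \<Sum>Z'\<in>words q m. K i X Z * G a b Z Z' * cnj (K i Y Z')) * v (b, Y))"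
      by (rule sum4_reorder)
    also have "\<dots> = (\<Sum>a<k. \<Sum>b<k. \<Sum>i\<in>S. \<Sum>X\<in>words q n. \<Sum>Y\<in>words q n. cnj (v (a, X)) *
          (\<Sum>Z\<in>words q m. \<Sum>Z'\<in>words q m. K i X Z * G a b Z Z' * cnj (K i Y Z')) * v (b, Y))"
      by (intro sum.cong refl)
         (simp only: sum_distrib_left[of _ _ S] sum_distrib_right[of _ S], rule sum3_rotate)
    also have "\<dots> = (\<Sum>i\<in>S. \<Sum>a<k. \<Sum>b<k. \<Sum>X\<in>words q n. \<Sum>Y\<in>words q n. cnj (v (a, X)) *
          (\<Sum>Z\<in>words q m. \<Sum>Z'\<in>words q m. K i X Z * G a b Z Z' * cnj (K i Y Z')) * v (b, Y))"
      by (rule sum3_rotate)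
    also have "\<dots> = (\<Sum>i\<in>S. \<Sum>a<k. \<Sum>b<k. \<Sum>Z\<in>words q m. \<Sum>Z'\<in>words q m.
          cnj (w i (a, Z)) * G a b Z Z' * w i (b, Z'))"
      unfolding sandwich_sum by (simp add: w_def mult.commute)
    also have "\<dots> = (\<Sum>i\<in>S. \<Sum>a<k. \<Sum>Z\<in>words q m. \<Sum>b<k. \<Sum>Z'\<in>words q m.
          cnj (w i (a, Z)) * G a b Z Z' * w i (b, Z'))"
      by (intro sum.cong[OF refl] sum4_reorder[symmetric])
    also have "\<dots> = (\<Sum>i\<in>S. \<Sum>X\<in>{..<k} \<times> words q m. \<Sum>Y\<in>{..<k} \<times> words q m. cnj (w i X) *
        (case X of (a, X) \<Rightarrow> \<lambda>(b, Y). G a b X Y) Y * w i Y)"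
      by (simp add: sum.cartesian_product')
    also have "\<dots> \<ge> 0"
      using G unfolding block_psd_def psd_on_def by (intro sum_nonneg[of S]) blast
    finally show "0 \<le> (\<Sum>X\<in>{..<k} \<times> words q n. \<Sum>Y\<in>{..<k} \<times> words q n. cnj (v X) *
        (case X of (a, X) \<Rightarrow> \<lambda>(b, Y). kraus_map q m n S K (G a b) X Y) Y * v Y)" .
  qed
qed

section \<open>Edit scripts\<close>

text \<open>Scripts describe basis errors letter by letter, from left to right. With position sets,
  composing two errors would mean renumbering positions; with scripts it is a recursion on the
  leading edits.\<close>

datatype edit = Keep | Del nat | Ins nat

fun runs :: "edit list \<Rightarrow> nat list \<Rightarrow> nat list \<Rightarrow> bool" where
  "runs [] X Z \<longleftrightarrow> X = [] \<and> Z = []"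
| "runs (Keep # e) X Z \<longleftrightarrow> X \<noteq> [] \<and> Z \<noteq> [] \<and> hd X = hd Z \<and> runs e (tl X) (tl Z)"
| "runs (Del a # e) X Z \<longleftrightarrow> X \<noteq> [] \<and> hd X = a \<and> runs e (tl X) Z"
| "runs (Ins b # e) X Z \<longleftrightarrow> Z \<noteq> [] \<and> hd Z = b \<and> runs e X (tl Z)"

fun dels :: "edit list \<Rightarrow> nat list" where
  "dels [] = []"
| "dels (Del a # e) = a # dels e"
| "dels (Keep # e) = dels e"
| "dels (Ins b # e) = dels e"

fun inss :: "edit list \<Rightarrow> nat list" where
  "inss [] = []"
| "inss (Ins b # e) = b # inss e"
| "inss (Keep # e) = inss e"
| "inss (Del a # e) = inss e"

fun keeps :: "edit list \<Rightarrow> nat" where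
  "keeps [] = 0"
| "keeps (Keep # e) = Suc (keeps e)"
| "keeps (Del a # e) = keeps e"
| "keeps (Ins b # e) = keeps e"

definition script :: "nat \<Rightarrow> nat \<Rightarrow> nat \<Rightarrow> nat \<Rightarrow> edit list \<Rightarrow> bool" where
  "script q k d i e \<longleftrightarrow> keeps e = k \<and> length (dels e) = d \<and> length (inss e) = i \<and>
     (\<forall>x\<in>set (dels e) \<union> set (inss e). x < q)"

lemma runs_length: "runs e X Z \<Longrightarrow> length X = keeps e + length (dels e) \<and> length Z = keeps e + length (inss e)"
proof (induction e X Z rule: runs.induct)
  case (2 e X Z) then show ?case by (cases X; cases Z) auto
next
  case (3 a e X Z) then show ?case by (cases X) auto
next
  case (4 b e X Z) then show ?case by (cases Z) auto
qed auto

text \<open>Makes the intermediate word in \<open>connects\<close> unique, so that the product of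
  two 0/1 matrices of errors again has entries 0 and 1.\<close>

lemma runs_functional: "runs e X Z \<Longrightarrow> runs e X Z' \<Longrightarrow> Z = Z'"
proof (induction e X Z arbitrary: Z' rule: runs.induct)
  case (2 e X Z) then show ?case by (cases Z; cases Z') auto
next
  case (4 b e X Z) then show ?case by (cases Z; cases Z') auto
qed auto

lemma runs_set: "runs e X Z \<Longrightarrow> set Z \<subseteq> set X \<union> set (inss e)"
proof (induction e X Z rule: runs.induct)
  case (2 e X Z) then show ?case by (cases X; cases Z) auto
next
  case (3 a e X Z) then show ?case by (cases X) auto
next
  case (4 b e X Z) then show ?case by (cases Z) auto
qed auto

section \<open>Composing one script with the reverse of another\<close>

definition connects :: "edit list \<Rightarrow> edit list \<Rightarrow> nat list \<Rightarrow> nat list \<Rightarrow> bool" where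
  "connects e f X Y \<longleftrightarrow> (\<exists>Z. runs e X Z \<and> runs f Y Z)"

lemma connects_Nil: "connects [] [] X Y \<longleftrightarrow> X = [] \<and> Y = []"
  by (auto simp: connects_def)

lemma connects_Del_left: "connects (Del a # e) f X Y \<longleftrightarrow> X \<noteq> [] \<and> hd X = a \<and> connects e f (tl X) Y"
  by (auto simp: connects_def)

lemma connects_Del_right: "connects e (Del b # f) X Y \<longleftrightarrow> Y \<noteq> [] \<and> hd Y = b \<and> connects e f X (tl Y)"
  by (auto simp: connects_def)

lemma ex_Cons: "(\<exists>Z. Z \<noteq> [] \<and> P (hd Z) (tl Z)) \<longleftrightarrow> (\<exists>z Z. P z Z)"
  by (metis list.distinct(1) list.sel(1,3))

lemma connects_Keep_Keep:
  "connects (Keep # e) (Keep # f) X Y \<longleftrightarrow> X \<noteq> [] \<and> Y \<noteq> [] \<and> hd X = hd Y \<and> connects e f (tl X) (tl Y)"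
  using ex_Cons[of "\<lambda>z Z. hd X = z \<and> hd Y = z \<and> runs e (tl X) Z \<and> runs f (tl Y) Z"]
  by (auto simp: connects_def)

lemma connects_Keep_Ins:
  "connects (Keep # e) (Ins b # f) X Y \<longleftrightarrow> X \<noteq> [] \<and> hd X = b \<and> connects e f (tl X) Y"
  using ex_Cons[of "\<lambda>z Z. hd X = z \<and> z = b \<and> runs e (tl X) Z \<and> runs f Y Z"]
  by (auto simp: connects_def)

lemma connects_Ins_Keep:
  "connects (Ins b # e) (Keep # f) X Y \<longleftrightarrow> Y \<noteq> [] \<and> hd Y = b \<and> connects e f X (tl Y)"
  using ex_Cons[of "\<lambda>z Z. hd Y = z \<and> z = b \<and> runs e X Z \<and> runs f (tl Y) Z"]
  by (auto simp: connects_def)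

lemma connects_Ins_Ins:
  "connects (Ins b # e) (Ins b' # f) X Y \<longleftrightarrow> b = b' \<and> connects e f X Y"
  using ex_Cons[of "\<lambda>z Z. z = b' \<and> z = b \<and> runs e X Z \<and> runs f Y Z"]
  by (auto simp: connects_def)

lemmas connects_simps = connects_Nil connects_Del_left connects_Del_right connects_Keep_Keep
  connects_Keep_Ins connects_Ins_Keep connects_Ins_Ins

lemma connects_one_sided:
  "\<not> connects [] (Keep # f) X Y" "\<not> connects [] (Ins b # f) X Y"
  "\<not> connects (Keep # e) [] X Y" "\<not> connects (Ins b # e) [] X Y"
  by (auto simp: connects_def)

text \<open>A letter of \<open>X\<close> that \<open>h\<close> deletes was either deleted by
  \<open>e\<close>, or kept by \<open>e\<close> and then explained as an insertion of
  \<open>f\<close>; this is the bound. The two equations with \<open>keeps\<close> fix the lengths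
  of the words that \<open>h\<close> relates to those that \<open>e\<close> and \<open>f\<close>
  read.\<close>

definition composite :: "edit list \<Rightarrow> edit list \<Rightarrow> edit list \<Rightarrow> bool" where
  "composite e f h \<longleftrightarrow> (\<forall>X Y. connects e f X Y \<longleftrightarrow> runs h X Y) \<and>
     length (dels h) \<le> length (dels e) + length (inss f) \<and>
     keeps h + length (dels h) = keeps e + length (dels e) \<and>
     keeps h + length (inss h) = keeps f + length (dels f) \<and>
     set (dels h) \<union> set (inss h) \<subseteq> set (dels e) \<union> set (inss e) \<union> set (dels f) \<union> set (inss f)"

text \<open>A deletion leaves the intermediate word alone and can be peeled off from either side.
  Otherwise both leading edits write the same letter of that word and are matched. A clash of
  inserted letters, or one script ending too early, makes the relation empty. Only one script may
  shrink, so the induction is on the sum of the lengths.\<close>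

lemma composite_exists:
  "(\<forall>X Y. \<not> connects e f X Y) \<or> (\<exists>h. composite e f h)"
proof (induction "length e + length f" arbitrary: e f rule: less_induct)
  case less
  consider (nil) "e = []" "f = []"
    | (dl) a e' where "e = Del a # e'"
    | (dr) b f' where "f = Del b # f'"
    | (kk) e' f' where "e = Keep # e'" "f = Keep # f'"
    | (ki) e' b f' where "e = Keep # e'" "f = Ins b # f'"
    | (ik) e' b f' where "e = Ins b # e'" "f = Keep # f'"
    | (ii) e' b f' b' where "e = Ins b # e'" "f = Ins b' # f'"
    | (none) "\<forall>X Y. \<not> connects e f X Y"
  proof (cases e)
    case Nil
    show ?thesis
    proof (cases f)
      case (Cons y f') then show ?thesis using Nil that by (cases y) (auto simp: connects_one_sided)
    qed (use Nil that in auto)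
  next
    case e: (Cons x e')
    show ?thesis
    proof (cases f)
      case Nil then show ?thesis using e that by (cases x) (auto simp: connects_one_sided)
    next
      case (Cons y f') then show ?thesis using e that by (cases x; cases y) auto
    qed
  qed
  then show ?case
  proof cases
    case nil
    then have "composite e f []" by (auto simp: composite_def connects_simps)
    then show ?thesis by blast
  next
    case dl
    have "composite e f (Del a # h)" if "composite e' f h" for h
      using that by (auto simp: dl composite_def connects_simps)
    moreover have "\<not> connects e f X Y" if "\<forall>X Y. \<not> connects e' f X Y" for X Y
      using that by (simp add: dl connects_simps)
    ultimately show ?thesis using less[of e' f] dl by auto
  next
    case dr
    have "composite e f (Ins b # h)" if "composite e f' h" for h
      using that by (auto simp: dr composite_def connects_simps)
    moreover have "\<not> connects e f X Y" if "\<forall>X Y. \<not> connects e f' X Y" for X Y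
      using that by (simp add: dr connects_simps)
    ultimately show ?thesis using less[of e f'] dr by auto
  next
    case kk
    have "composite e f (Keep # h)" if "composite e' f' h" for h
      using that by (auto simp: kk composite_def connects_simps)
    moreover have "\<not> connects e f X Y" if "\<forall>X Y. \<not> connects e' f' X Y" for X Y
      using that by (simp add: kk connects_simps)
    ultimately show ?thesis using less[of e' f'] kk by auto
  next
    case ki
    have "composite e f (Del b # h)" if "composite e' f' h" for h
      using that by (auto simp: ki composite_def connects_simps)
    moreover have "\<not> connects e f X Y" if "\<forall>X Y. \<not> connects e' f' X Y" for X Y
      using that by (simp add: ki connects_simps)
    ultimately show ?thesis using less[of e' f'] ki by auto
  next
    case ik
    have "composite e f (Ins b # h)" if "composite e' f' h" for h
      using that by (auto simp: ik composite_def connects_simps)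
    moreover have "\<not> connects e f X Y" if "\<forall>X Y. \<not> connects e' f' X Y" for X Y
      using that by (simp add: ik connects_simps)
    ultimately show ?thesis using less[of e' f'] ik by auto
  next
    case ii
    \<comment> \<open>Two equal insertions cancel and leave nothing in \<open>h\<close>: the only
      case in which the bound on the deletions becomes strict.\<close>
    have "composite e f h" if "composite e' f' h" "b = b'" for h
      using that by (auto simp: ii composite_def connects_simps)
    moreover have "\<not> connects e f X Y" if "(\<forall>X Y. \<not> connects e' f' X Y) \<or> b \<noteq> b'" for X Y
      using that by (auto simp: ii connects_simps)
    ultimately show ?thesis using less[of e' f'] ii by auto
  next
    case none then show ?thesis by blast
  qed
qed

lemma connects_replicate_Ins:
  "connects (replicate j (Ins c)) (replicate j (Ins c)) X Y \<longleftrightarrow> X = [] \<and> Y = []"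
  by (induction j) (auto simp: connects_simps)

lemma replicate_Ins_counts:
  "keeps (replicate j (Ins c)) = 0" "dels (replicate j (Ins c)) = []" "inss (replicate j (Ins c)) = replicate j c"
  by (induction j) auto

text \<open>\<open>m\<close> and \<open>n\<close> are the deletion budgets of \<open>e\<close> and
  \<open>f\<close>, and \<open>j\<close> is the amount of common padding. The counts are stated
  additively to avoid truncated subtraction; \<open>insert 0\<close> accounts for the padding
  letter.\<close>

definition factors :: "edit list \<Rightarrow> nat \<Rightarrow> nat \<Rightarrow> nat \<Rightarrow> edit list \<Rightarrow> edit list \<Rightarrow> bool" where
  "factors h j m n e f \<longleftrightarrow> (\<forall>X Y. connects e f X Y \<longleftrightarrow> runs h X Y) \<and>
     length (dels e) = m \<and> length (dels f) = n \<and>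
     length (inss e) + n = length (inss h) + j \<and> length (inss f) + m = length (dels h) + j \<and>
     keeps e + m = keeps h + length (dels h) \<and> keeps f + n = keeps h + length (inss h) \<and>
     set (dels e) \<union> set (inss e) \<union> set (dels f) \<union> set (inss f) \<subseteq> insert 0 (set (dels h) \<union> set (inss h))"

text \<open>A letter deleted by \<open>h\<close> is either deleted by \<open>e\<close> or inserted by \<open>f\<close>, and dually for the
  letters inserted by \<open>h\<close>; the \<open>j\<close> spare insertions are spent on common padding.\<close>

lemma factors_exists:
  "m \<le> length (dels h) \<Longrightarrow> n \<le> length (inss h) \<Longrightarrow> \<exists>e f. factors h j m n e f"
proof (induction h arbitrary: m n)
  case Nil
  \<comment> \<open>Both budgets are 0 here. The padding forms the end of the intermediate word, and
    its letter \<open>0\<close> is a legal letter once \<open>q > 0\<close>.\<close>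
  then have "factors [] j m n (replicate j (Ins 0)) (replicate j (Ins 0))"
    by (auto simp: factors_def connects_replicate_Ins replicate_Ins_counts)
  then show ?case by blast
next
  case (Cons x h)
  show ?case
  proof (cases x)
    case Keep
    then obtain e f where "factors h j m n e f" using Cons by force
    then have "factors (x # h) j m n (Keep # e) (Keep # f)"
      by (auto simp: Keep factors_def connects_simps)
    then show ?thesis by blast
  next
    case (Del a)
    show ?thesis
    \<comment> \<open>The budget is spent greedily: while it lasts \<open>e\<close> deletes the
      letter, afterwards \<open>f\<close> inserts it.\<close>
    proof (cases m)
      case 0
      then obtain e f where "factors h j m n e f" using Cons Del by force
      then have "factors (x # h) j m n (Keep # e) (Ins a # f)"
        using 0 by (auto simp: Del factors_def connects_simps)
      then show ?thesis by blast
    next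
      case (Suc m')
      then obtain e f where "factors h j m' n e f" using Cons Del by force
      then have "factors (x # h) j m n (Del a # e) f"
        using Suc by (auto simp: Del factors_def connects_simps)
      then show ?thesis by blast
    qed
  next
    case (Ins b)
    show ?thesis
    proof (cases n)
      case 0
      then obtain e f where "factors h j m n e f" using Cons Ins by force
      then have "factors (x # h) j m n (Ins b # e) (Keep # f)"
        using 0 by (auto simp: Ins factors_def connects_simps)
      then show ?thesis by blast
    next
      case (Suc n')
      then obtain e f where "factors h j m n' e f" using Cons Ins by force
      then have "factors (x # h) j m n e (Del b # f)"
        using Suc by (auto simp: Ins factors_def connects_simps)
      then show ?thesis by blast
    qed
  qed
qed

lemma keeps_split: "keeps e > 0 \<Longrightarrow> \<exists>e1 e2. e = e1 @ Keep # e2"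
proof (induction e)
  case (Cons x e)
  show ?case
  proof (cases x)
    case Keep then show ?thesis by blast
  next
    case (Del a) then show ?thesis using Cons by (metis append_Cons keeps.simps(3))
  next
    case (Ins b) then show ?thesis using Cons by (metis append_Cons keeps.simps(4))
  qed
qed simp

lemma edit_counts_append:
  "keeps (e @ f) = keeps e + keeps f" "dels (e @ f) = dels e @ dels f" "inss (e @ f) = inss e @ inss f"
  by (induction e rule: keeps.induct; simp)+

text \<open>The identity on one letter is the sum of the projections to the basis letters. The bound
  on the letters of \<open>X\<close> guarantees that the kept letter is one of the summands, and it
  is the only one that contributes.\<close>

lemma runs_Keep_expand:
  assumes "\<forall>x\<in>set X. x < q"
  shows "(of_bool (runs (e1 @ Keep # e2) X Y) :: complex)
     = (\<Sum>b<q. of_bool (runs (e1 @ Del b # Ins b # e2) X Y))"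
  using assms
proof (induction e1 arbitrary: X Y)
  case Nil
  show ?case
  proof (cases "X \<noteq> [] \<and> Y \<noteq> [] \<and> hd X = hd Y \<and> runs e2 (tl X) (tl Y)")
    case True
    then have "hd X < q" using Nil by (meson hd_in_set)
    have "(\<Sum>b<q. of_bool (runs (Del b # Ins b # e2) X Y)) = (\<Sum>b<q. if b = hd X then 1 else (0::complex))"
      using True by (intro sum.cong) auto
    then show ?thesis using True \<open>hd X < q\<close> by simp
  next
    case False
    then have "\<not> runs (Del b # Ins b # e2) X Y" for b by auto
    then show ?thesis using False by auto
  qed
next
  case (Cons x e1)
  show ?case
  proof (cases "X = []")
    case True
    then show ?thesis using Cons.IH[of "[]" "tl Y"] by (cases x) (auto split: if_splits)
  next
    case False
    then have "\<forall>x\<in>set (tl X). x < q" using Cons.prems by (auto dest: list.set_sel(2))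
    then show ?thesis using Cons.IH[of "tl X" Y] Cons.IH[of "tl X" "tl Y"] Cons.IH[of X "tl Y"] Cons.prems
      by (cases x) auto
  qed
qed

text \<open>The sesquilinear form of the 0/1 matrix of \<open>r\<close>, conjugate-linear in
  \<open>c\<close>. For \<open>connects e f\<close> it is the inner product of two erroneous
  codewords, see \<open>ip_err_script\<close>.\<close>

definition rel_form :: "nat \<Rightarrow> nat \<Rightarrow> (nat list \<Rightarrow> nat list \<Rightarrow> bool) \<Rightarrow> vec \<Rightarrow> vec \<Rightarrow> complex" where
  "rel_form q N r c d = (\<Sum>X\<in>words q N. \<Sum>Y\<in>words q N. of_bool (r X Y) * (cnj (c X) * d Y))"

lemma rel_form_Keep_expand:
  "rel_form q N (runs (e1 @ Keep # e2)) c d = (\<Sum>b<q. rel_form q N (runs (e1 @ Del b # Ins b # e2)) c d)"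
proof -
  have "rel_form q N (runs (e1 @ Keep # e2)) c d = (\<Sum>X\<in>words q N. \<Sum>Y\<in>words q N. \<Sum>b<q.
      of_bool (runs (e1 @ Del b # Ins b # e2) X Y) * (cnj (c X) * d Y))"
    unfolding rel_form_def
  proof (intro sum.cong refl)
    fix X Y assume "X \<in> words q N"
    then have "\<forall>x\<in>set X. x < q" by (auto simp: words_def)
    from runs_Keep_expand[OF this, of e1 e2 Y]
    show "of_bool (runs (e1 @ Keep # e2) X Y) * (cnj (c X) * d Y)
      = (\<Sum>b<q. of_bool (runs (e1 @ Del b # Ins b # e2) X Y) * (cnj (c X) * d Y))"
      by (simp add: sum_distrib_right)
  qed
  also have "\<dots> = (\<Sum>b<q. rel_form q N (runs (e1 @ Del b # Ins b # e2)) c d)"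
    unfolding rel_form_def by (rule sum3_rotate)
  finally show ?thesis .
qed

section \<open>The orthogonality condition depends on \<open>t1 + t2\<close> only\<close>

definition script_orth :: "nat \<Rightarrow> nat \<Rightarrow> nat \<Rightarrow> vec \<Rightarrow> vec \<Rightarrow> bool" where
  "script_orth q N k c d \<longleftrightarrow> (\<forall>h. script q (N - k) k k h \<longrightarrow> rel_form q N (runs h) c d = 0)"

definition pair_orth :: "nat \<Rightarrow> nat \<Rightarrow> nat \<Rightarrow> nat \<Rightarrow> vec \<Rightarrow> vec \<Rightarrow> bool" where
  "pair_orth q N s1 s2 c d \<longleftrightarrow> (\<forall>e f. script q (N - s2) s2 s1 e \<longrightarrow> script q (N - s2) s2 s1 f \<longrightarrow>
     rel_form q N (connects e f) c d = 0)"

text \<open>Since \<open>k < N\<close>, the script still keeps some letter; expanding it turns one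
  \<open>Keep\<close> into one deletion and one insertion.\<close>

lemma script_orth_Suc:
  assumes "script_orth q N (Suc k) c d" "k < N"
  shows "script_orth q N k c d"
  unfolding script_orth_def
proof (intro allI impI)
  fix h assume h: "script q (N - k) k k h"
  then obtain e1 e2 where e: "h = e1 @ Keep # e2"
    using keeps_split[of h] assms(2) by (auto simp: script_def)
  have "rel_form q N (runs (e1 @ Del b # Ins b # e2)) c d = 0" if "b < q" for b
  proof -
    have "script q (N - Suc k) (Suc k) (Suc k) (e1 @ Del b # Ins b # e2)"
      using h that by (auto simp: script_def e edit_counts_append)
    then show ?thesis using assms(1) unfolding script_orth_def by blast
  qed
  then show "rel_form q N (runs h) c d = 0"
    unfolding e rel_form_Keep_expand by simp
qed

lemma script_orth_le:
  assumes "script_orth q N K c d" "k \<le> K" "K \<le> N"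
  shows "script_orth q N k c d"
  using assms(2)
  by (induction rule: inc_induct) (use assms(1,3) script_orth_Suc in auto)

lemma pair_orth_imp_script_orth:
  assumes "pair_orth q N t1 t2 c d" "t2 < N" "q > 0"
  shows "script_orth q N (min (t1 + t2) N) c d"
  unfolding script_orth_def
proof (intro allI impI)
  define k where "k = min (t1 + t2) N"
  fix h assume "script q (N - min (t1 + t2) N) (min (t1 + t2) N) (min (t1 + t2) N) h"
  then have h: "script q (N - k) k k h" by (simp add: k_def)
  have k: "t2 \<le> k" "k \<le> t1 + t2" "k \<le> N" using assms(2) by (auto simp: k_def)
  \<comment> \<open>Each of \<open>e\<close> and \<open>f\<close> deletes \<open>t2\<close> letters
    and inserts the other \<open>k - t2\<close> letters of the opposite side; a padding of
    \<open>t1 + t2 - k\<close> brings the insertions up to exactly \<open>t1\<close>.\<close>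
  obtain e f where ef: "factors h (t1 + t2 - k) t2 t2 e f"
    using factors_exists[of t2 h t2 "t1 + t2 - k"] h k by (auto simp: script_def)
  have "script q (N - t2) t2 t1 e" "script q (N - t2) t2 t1 f"
    using ef h k assms(2,3) by (auto simp: script_def factors_def)
  then have "rel_form q N (connects e f) c d = 0" using assms(1) unfolding pair_orth_def by blast
  moreover have "connects e f = runs h" using ef by (simp add: factors_def fun_eq_iff)
  ultimately show "rel_form q N (runs h) c d = 0" by simp
qed

lemma script_orth_imp_pair_orth:
  assumes "script_orth q N (min (s1 + s2) N) c d" "s2 < N"
  shows "pair_orth q N s1 s2 c d"
  unfolding pair_orth_def
proof (intro allI impI)
  fix e f assume e: "script q (N - s2) s2 s1 e" and f: "script q (N - s2) s2 s1 f"
  from composite_exists[of e f]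
  show "rel_form q N (connects e f) c d = 0"
  proof
    assume "\<forall>X Y. \<not> connects e f X Y"
    then show ?thesis by (simp add: rel_form_def)
  next
    assume "\<exists>h. composite e f h"
    then obtain h where h: "composite e f h" by blast
    define k where "k = length (dels h)"
    \<comment> \<open>Both outer words have length \<open>N\<close>, so \<open>h\<close> has as many
      insertions as deletions. Their number is at most \<open>s2 + s1\<close> by the bound in
      \<open>composite\<close> and at most \<open>N\<close> by the length.\<close>
    have 1: "script q (N - k) k k h" and 2: "k \<le> min (s1 + s2) N"
      using h e f assms(2) unfolding composite_def script_def k_def by auto
    have "script_orth q N k c d" using script_orth_le[OF assms(1) 2] by simp
    then have "rel_form q N (runs h) c d = 0" using 1 unfolding script_orth_def by blast
    moreover have "connects e f = runs h" using h by (simp add: composite_def fun_eq_iff)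
    ultimately show ?thesis by simp
  qed
qed

lemma pair_orth_transfer:
  assumes "pair_orth q N t1 t2 c d" "t2 < N" "s2 < N" "t1 + t2 = s1 + s2" "q > 0"
  shows "pair_orth q N s1 s2 c d"
  using pair_orth_imp_script_orth[OF assms(1,2,5)] script_orth_imp_pair_orth[OF _ assms(3)] assms(4)
  by simp

section \<open>Errors as relations on words\<close>

text \<open>The description by position sets that the channels use. It forgets the order of
  neighbouring deletions and insertions, so different scripts may give the same relation.\<close>

definition err_rel :: "nat set \<Rightarrow> nat list \<Rightarrow> nat set \<Rightarrow> nat list \<Rightarrow> nat list \<Rightarrow> nat list \<Rightarrow> bool" where
  "err_rel P a Q b X Z \<longleftrightarrow> nths X P = a \<and> nths Z Q = b \<and> nths X (- P) = nths Z (- Q)"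

fun del_pos :: "edit list \<Rightarrow> nat set" where
  "del_pos [] = {}"
| "del_pos (Del a # e) = insert 0 (Suc ` del_pos e)"
| "del_pos (Keep # e) = Suc ` del_pos e"
| "del_pos (Ins b # e) = del_pos e"

fun ins_pos :: "edit list \<Rightarrow> nat set" where
  "ins_pos [] = {}"
| "ins_pos (Ins b # e) = insert 0 (Suc ` ins_pos e)"
| "ins_pos (Keep # e) = Suc ` ins_pos e"
| "ins_pos (Del a # e) = ins_pos e"

lemma Suc_preimages [simp]:
  "{j. Suc j \<in> insert 0 (Suc ` A)} = A" "{j. Suc j \<in> Suc ` A} = A"
  "{j. Suc j \<in> - insert 0 (Suc ` A)} = - A" "{j. Suc j \<in> - (Suc ` A)} = - A"
  by auto

lemma nths_Cons_shift [simp]: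
  "nths (x # xs) (insert 0 (Suc ` A)) = x # nths xs A"
  "nths (x # xs) (Suc ` A) = nths xs A"
  "nths (x # xs) (- insert 0 (Suc ` A)) = nths xs (- A)"
  "nths (x # xs) (- (Suc ` A)) = x # nths xs (- A)"
  unfolding nths_Cons Suc_preimages by auto

text \<open>\<open>err_rel\<close> does not fix the lengths of its words: with empty data it relates
  every word to itself, while the empty script accepts only empty words. Hence the length
  assumptions.\<close>

lemma runs_iff_err_rel:
  "length X = keeps e + length (dels e) \<Longrightarrow> length Z = keeps e + length (inss e) \<Longrightarrow>
   runs e X Z \<longleftrightarrow> err_rel (del_pos e) (dels e) (ins_pos e) (inss e) X Z"
proof (induction e X Z rule: runs.induct)
  case (2 e X Z)
  then obtain x X' z Z' where "X = x # X'" "Z = z # Z'" by (cases X; cases Z) auto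
  then show ?case using 2 by (auto simp: err_rel_def simp del: Compl_insert)
next
  case (3 a e X Z)
  then obtain x X' where "X = x # X'" by (cases X) auto
  then show ?case using 3 by (auto simp: err_rel_def simp del: Compl_insert)
next
  case (4 b e X Z)
  then obtain z Z' where "Z = z # Z'" by (cases Z) auto
  then show ?case using 4 by (auto simp: err_rel_def simp del: Compl_insert)
qed (auto simp: err_rel_def)

lemma del_pos_card: "del_pos e \<subseteq> {..<keeps e + length (dels e)} \<and> card (del_pos e) = length (dels e)"
proof (induction e rule: del_pos.induct)
  case (2 a e)
  then have "finite (del_pos e)" using finite_subset by blast
  then have "card (insert 0 (Suc ` del_pos e)) = Suc (card (del_pos e))"
    by (subst card_insert_disjoint) (auto simp: card_image)
  then show ?case using 2 by auto
qed (auto simp: card_image)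

lemma ins_pos_card: "ins_pos e \<subseteq> {..<keeps e + length (inss e)} \<and> card (ins_pos e) = length (inss e)"
proof (induction e rule: ins_pos.induct)
  case (2 a e)
  then have "finite (ins_pos e)" using finite_subset by blast
  then have "card (insert 0 (Suc ` ins_pos e)) = Suc (card (ins_pos e))"
    by (subst card_insert_disjoint) (auto simp: card_image)
  then show ?case using 2 by auto
qed (auto simp: card_image)

text \<open>Converse translation: one related pair of words determines the edits, read off from left
  to right, and the resulting script then represents the relation on all words of the same
  lengths.\<close>

lemma err_rel_script:
  fixes X0 Z0 :: "nat list"
  assumes "nths X0 (- P) = nths Z0 (- Q)"
  shows "\<exists>e. dels e = nths X0 P \<and> inss e = nths Z0 Q \<and> keeps e = length (nths X0 (- P)) \<and>
    (\<forall>X Z. length X = length X0 \<longrightarrow> length Z = length Z0 \<longrightarrow>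
       runs e X Z \<longleftrightarrow> err_rel P (nths X0 P) Q (nths Z0 Q) X Z)"
  using assms
proof (induction "length X0 + length Z0" arbitrary: X0 Z0 P Q rule: less_induct)
  case less
  let ?P = "{j. Suc j \<in> P}" and ?Q = "{j. Suc j \<in> Q}"
  have cP: "{j. Suc j \<notin> P} = - ?P" and cQ: "{j. Suc j \<notin> Q} = - ?Q" by auto
  consider (nil) "X0 = []" "Z0 = []"
    | (del) x X1 where "X0 = x # X1" "0 \<in> P"
    | (ins) z Z1 where "Z0 = z # Z1" "0 \<in> Q"
    | (keep) x X1 Z1 where "X0 = x # X1" "Z0 = x # Z1" "0 \<notin> P" "0 \<notin> Q"
    using less.prems by (cases X0; cases Z0) (auto simp: nths_Cons split: if_splits)
  then show ?case
  proof cases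
    case nil
    then show ?thesis by (intro exI[of _ "[]"]) (auto simp: err_rel_def)
  next
    case del
    have "nths X1 (- ?P) = nths Z0 (- Q)" using less.prems del by (simp add: nths_Cons cP)
    from less.hyps[OF _ this] del obtain e where e: "dels e = nths X1 ?P" "inss e = nths Z0 Q"
      "keeps e = length (nths X1 (- ?P))"
      "\<And>X Z. length X = length X1 \<Longrightarrow> length Z = length Z0 \<Longrightarrow>
         runs e X Z \<longleftrightarrow> err_rel ?P (nths X1 ?P) Q (nths Z0 Q) X Z" by force
    show ?thesis
    proof (intro exI[of _ "Del x # e"] conjI allI impI)
      fix X Z :: "nat list" assume l: "length X = length X0" "length Z = length Z0"
      then obtain y X' where "X = y # X'" using del by (cases X) auto
      then show "runs (Del x # e) X Z \<longleftrightarrow> err_rel P (nths X0 P) Q (nths Z0 Q) X Z"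
        using l del e(4)[of X' Z] by (auto simp: err_rel_def nths_Cons cP)
    qed (use del e in \<open>auto simp: nths_Cons cP\<close>)
  next
    case ins
    have "nths X0 (- P) = nths Z1 (- ?Q)" using less.prems ins by (simp add: nths_Cons cQ)
    from less.hyps[OF _ this] ins obtain e where e: "dels e = nths X0 P" "inss e = nths Z1 ?Q"
      "keeps e = length (nths X0 (- P))"
      "\<And>X Z. length X = length X0 \<Longrightarrow> length Z = length Z1 \<Longrightarrow>
         runs e X Z \<longleftrightarrow> err_rel P (nths X0 P) ?Q (nths Z1 ?Q) X Z" by force
    show ?thesis
    proof (intro exI[of _ "Ins z # e"] conjI allI impI)
      fix X Z :: "nat list" assume l: "length X = length X0" "length Z = length Z0"
      then obtain y Z' where "Z = y # Z'" using ins by (cases Z) auto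
      then show "runs (Ins z # e) X Z \<longleftrightarrow> err_rel P (nths X0 P) Q (nths Z0 Q) X Z"
        using l ins e(4)[of X Z'] by (auto simp: err_rel_def nths_Cons cQ)
    qed (use ins e in \<open>auto simp: nths_Cons cQ\<close>)
  next
    case keep
    have "nths X1 (- ?P) = nths Z1 (- ?Q)" using less.prems keep by (simp add: nths_Cons cQ cP)
    from less.hyps[OF _ this] keep obtain e where e: "dels e = nths X1 ?P" "inss e = nths Z1 ?Q"
      "keeps e = length (nths X1 (- ?P))"
      "\<And>X Z. length X = length X1 \<Longrightarrow> length Z = length Z1 \<Longrightarrow>
         runs e X Z \<longleftrightarrow> err_rel ?P (nths X1 ?P) ?Q (nths Z1 ?Q) X Z" by force
    show ?thesis
    proof (intro exI[of _ "Keep # e"] conjI allI impI)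
      fix X Z :: "nat list" assume l: "length X = length X0" "length Z = length Z0"
      then obtain y y' X' Z' where "X = y # X'" "Z = y' # Z'" using keep by (cases X; cases Z) auto
      then show "runs (Keep # e) X Z \<longleftrightarrow> err_rel P (nths X0 P) Q (nths Z0 Q) X Z"
        using l keep e(4)[of X' Z'] by (auto simp: err_rel_def nths_Cons cQ cP)
    qed (use keep e in \<open>auto simp: nths_Cons cQ cP\<close>)
  qed
qed

section \<open>Explicit entries of the insertion and erasure maps\<close>

lemma nths_cong: "(\<And>i. i < length xs \<Longrightarrow> i \<in> A \<longleftrightarrow> i \<in> B) \<Longrightarrow> nths xs A = nths xs B"
  unfolding nths_def by (intro arg_cong[where f = "map fst"] filter_cong) (auto simp: set_zip)

text \<open>Removing the largest position does not renumber the smaller ones. This lets the channels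
  be evaluated one position at a time, starting from the largest.\<close>

lemma nths_insert_max:
  assumes "p < length Z" "\<And>i. i \<in> S \<Longrightarrow> i < p"
  shows "nths Z (insert p S) = nths (del_at p Z) S @ [Z ! p]"
    and "nths Z (- insert p S) = nths (del_at p Z) (- S)"
proof -
  define xs ys where "xs = take p Z" and "ys = drop (Suc p) Z"
  have Z: "Z = xs @ Z ! p # ys" unfolding xs_def ys_def using assms(1) by (rule id_take_nth_drop)
  have d: "del_at p Z = xs @ ys" by (simp add: del_at_def xs_def ys_def)
  have l: "length xs = p" using assms(1) by (simp add: xs_def)
  have 1: "nths xs (insert p S) = nths xs S" "nths xs (- insert p S) = nths xs (- S)"
    by (rule nths_cong; use l in auto)+
  have out: "j + p \<notin> S" "Suc j + p \<notin> insert p S" for j using assms(2)[of "j + p"] assms(2)[of "Suc j + p"] by auto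
  have "{j. j + p \<in> S} = {}" "{j. Suc j + p \<in> insert p S} = {}" using out by blast+
  then have 2: "nths ys {j. j + p \<in> S} = []" "nths ys {j. Suc j + p \<in> insert p S} = []"
    by (simp_all only: nths_empty)
  have 3: "nths ys {j. Suc j + p \<in> - insert p S} = ys" "nths ys {j. j + p \<in> - S} = ys"
    by (rule nths_all, use out in simp)+
  show "nths Z (insert p S) = nths (del_at p Z) S @ [Z ! p]"
    unfolding d by (subst (1) Z) (use l 1 2 in \<open>simp add: nths_append nths_Cons\<close>)
  show "nths Z (- insert p S) = nths (del_at p Z) (- S)"
    unfolding d by (subst (1) Z) (use l 1 3 in \<open>simp add: nths_append nths_Cons\<close>)
qed

lemma nths_length_card:
  assumes "S \<subseteq> {..<n}" "length Z = n"
  shows "length (nths Z S) = card S" "length (nths Z (- S)) = n - card S"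
proof -
  have "{i. i < length Z \<and> i \<in> S} = S" "{i. i < length Z \<and> i \<in> - S} = {..<n} - S"
    using assms by auto
  then show "length (nths Z S) = card S" "length (nths Z (- S)) = n - card S"
    using assms finite_subset[OF assms(1)] unfolding length_nths by (simp_all add: card_Diff_subset)
qed

lemma nths_words:
  assumes "S \<subseteq> {..<n}" "card S = t" "Z \<in> words q n"
  shows "nths Z S \<in> words q t" "nths Z (- S) \<in> words q (n - t)"
  using assms nths_length_card[of S n Z] unfolding words_def by (auto dest: in_set_nthsD)

lemma words_0 [simp]: "words q 0 = {[]}"
  by (auto simp: words_def)

text \<open>Position sets of the channels are 1-based, list positions are 0-based.\<close>

definition zpos :: "nat set \<Rightarrow> nat set" where
  "zpos P = {i. Suc i \<in> P}"

lemma zpos_Suc_image [simp]: "zpos (Suc ` S) = S"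
  by (auto simp: zpos_def)

lemma zpos_card:
  assumes "P \<subseteq> {1..n}"
  shows "zpos P \<subseteq> {..<n}" "card (zpos P) = card P"
proof -
  have "P = Suc ` zpos P"
  proof (intro equalityI subsetI)
    fix x assume "x \<in> P"
    then show "x \<in> Suc ` zpos P" using assms by (cases x) (auto simp: zpos_def)
  qed (auto simp: zpos_def)
  then show "card (zpos P) = card P" by (metis card_image inj_Suc inj_on_subset subset_UNIV)
  show "zpos P \<subseteq> {..<n}" using assms by (auto simp: zpos_def)
qed

lemma zpos_tsubsets:
  assumes "P \<in> tsubsets n t"
  shows "zpos P \<subseteq> {..<n}" "card (zpos P) = t"
  using assms zpos_card unfolding tsubsets_def by auto

lemma Suc_image_tsubsets:
  assumes "S \<subseteq> {..<n}" "card S = t"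
  shows "Suc ` S \<in> tsubsets n t"
  using assms unfolding tsubsets_def by (auto simp: card_image)

lemma finite_tsubsets [simp]: "finite (tsubsets n t)"
  unfolding tsubsets_def by (rule finite_subset[of _ "Pow {1..n}"]) auto

lemma zpos_snoc: "p \<ge> 1 \<Longrightarrow> zpos (set (ps @ [p])) = insert (p - 1) (zpos (set ps))"
  by (auto simp: zpos_def)

lemma strict_sorted_snoc:
  assumes "sorted_wrt (<) (ps @ [p])" "set (ps @ [p]) \<subseteq> {1..Suc n}"
  shows "sorted_wrt (<) ps" "set ps \<subseteq> {1..n}" "p \<ge> 1" "p - 1 \<le> n" "\<And>i. i \<in> zpos (set ps) \<Longrightarrow> i < p - 1"
proof -
  have lt: "\<forall>x\<in>set ps. x < p" and p: "1 \<le> p" "p \<le> Suc n" and ps: "\<forall>x\<in>set ps. 1 \<le> x"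
    using assms by (auto simp: sorted_wrt_append)
  show "sorted_wrt (<) ps" using assms by (simp add: sorted_wrt_append)
  show "set ps \<subseteq> {1..n}" using lt p ps by fastforce
  show "p \<ge> 1" "p - 1 \<le> n" using p by auto
  show "i < p - 1" if "i \<in> zpos (set ps)" for i using that lt by (auto simp: zpos_def)
qed

lemma card_zpos_sorted:
  assumes "sorted_wrt (<) ps" "set ps \<subseteq> {1..n}"
  shows "card (zpos (set ps)) = length ps"
  using zpos_card(2)[OF assms(2)] assms(1) by (metis distinct_card strict_sorted_iff)

text \<open>The matrix entry of the product state with factors \<sigma> between the basis words
  \<open>b\<close> and \<open>b'\<close>.\<close>

definition wt :: "(nat \<Rightarrow> nat \<Rightarrow> complex) list \<Rightarrow> nat list \<Rightarrow> nat list \<Rightarrow> complex" where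
  "wt \<sigma> b b' = (\<Prod>i<length \<sigma>. (\<sigma> ! i) (b ! i) (b' ! i))"

lemma wt_snoc:
  assumes "length b = length \<sigma>" "length b' = length \<sigma>"
  shows "wt (\<sigma> @ [s]) (b @ [x]) (b' @ [x']) = s x x' * wt \<sigma> b b'"
proof -
  have "(\<Prod>i<length \<sigma>. ((\<sigma> @ [s]) ! i) ((b @ [x]) ! i) ((b' @ [x']) ! i)) = wt \<sigma> b b'"
    unfolding wt_def using assms by (intro prod.cong) (auto simp: nth_append)
  then show ?thesis using assms by (simp add: wt_def nth_append mult.commute)
qed

lemma ins_seq_snoc:
  "ins_seq q m (l @ [(p, s)]) \<rho> = In_map q (m + length l) p s (ins_seq q m l \<rho>)"
  by (induction q m l \<rho> rule: ins_seq.induct) auto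

lemma ins_seq_ops:
  "\<rho> \<in> ops q m \<Longrightarrow> ins_seq q m l \<rho> \<in> ops q (m + length l)"
proof (induction l rule: rev_induct)
  case (snoc x l)
  obtain p s where "x = (p, s)" by fastforce
  then show ?case by (auto simp: ins_seq_snoc In_map_def ops_def)
qed simp

lemma del_at_words:
  assumes "Z \<in> words q (Suc n)" "p < Suc n"
  shows "del_at p Z \<in> words q n"
  using assms unfolding words_def del_at_def by (auto dest: in_set_takeD in_set_dropD)

lemma ins_at_words:
  assumes "Z \<in> words q n" "x < q" "p \<le> n"
  shows "ins_at p x Z \<in> words q (Suc n)"
  using assms unfolding words_def ins_at_def by (auto dest: in_set_takeD in_set_dropD)

text \<open>Insertions run in increasing order, so a letter never moves after its insertion and
  \<open>p\<close> is already its final position. The induction peels off the last and largest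
  position.\<close>

lemma ins_seq_eval:
  assumes "sorted_wrt (<) ps" "set ps \<subseteq> {1..m + length ps}" "length \<sigma> = length ps"
    "Z \<in> words q (m + length ps)" "Z' \<in> words q (m + length ps)"
  shows "ins_seq q m (zip ps \<sigma>) \<rho> Z Z' = wt \<sigma> (nths Z (zpos (set ps))) (nths Z' (zpos (set ps)))
     * \<rho> (nths Z (- zpos (set ps))) (nths Z' (- zpos (set ps)))"
  using assms
proof (induction ps arbitrary: \<sigma> Z Z' rule: rev_induct)
  case Nil
  then show ?case by (simp add: wt_def zpos_def nths_all)
next
  case (snoc p ps)
  then obtain \<sigma>' s where \<sigma>: "\<sigma> = \<sigma>' @ [s]" "length \<sigma>' = length ps"
    by (metis length_append_singleton length_Suc_conv_rev)
  define n where "n = m + length ps"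
  have n: "m + length (ps @ [p]) = Suc n" by (simp add: n_def)
  note ss = strict_sorted_snoc[OF snoc.prems(1), of n] 
  have p: "sorted_wrt (<) ps" "set ps \<subseteq> {1..n}" "p \<ge> 1" "p - 1 < Suc n"
    "\<And>i. i \<in> zpos (set ps) \<Longrightarrow> i < p - 1"
    using ss snoc.prems(2) unfolding n by (auto simp: less_Suc_eq_le)
  have ZZ: "Z \<in> words q (Suc n)" "Z' \<in> words q (Suc n)" using snoc.prems n by auto
  then have l: "length Z = Suc n" "length Z' = Suc n" by (auto simp: words_def)
  have d: "del_at (p - 1) Z \<in> words q n" "del_at (p - 1) Z' \<in> words q n"
    using del_at_words ZZ p(4) by auto
  have len: "length (nths (del_at (p - 1) Y) (zpos (set ps))) = length \<sigma>'" if "Y \<in> words q (Suc n)" for Y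
  proof -
    have "length (del_at (p - 1) Y) = n" using del_at_words[OF that p(4)] by (simp add: words_def)
    then show ?thesis using nths_length_card(1)[OF zpos_card(1)[OF p(2)]] card_zpos_sorted[OF p(1,2)] \<sigma>(2)
      by simp
  qed
  have nths_max: "nths Y (insert (p - 1) (zpos (set ps))) = nths (del_at (p - 1) Y) (zpos (set ps)) @ [Y ! (p - 1)]"
    "nths Y (- insert (p - 1) (zpos (set ps))) = nths (del_at (p - 1) Y) (- zpos (set ps))"
    if "length Y = Suc n" for Y :: "nat list"
    by (rule nths_insert_max; use p that in simp)+
  have "ins_seq q m (zip (ps @ [p]) \<sigma>) \<rho> Z Z' = In_map q n p s (ins_seq q m (zip ps \<sigma>') \<rho>) Z Z'"
    using \<sigma> by (simp add: ins_seq_snoc n_def)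
  also have "\<dots> = s (Z ! (p - 1)) (Z' ! (p - 1)) * ins_seq q m (zip ps \<sigma>') \<rho> (del_at (p - 1) Z) (del_at (p - 1) Z')"
    using ZZ by (simp add: In_map_def)
  also have "\<dots> = s (Z ! (p - 1)) (Z' ! (p - 1)) *
     (wt \<sigma>' (nths (del_at (p - 1) Z) (zpos (set ps))) (nths (del_at (p - 1) Z') (zpos (set ps)))
     * \<rho> (nths (del_at (p - 1) Z) (- zpos (set ps))) (nths (del_at (p - 1) Z') (- zpos (set ps))))"
    using snoc.IH[of \<sigma>' "del_at (p - 1) Z" "del_at (p - 1) Z'"] p d \<sigma>(2) by (simp add: n_def)
  also have "\<dots> = wt \<sigma> (nths Z (zpos (set (ps @ [p])))) (nths Z' (zpos (set (ps @ [p]))))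
     * \<rho> (nths Z (- zpos (set (ps @ [p])))) (nths Z' (- zpos (set (ps @ [p]))))"
    unfolding zpos_snoc[OF p(3)] nths_max[OF l(1)] nths_max[OF l(2)]
    by (simp only: wt_snoc len[OF ZZ(1)] len[OF ZZ(2)] \<sigma>(1) mult.assoc)
  finally show ?case .
qed

lemma sorted_list_tsubsets:
  assumes "P \<in> tsubsets n t"
  shows "sorted_wrt (<) (sorted_list_of_set P)" "set (sorted_list_of_set P) = P"
    "length (sorted_list_of_set P) = t" "P \<subseteq> {1..n}"
proof -
  have "finite P" using assms finite_subset unfolding tsubsets_def by blast
  then show "set (sorted_list_of_set P) = P" by simp
  show "sorted_wrt (<) (sorted_list_of_set P)" by simp
  show "length (sorted_list_of_set P) = t" "P \<subseteq> {1..n}" using assms unfolding tsubsets_def by auto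
qed

lemma Ins_P_eval:
  assumes "P \<in> tsubsets (m + t) t" "length \<sigma> = t" "\<rho> \<in> ops q m"
  shows "Ins_P q m P \<sigma> \<rho> Z Z' = (if Z \<in> words q (m + t) \<and> Z' \<in> words q (m + t)
    then wt \<sigma> (nths Z (zpos P)) (nths Z' (zpos P)) * \<rho> (nths Z (- zpos P)) (nths Z' (- zpos P)) else 0)"
proof (cases "Z \<in> words q (m + t) \<and> Z' \<in> words q (m + t)")
  case True
  note ps = sorted_list_tsubsets[OF assms(1)]
  show ?thesis
    using ins_seq_eval[OF ps(1), unfolded ps(2,3), OF ps(4) assms(2), of Z q Z' \<rho>] True
    by (simp add: Ins_P_def)
next
  case False
  have "Ins_P q m P \<sigma> \<rho> \<in> ops q (m + t)"
    using ins_seq_ops[OF assms(3), of "zip (sorted_list_of_set P) \<sigma>"] sorted_list_tsubsets[OF assms(1)] assms(2)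
    by (simp add: Ins_P_def)
  then show ?thesis using False by (auto simp: ops_def)
qed

text \<open>Puts the letters \<open>a\<close> into \<open>W\<close> at the 1-based increasing
  positions \<open>ps\<close>: the inverse of splitting a word into its letters at \<open>ps\<close>
  and the rest, as \<open>mrg_eq_iff\<close> confirms.\<close>

definition mrg :: "nat list \<Rightarrow> nat list \<Rightarrow> nat list \<Rightarrow> nat list" where
  "mrg ps a W = foldl (\<lambda>X (p, x). ins_at (p - 1) x X) W (zip ps a)"

lemma mrg_snoc: "length a = length ps \<Longrightarrow> mrg (ps @ [p]) (a @ [x]) W = ins_at (p - 1) x (mrg ps a W)"
  by (simp add: mrg_def)

lemma words_snoc_sum:
  "(\<Sum>a\<in>words q (Suc n). f a) = (\<Sum>a\<in>words q n. \<Sum>x<q. f (a @ [x]))"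
proof -
  have "(\<Sum>a\<in>words q n. \<Sum>x<q. f (a @ [x])) = (\<Sum>(a, x)\<in>words q n \<times> {..<q}. f (a @ [x]))"
    by (simp add: sum.cartesian_product)
  also have "\<dots> = (\<Sum>a\<in>words q (Suc n). f a)"
  proof (rule sum.reindex_bij_witness[of _ "\<lambda>a. (butlast a, last a)" "\<lambda>(a, x). a @ [x]"])
    fix a assume a: "a \<in> words q (Suc n)"
    then have "a \<noteq> []" by (auto simp: words_def)
    then show "(case (butlast a, last a) of (a, x) \<Rightarrow> a @ [x]) = a"
      "(butlast a, last a) \<in> words q n \<times> {..<q}"
      using a by (auto simp: words_def dest: in_set_butlastD)
  qed (auto simp: words_def)
  finally show ?thesis by simp
qed

lemma mrg_words:
  assumes "sorted_wrt (<) ps" "set ps \<subseteq> {1..n + length ps}" "a \<in> words q (length ps)" "W \<in> words q n"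
  shows "mrg ps a W \<in> words q (n + length ps)"
  using assms
proof (induction ps arbitrary: a rule: rev_induct)
  case Nil
  then show ?case by (simp add: mrg_def)
next
  case (snoc p ps)
  then have "length a = Suc (length ps)" by (simp add: words_def)
  then obtain a' x where a: "a = a' @ [x]" "length a' = length ps" by (metis length_Suc_conv_rev)
  note p = strict_sorted_snoc[OF snoc.prems(1), of "n + length ps"]
  have "a' \<in> words q (length ps)" "x < q" using snoc.prems(3) a by (auto simp: words_def)
  then show ?case using snoc p a by (auto simp: mrg_snoc ins_at_words)
qed

lemma mrg_length: "length a = length ps \<Longrightarrow> length (mrg ps a W) = length W + length ps"
proof (induction ps arbitrary: a rule: rev_induct)
  case (snoc p ps)
  then obtain a' x where a: "a = a' @ [x]" "length a' = length ps"
    by (metis length_append_singleton length_Suc_conv_rev)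
  then show ?case using snoc.IH[of a'] by (simp add: mrg_snoc ins_at_def)
qed (simp add: mrg_def)

lemma ins_at_eq_iff:
  assumes "p < length X" "length X = Suc (length Y)"
  shows "ins_at p x Y = X \<longleftrightarrow> X ! p = x \<and> del_at p X = Y"
proof
  assume "ins_at p x Y = X"
  then show "X ! p = x \<and> del_at p X = Y"
    using assms by (auto simp: ins_at_def del_at_def nth_append)
next
  assume "X ! p = x \<and> del_at p X = Y"
  then show "ins_at p x Y = X"
    using assms(1) id_take_nth_drop[OF assms(1), symmetric] by (auto simp: ins_at_def del_at_def)
qed

lemma mrg_eq_iff:
  assumes "sorted_wrt (<) ps" "set ps \<subseteq> {1..length X}" "length a = length ps" "length W + length ps = length X"
  shows "mrg ps a W = X \<longleftrightarrow> nths X (zpos (set ps)) = a \<and> nths X (- zpos (set ps)) = W"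
  using assms
proof (induction ps arbitrary: a X rule: rev_induct)
  case Nil
  then show ?case by (auto simp: mrg_def zpos_def nths_all)
next
  case (snoc p ps)
  then obtain a' x where a: "a = a' @ [x]" "length a' = length ps"
    by (metis length_append_singleton length_Suc_conv_rev)
  define n where "n = length W + length ps"
  have l: "length X = Suc n" using snoc.prems(4) by (simp add: n_def)
  note p = strict_sorted_snoc[OF snoc.prems(1), of n, folded l, OF snoc.prems(2)]
  have pX: "p - 1 < length X" using p l by simp
  have ld: "length (del_at (p - 1) X) = n" using l pX by (simp add: del_at_def)
  have "mrg (ps @ [p]) a W = X \<longleftrightarrow> X ! (p - 1) = x \<and> del_at (p - 1) X = mrg ps a' W"
    unfolding a(1) mrg_snoc[OF a(2)] using pX l mrg_length[OF a(2), of W]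
    by (intro ins_at_eq_iff) (auto simp: n_def)
  also have "del_at (p - 1) X = mrg ps a' W \<longleftrightarrow> mrg ps a' W = del_at (p - 1) X" by (rule eq_commute)
  also have "\<dots> \<longleftrightarrow>
     nths (del_at (p - 1) X) (zpos (set ps)) = a' \<and> nths (del_at (p - 1) X) (- zpos (set ps)) = W"
    by (rule snoc.IH[OF p(1) _ a(2)]) (use p(2) ld in \<open>auto simp: n_def\<close>)
  finally have "mrg (ps @ [p]) a W = X \<longleftrightarrow> X ! (p - 1) = x \<and>
     nths (del_at (p - 1) X) (zpos (set ps)) = a' \<and> nths (del_at (p - 1) X) (- zpos (set ps)) = W" .
  moreover have "nths X (insert (p - 1) (zpos (set ps))) = nths (del_at (p - 1) X) (zpos (set ps)) @ [X ! (p - 1)]"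
    "nths X (- insert (p - 1) (zpos (set ps))) = nths (del_at (p - 1) X) (- zpos (set ps))"
    by (rule nths_insert_max[OF pX]; use p in simp)+
  ultimately show ?case unfolding zpos_snoc[OF p(3)] a(1) by auto
qed

lemma Tr_map_ops: "Tr_map q m p \<rho> \<in> ops q (m - 1)"
  by (auto simp: Tr_map_def ops_def)

lemma era_seq_ops: "\<rho> \<in> ops q m \<Longrightarrow> era_seq q m l \<rho> \<in> ops q (m - length l)"
proof (induction l arbitrary: m \<rho>)
  case (Cons p l)
  then show ?case using Cons.IH[OF Tr_map_ops, of m p \<rho>] by simp
qed simp

text \<open>Erasures run from the largest position downwards, so the remaining positions stay valid.
  The traced letters are collected into one word \<open>a\<close>, common to both arguments.\<close>

lemma era_seq_eval:
  assumes "sorted_wrt (<) ps" "set ps \<subseteq> {1..n + length ps}" "W \<in> words q n" "W' \<in> words q n"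
  shows "era_seq q (n + length ps) (rev ps) \<rho> W W' = (\<Sum>a\<in>words q (length ps). \<rho> (mrg ps a W) (mrg ps a W'))"
  using assms
proof (induction ps arbitrary: \<rho> rule: rev_induct)
  case Nil
  then show ?case by (simp add: mrg_def)
next
  case (snoc p ps)
  define m where "m = n + length ps"
  note p = strict_sorted_snoc[OF snoc.prems(1), of m]
  have p: "sorted_wrt (<) ps" "set ps \<subseteq> {1..m}" using p snoc.prems(2) by (auto simp: m_def)
  have "era_seq q (n + length (ps @ [p])) (rev (ps @ [p])) \<rho> W W' = era_seq q m (rev ps) (Tr_map q (Suc m) p \<rho>) W W'"
    by (simp add: m_def)
  also have "\<dots> = (\<Sum>a\<in>words q (length ps). Tr_map q (Suc m) p \<rho> (mrg ps a W) (mrg ps a W'))"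
    using snoc.IH[of "Tr_map q (Suc m) p \<rho>"] p snoc.prems(3,4) by (simp add: m_def)
  also have "\<dots> = (\<Sum>a\<in>words q (length ps). \<Sum>x<q. \<rho> (mrg (ps @ [p]) (a @ [x]) W) (mrg (ps @ [p]) (a @ [x]) W'))"
  proof (intro sum.cong refl)
    fix a assume a: "a \<in> words q (length ps)"
    then have "length a = length ps" by (simp add: words_def)
    moreover have "mrg ps a W \<in> words q m" "mrg ps a W' \<in> words q m"
      using mrg_words[OF p(1) _ a] p(2) snoc.prems(3,4) unfolding m_def by auto
    ultimately show "Tr_map q (Suc m) p \<rho> (mrg ps a W) (mrg ps a W') =
      (\<Sum>x<q. \<rho> (mrg (ps @ [p]) (a @ [x]) W) (mrg (ps @ [p]) (a @ [x]) W'))"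
      by (simp add: Tr_map_def mrg_snoc)
  qed
  finally show ?case by (simp add: words_snoc_sum)
qed

lemma Era_P_ops:
  assumes "P \<in> tsubsets N t" "\<rho> \<in> ops q N"
  shows "Era_P q N P \<rho> \<in> ops q (N - t)"
  using era_seq_ops[OF assms(2), of "rev (sorted_list_of_set P)"] sorted_list_tsubsets[OF assms(1)]
  by (simp add: Era_P_def)

definition err :: "nat \<Rightarrow> nat \<Rightarrow> nat \<Rightarrow> (nat list \<Rightarrow> nat list \<Rightarrow> bool) \<Rightarrow> vec \<Rightarrow> vec" where
  "err q N M r c Z = (if Z \<in> words q M then \<Sum>X\<in>words q N. of_bool (r X Z) * c X else 0)"

definition outer :: "vec \<Rightarrow> vec \<Rightarrow> op" where
  "outer c d X Y = c X * cnj (d Y)"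

text \<open>Given the output \<open>Z\<close> and the deleted letters \<open>a\<close>, exactly one
  input word is possible, so the sum has at most one nonzero term.\<close>

lemma err_err_rel:
  assumes P: "P \<in> tsubsets N t2" "t2 \<le> N" and Q: "Q \<in> tsubsets (N - t2 + t1) t1"
    and a: "a \<in> words q t2" and Z: "Z \<in> words q (N - t2 + t1)"
  shows "err q N (N - t2 + t1) (err_rel (zpos P) a (zpos Q) b) c Z
    = (if nths Z (zpos Q) = b then c (mrg (sorted_list_of_set P) a (nths Z (- zpos Q))) else 0)"
proof -
  let ?W = "nths Z (- zpos Q)" and ?ps = "sorted_list_of_set P"
  note ps = sorted_list_tsubsets[OF P(1)]
  have W: "?W \<in> words q (N - t2)"
    using nths_words(2)[OF zpos_tsubsets[OF Q] Z] by simp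
  have Y: "mrg ?ps a ?W \<in> words q N"
    using mrg_words[OF ps(1) _ _ W, of a] ps(2-4) a P(2) by simp
  have "(\<Sum>X\<in>words q N. of_bool (err_rel (zpos P) a (zpos Q) b X Z) * c X)
     = (\<Sum>X\<in>words q N. if mrg ?ps a ?W = X then (if nths Z (zpos Q) = b then c X else 0) else 0)"
  proof (intro sum.cong refl)
    fix X assume "X \<in> words q N"
    then have "length X = N" by (simp add: words_def)
    then have "mrg ?ps a ?W = X \<longleftrightarrow> nths X (zpos P) = a \<and> nths X (- zpos P) = ?W"
      using mrg_eq_iff[OF ps(1), of X a ?W] ps a W P(2) by (simp add: words_def)
    then show "of_bool (err_rel (zpos P) a (zpos Q) b X Z) * c X =
       (if mrg ?ps a ?W = X then (if nths Z (zpos Q) = b then c X else 0) else 0)"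
      unfolding err_rel_def by auto
  qed
  then show ?thesis using Y Z by (simp add: err_def)
qed

text \<open>The partial trace makes the deleted letters \<open>a\<close> agree on both sides. The
  inserted letters \<open>b\<close> and \<open>b'\<close> are independent, coupled only by the entry
  of the inserted state; this is the source of the cross terms.\<close>

lemma insdel_outer:
  assumes P: "P \<in> tsubsets N t2" "t2 \<le> N" and Q: "Q \<in> tsubsets (N - t2 + t1) t1" and \<sigma>: "length \<sigma> = t1"
    and c: "outer c d \<in> ops q N"
  shows "Ins_P q (N - t2) Q \<sigma> (Era_P q N P (outer c d)) Z Z' =
    (\<Sum>a\<in>words q t2. \<Sum>b\<in>words q t1. \<Sum>b'\<in>words q t1. wt \<sigma> b b' *
       outer (err q N (N - t2 + t1) (err_rel (zpos P) a (zpos Q) b) c)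
             (err q N (N - t2 + t1) (err_rel (zpos P) a (zpos Q) b') d) Z Z')"
    (is "?L = ?R")
proof (cases "Z \<in> words q (N - t2 + t1) \<and> Z' \<in> words q (N - t2 + t1)")
  case False
  then have "?R = 0" by (auto simp: outer_def err_def)
  moreover have "?L = 0" using False
    by (subst Ins_P_eval[OF Q \<sigma> Era_P_ops[OF P(1) c]]) auto
  ultimately show ?thesis by simp
next
  case True
  then have Z: "Z \<in> words q (N - t2 + t1)" "Z' \<in> words q (N - t2 + t1)" by auto
  let ?ps = "sorted_list_of_set P"
  note ps = sorted_list_tsubsets[OF P(1)]
  have W: "nths Z (- zpos Q) \<in> words q (N - t2)" "nths Z' (- zpos Q) \<in> words q (N - t2)"
    using nths_words(2)[OF zpos_tsubsets[OF Q]] Z by simp_all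
  have b: "nths Z (zpos Q) \<in> words q t1" "nths Z' (zpos Q) \<in> words q t1"
    using nths_words(1)[OF zpos_tsubsets[OF Q]] Z by simp_all
  have "?L = wt \<sigma> (nths Z (zpos Q)) (nths Z' (zpos Q)) *
     Era_P q N P (outer c d) (nths Z (- zpos Q)) (nths Z' (- zpos Q))"
    using Z by (subst Ins_P_eval[OF Q \<sigma> Era_P_ops[OF P(1) c]]) simp
  also have "Era_P q N P (outer c d) (nths Z (- zpos Q)) (nths Z' (- zpos Q)) =
     (\<Sum>a\<in>words q t2. outer c d (mrg ?ps a (nths Z (- zpos Q))) (mrg ?ps a (nths Z' (- zpos Q))))"
    using era_seq_eval[OF ps(1) _ W, of "outer c d"] ps P(2) by (simp add: Era_P_def)
  finally have L: "?L = (\<Sum>a\<in>words q t2. wt \<sigma> (nths Z (zpos Q)) (nths Z' (zpos Q)) *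
     outer c d (mrg ?ps a (nths Z (- zpos Q))) (mrg ?ps a (nths Z' (- zpos Q))))"
    by (simp add: sum_distrib_left)
  show ?thesis unfolding L
  proof (intro sum.cong refl)
    fix a assume a: "a \<in> words q t2"
    let ?X = "mrg ?ps a (nths Z (- zpos Q))" and ?Y = "mrg ?ps a (nths Z' (- zpos Q))"
    have "(\<Sum>b\<in>words q t1. \<Sum>b'\<in>words q t1. wt \<sigma> b b' *
       outer (err q N (N - t2 + t1) (err_rel (zpos P) a (zpos Q) b) c)
             (err q N (N - t2 + t1) (err_rel (zpos P) a (zpos Q) b') d) Z Z')
      = (\<Sum>b\<in>words q t1. \<Sum>b'\<in>words q t1. if nths Z' (zpos Q) = b' then
          (if nths Z (zpos Q) = b then wt \<sigma> b b' * outer c d ?X ?Y else 0) else 0)"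
      unfolding outer_def err_err_rel[OF P Q a Z(1)] err_err_rel[OF P Q a Z(2)]
      by (intro sum.cong refl) auto
    also have "\<dots> = wt \<sigma> (nths Z (zpos Q)) (nths Z' (zpos Q)) * outer c d ?X ?Y"
      using b by simp
    finally show "wt \<sigma> (nths Z (zpos Q)) (nths Z' (zpos Q)) * outer c d ?X ?Y = 
      (\<Sum>b\<in>words q t1. \<Sum>b'\<in>words q t1. wt \<sigma> b b' *
       outer (err q N (N - t2 + t1) (err_rel (zpos P) a (zpos Q) b) c)
             (err q N (N - t2 + t1) (err_rel (zpos P) a (zpos Q) b') d) Z Z')" by simp
  qed
qed

section \<open>Recovery implies orthogonality\<close>

lemma err_cong:
  assumes "\<And>X Z. X \<in> words q N \<Longrightarrow> Z \<in> words q M \<Longrightarrow> r X Z = r' X Z"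
  shows "err q N M r c = err q N M r' c"
proof
  fix Z
  show "err q N M r c Z = err q N M r' c Z"
    unfolding err_def using assms by (auto intro!: sum.cong)
qed

lemma err_supp: "err q N M r c \<in> supp_space (words q M)"
  by (simp add: supp_space_def err_def)

lemma outer_ops: "u \<in> supp_space (words q M) \<Longrightarrow> v \<in> supp_space (words q M) \<Longrightarrow> outer u v \<in> ops q M"
  by (auto simp: supp_space_def ops_def outer_def)

text \<open>Summing over the intermediate word gives a 0/1 matrix: that word is unique when it
  exists, and it stays within the alphabet because the input and the inserted letters do.\<close>

lemma ip_err_script:
  assumes e: "script q (N - t2) t2 t1 e" and f: "script q (N - t2) t2 t1 f"
  shows "ip (words q (N - t2 + t1)) (err q N (N - t2 + t1) (runs e) c) (err q N (N - t2 + t1) (runs f) d)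
    = rel_form q N (connects e f) c d"
proof -
  let ?M = "N - t2 + t1"
  have uniq: "(\<Sum>Z\<in>words q ?M. of_bool (runs e X Z) * of_bool (runs f Y Z)) = (of_bool (connects e f X Y) :: complex)"
    if X: "X \<in> words q N" for X Y
  proof (cases "connects e f X Y")
    case True
    then obtain Z where Z: "runs e X Z" "runs f Y Z" by (auto simp: connects_def)
    have "length Z = ?M" using runs_length[OF Z(1)] e by (simp add: script_def)
    moreover have "\<forall>z\<in>set Z. z < q" using runs_set[OF Z(1)] e X by (auto simp: script_def words_def)
    ultimately have ZM: "Z \<in> words q ?M" by (simp add: words_def)
    have "(\<Sum>Z'\<in>words q ?M. of_bool (runs e X Z') * of_bool (runs f Y Z')) =
       (\<Sum>Z'\<in>words q ?M. if Z' = Z then 1 else (0::complex))"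
    proof (intro sum.cong refl)
      fix Z'
      have "runs e X Z' \<longleftrightarrow> Z' = Z" using Z(1) runs_functional by blast
      then show "of_bool (runs e X Z') * of_bool (runs f Y Z') = (if Z' = Z then 1 else (0::complex))"
        using Z(2) by auto
    qed
    then show ?thesis using ZM True by simp
  next
    case False
    then have "of_bool (runs e X Z) * of_bool (runs f Y Z) = (0::complex)" for Z
      by (auto simp: connects_def)
    then show ?thesis using False by simp
  qed
  have "ip (words q ?M) (err q N ?M (runs e) c) (err q N ?M (runs f) d) =
    (\<Sum>Z\<in>words q ?M. (\<Sum>X\<in>words q N. of_bool (runs e X Z) * cnj (c X)) * (\<Sum>Y\<in>words q N. of_bool (runs f Y Z) * d Y))"
    unfolding ip_def err_def by (intro sum.cong refl) simp
  also have "\<dots> = (\<Sum>Z\<in>words q ?M. \<Sum>X\<in>words q N. \<Sum>Y\<in>words q N.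
       of_bool (runs e X Z) * of_bool (runs f Y Z) * (cnj (c X) * d Y))"
    unfolding sum_product by (intro sum.cong refl) (simp only: mult_ac)
  also have "\<dots> = (\<Sum>X\<in>words q N. \<Sum>Y\<in>words q N. \<Sum>Z\<in>words q ?M.
       of_bool (runs e X Z) * of_bool (runs f Y Z) * (cnj (c X) * d Y))"
    by (rule sum3_rotate[symmetric])
  also have "\<dots> = rel_form q N (connects e f) c d"
    unfolding rel_form_def by (intro sum.cong refl) (simp only: sum_distrib_right[symmetric] uniq)
  finally show ?thesis .
qed

lemma qform_outer: "qform I (outer u v) w = cnj (ip I u w) * ip I v w"
  unfolding qform_def ip_def outer_def
  by (simp add: sum_product mult_ac)

lemma psd_outer: "psd_on I (outer u u)"
  unfolding psd_on_qform qform_outer by (simp add: less_eq_complex_def)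

lemma trace_outer: "trace_on I (outer u v) = ip I v u"
  by (simp add: trace_on_def outer_def ip_def mult.commute)

lemma qform_lin: "qform I (\<lambda>X Y. a * A X Y + b * B X Y) d = a * qform I A d + b * qform I B d"
  by (simp add: qform_def sum.distrib sum_distrib_left algebra_simps)

lemma qform_sum: "qform I (\<lambda>X Y. \<Sum>j\<in>J. k j * A j X Y) d = (\<Sum>j\<in>J. k j * qform I (A j) d)"
proof -
  have "qform I (\<lambda>X Y. \<Sum>j\<in>J. k j * A j X Y) d = (\<Sum>X\<in>I. \<Sum>Y\<in>I. \<Sum>j\<in>J. k j * (cnj (d X) * A j X Y * d Y))"
    unfolding qform_def by (simp add: sum_distrib_left sum_distrib_right mult_ac)
  also have "\<dots> = (\<Sum>j\<in>J. \<Sum>X\<in>I. \<Sum>Y\<in>I. k j * (cnj (d X) * A j X Y * d Y))"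
    by (rule sum3_rotate)
  finally show ?thesis by (simp add: qform_def sum_distrib_left)
qed

lemma trace_sum: "trace_on I (\<lambda>X Y. \<Sum>j\<in>J. k j * A j X Y) = (\<Sum>j\<in>J. k j * trace_on I (A j))"
  unfolding trace_on_def by (subst sum.swap) (simp add: sum_distrib_left)

lemma qchannel_lin:
  assumes "qchannel q m n R" "A \<in> ops q m" "B \<in> ops q m"
  shows "R (\<lambda>X Y. a * A X Y + b * B X Y) = (\<lambda>X Y. a * R A X Y + b * R B X Y)"
  using assms unfolding qchannel_def by blast

lemma qchannel_trace:
  assumes "qchannel q m n R" "A \<in> ops q m"
  shows "trace_on (words q n) (R A) = trace_on (words q m) A"
  using assms unfolding qchannel_def by blast

lemma ops_lin: "A \<in> ops q m \<Longrightarrow> B \<in> ops q m \<Longrightarrow> (\<lambda>X Y. a * A X Y + b * B X Y) \<in> ops q m"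
  by (auto simp: ops_def)

lemma ops_sum: "(\<And>j. j \<in> J \<Longrightarrow> A j \<in> ops q m) \<Longrightarrow> (\<lambda>X Y. \<Sum>j\<in>J. k j * A j X Y) \<in> ops q m"
  by (auto simp: ops_def intro!: sum.neutral)

lemma qchannel_sum:
  assumes R: "qchannel q m n R" and J: "finite J" and A: "\<And>j. j \<in> J \<Longrightarrow> A j \<in> ops q m"
  shows "R (\<lambda>X Y. \<Sum>j\<in>J. k j * A j X Y) = (\<lambda>X Y. \<Sum>j\<in>J. k j * R (A j) X Y)"
  using J A
proof (induction J rule: finite_induct)
  case empty
  have "(\<lambda>_ _. 0) \<in> ops q m" by (simp add: ops_def)
  from qchannel_lin[OF R this this, of 0 0] show ?case by simp
next
  case (insert j J)
  have "R (\<lambda>X Y. k j * A j X Y + 1 * (\<Sum>j\<in>J. k j * A j X Y)) =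
     (\<lambda>X Y. k j * R (A j) X Y + 1 * R (\<lambda>X Y. \<Sum>j\<in>J. k j * A j X Y) X Y)"
    by (rule qchannel_lin[OF R]) (use insert.prems in \<open>auto intro: ops_sum\<close>)
  then show ?case using insert by simp
qed

text \<open>Positivity is complete positivity with a single block.\<close>

lemma qchannel_psd:
  assumes R: "qchannel q m n R" and A: "A \<in> ops q m" "psd_on (words q m) A"
  shows "psd_on (words q n) (R A)"
proof -
  have one: "block_psd q 1 l (\<lambda>_ _. B) \<longleftrightarrow> psd_on (words q l) B" for l B
  proof -
    have "(\<forall>v. Q (\<lambda>X. v (0, X))) \<longleftrightarrow> (\<forall>v. Q v)" for Q :: "(nat list \<Rightarrow> complex) \<Rightarrow> bool"
    proof (intro iffI allI)
      fix v assume *: "\<forall>v. Q (\<lambda>X. v (0, X))"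
      show "Q v" using *[rule_format, of "\<lambda>(_, X). v X"] by simp
    qed blast
    note quant = this[of "\<lambda>v. 0 \<le> (\<Sum>X\<in>words q l. \<Sum>Y\<in>words q l. cnj (v X) * B X Y * v Y)"]
    have "{..<1::nat} = {0}" by auto
    then show ?thesis unfolding block_psd_def psd_on_def
      using quant by (simp add: sum.cartesian_product')
  qed
  have "block_psd q 1 n (\<lambda>a b. R ((\<lambda>_ _. A) a b))"
  proof -
    have "\<And>k G. \<forall>a b. G a b \<in> ops q m \<Longrightarrow> block_psd q k m G \<Longrightarrow> block_psd q k n (\<lambda>a b. R (G a b))"
      using R unfolding qchannel_def by blast
    from this[of "\<lambda>_ _. A" 1] show ?thesis using A one[of m A] by blast
  qed
  then show ?thesis using one by simp
qed

section \<open>Null vectors of positive functionals\<close>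

lemma real_quadratic_linear_zero:
  fixes x A :: real
  assumes "\<And>r. 0 \<le> r * x + r\<^sup>2 * A"
  shows "x = 0"
proof (rule ccontr)
  assume x: "x \<noteq> 0"
  \<comment> \<open>A bound above \<open>A\<close>: at \<open>r = - x / k\<close> the linear term
    outweighs the quadratic one.\<close>
  define k where "k = \<bar>A\<bar> + 1"
  have k: "k > 0" "A < k" by (auto simp: k_def)
  have "0 \<le> (- x / k) * x + (- x / k)\<^sup>2 * A" by (rule assms)
  also have "\<dots> = (x / k)\<^sup>2 * (A - k)" using k by (simp add: field_simps power2_eq_square)
  also have "\<dots> < 0" using x k by (intro mult_pos_neg) auto
  finally show False by simp
qed

text \<open>Real and purely imaginary \<open>s\<close> give real inequalities for the sum and the
  difference of \<beta> and \<gamma>; the vanishing imaginary parts of the assumption supply the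
  remaining two equations.\<close>

lemma complex_quadratic_linear_zero:
  assumes "\<And>s. 0 \<le> s * \<beta> + cnj s * \<gamma> + s * cnj s * \<alpha>"
  shows "\<beta> = 0"
proof -
  have r: "0 \<le> r * Re (\<beta> + \<gamma>) + r\<^sup>2 * Re \<alpha>" "r * Im (\<beta> + \<gamma>) + r\<^sup>2 * Im \<alpha> = 0" for r
    using assms[of "complex_of_real r"] by (auto simp: less_eq_complex_def algebra_simps power2_eq_square)
  have i: "0 \<le> r * Im (\<gamma> - \<beta>) + r\<^sup>2 * Re \<alpha>" "r * Re (\<beta> - \<gamma>) + r\<^sup>2 * Im \<alpha> = 0" for r
    using assms[of "\<i> * complex_of_real r"] by (auto simp: less_eq_complex_def algebra_simps power2_eq_square)
  have "Re (\<beta> + \<gamma>) = 0" "Im (\<gamma> - \<beta>) = 0"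
    using real_quadratic_linear_zero r(1) i(1) by blast+
  moreover have "Im (\<beta> + \<gamma>) = 0" "Re (\<beta> - \<gamma>) = 0"
    using r(2)[of 1] r(2)[of "-1"] i(2)[of 1] i(2)[of "-1"] by auto
  ultimately show ?thesis by (simp add: complex_eq_iff)
qed

text \<open>The degenerate case of the Cauchy-Schwarz inequality: the value at
  \<open>u + s v\<close> is nonnegative for all \<open>s\<close> and has no constant term, so its
  linear terms vanish.\<close>

lemma null_functional:
  fixes \<psi> :: "op \<Rightarrow> complex"
  assumes lin: "\<And>A B a b. A \<in> ops q M \<Longrightarrow> B \<in> ops q M \<Longrightarrow> \<psi> (\<lambda>X Y. a * A X Y + b * B X Y) = a * \<psi> A + b * \<psi> B"
    and pos: "\<And>w. w \<in> supp_space (words q M) \<Longrightarrow> 0 \<le> \<psi> (outer w w)"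
    and u: "u \<in> supp_space (words q M)" "\<psi> (outer u u) = 0" and v: "v \<in> supp_space (words q M)"
  shows "\<psi> (outer v u) = 0" "\<psi> (outer u v) = 0"
proof -
  have *: "0 \<le> s * \<psi> (outer v u) + cnj s * \<psi> (outer u v) + s * cnj s * \<psi> (outer v v)" for s
  proof -
    define w where "w = (\<lambda>X. 1 * u X + s * v X)"
    \<comment> \<open>Linearity is assumed for two operators at a time, so the four terms of
      \<open>outer w w\<close> are grouped in pairs.\<close>
    define A B where "A = (\<lambda>X Y. 1 * outer u u X Y + s * outer v u X Y)"
      and "B = (\<lambda>X Y. cnj s * outer u v X Y + (s * cnj s) * outer v v X Y)"
    have AB: "A \<in> ops q M" "B \<in> ops q M" unfolding A_def B_def by (intro ops_lin outer_ops u(1) v)+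
    have "w \<in> supp_space (words q M)" unfolding w_def by (rule lin_sub_comb[OF lin_sub_supp_space u(1) v])
    then have "0 \<le> \<psi> (outer w w)" by (rule pos)
    also have "outer w w = (\<lambda>X Y. 1 * A X Y + 1 * B X Y)"
      by (intro ext) (simp add: outer_def w_def A_def B_def algebra_simps)
    also have "\<psi> \<dots> = \<psi> A + \<psi> B" using lin[OF AB, of 1 1] by simp
    also have "\<psi> A = s * \<psi> (outer v u)" unfolding A_def using u v by (subst lin) (auto intro: outer_ops)
    also have "\<psi> B = cnj s * \<psi> (outer u v) + (s * cnj s) * \<psi> (outer v v)"
      unfolding B_def using u v by (subst lin) (auto intro: outer_ops)
    finally show ?thesis by (simp add: algebra_simps)
  qed
  show "\<psi> (outer v u) = 0" using complex_quadratic_linear_zero[OF *] .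
  have "0 \<le> s * \<psi> (outer u v) + cnj s * \<psi> (outer v u) + s * cnj s * \<psi> (outer v v)" for s
    using *[of "cnj s"] by (simp add: algebra_simps)
  then show "\<psi> (outer u v) = 0" by (rule complex_quadratic_linear_zero)
qed

text \<open>The functional \<open>A \<mapsto> \<langle>d, R A d\<rangle>\<close> and its complement to the trace are both positive; \<open>u\<close> is null
  for the first one and \<open>v\<close> for the second one.\<close>

lemma recovered_apart_imp_orthogonal:
  assumes R: "qchannel q M N R"
    and u: "u \<in> supp_space (words q M)" and v: "v \<in> supp_space (words q M)"
    and d: "d \<in> supp_space (words q N)" "ip (words q N) d d = 1"
    and ud: "qform (words q N) (R (outer u u)) d = 0"
    and vd: "qform (words q N) (R (outer v v)) d = ip (words q M) v v"
  shows "ip (words q M) u v = 0"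
proof -
  define \<phi> where "\<phi> = (\<lambda>A. qform (words q N) (R A) d)"
  define \<psi> where "\<psi> = (\<lambda>A. trace_on (words q M) A - \<phi> A)"
  have \<phi>lin: "\<phi> (\<lambda>X Y. a * A X Y + b * B X Y) = a * \<phi> A + b * \<phi> B"
    if "A \<in> ops q M" "B \<in> ops q M" for A B a b
    unfolding \<phi>_def qchannel_lin[OF R that] by (rule qform_lin)
  have \<psi>lin: "\<psi> (\<lambda>X Y. a * A X Y + b * B X Y) = a * \<psi> A + b * \<psi> B"
    if "A \<in> ops q M" "B \<in> ops q M" for A B a b
    unfolding \<psi>_def \<phi>lin[OF that] by (simp add: trace_on_def sum.distrib sum_distrib_left algebra_simps)
  have psd: "psd_on (words q N) (R (outer w w))" if "w \<in> supp_space (words q M)" for w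
    using qchannel_psd[OF R outer_ops[OF that that] psd_outer] .
  have \<phi>pos: "0 \<le> \<phi> (outer w w)" if "w \<in> supp_space (words q M)" for w
    using psd[OF that] unfolding \<phi>_def psd_on_qform by blast
  have \<psi>pos: "0 \<le> \<psi> (outer w w)" if "w \<in> supp_space (words q M)" for w
    using qform_le_trace[OF finite_words psd[OF that] d] qchannel_trace[OF R outer_ops[OF that that]]
    unfolding \<psi>_def \<phi>_def by simp
  have "\<phi> (outer v u) = 0"
    by (rule null_functional(1)[of q M \<phi>, OF \<phi>lin \<phi>pos u _ v]) (use ud in \<open>simp_all add: \<phi>_def\<close>)
  moreover have "\<psi> (outer v u) = 0"
    by (rule null_functional(2)[of q M \<psi>, OF \<psi>lin \<psi>pos v _ u]) (use vd in \<open>simp_all add: \<psi>_def \<phi>_def trace_outer\<close>)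
  \<comment> \<open>The trace of \<open>outer v u\<close> is \<open>ip u v\<close>, and it is the
    sum of the two vanishing values.\<close>
  ultimately show ?thesis unfolding \<psi>_def by (simp add: trace_outer)
qed

lemma Ins_P_sum:
  assumes "Q \<in> tsubsets (m + t) t" "length \<sigma> = t" "\<And>j. j \<in> J \<Longrightarrow> A j \<in> ops q m"
  shows "Ins_P q m Q \<sigma> (\<lambda>X Y. \<Sum>j\<in>J. k j * A j X Y) Z Z' = (\<Sum>j\<in>J. k j * Ins_P q m Q \<sigma> (A j) Z Z')"
  using assms by (auto simp: Ins_P_eval ops_sum sum_distrib_left mult_ac)

lemma del_chan_ops:
  assumes "\<rho> \<in> ops q N"
  shows "del_chan q N t pd \<rho> \<in> ops q (N - t)"
  unfolding del_chan_def by (rule ops_sum) (rule Era_P_ops[OF _ assms])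

lemma Ins_P_del_chan:
  assumes "Q \<in> tsubsets (N - t2 + t1) t1" "length \<sigma> = t1" "\<rho> \<in> ops q N"
  shows "Ins_P q (N - t2) Q \<sigma> (del_chan q N t2 pd \<rho>) Z Z' =
    (\<Sum>P\<in>tsubsets N t2. complex_of_real (pd P) * Ins_P q (N - t2) Q \<sigma> (Era_P q N P \<rho>) Z Z')"
  unfolding del_chan_def by (rule Ins_P_sum[OF assms(1,2)]) (rule Era_P_ops[OF _ assms(3)])

section \<open>The uniform channel with maximally mixed insertions\<close>

definition mixed :: "nat \<Rightarrow> nat \<Rightarrow> nat \<Rightarrow> complex" where
  "mixed q x y = (if x = y \<and> x < q then 1 / of_nat q else 0)"

lemma mixed_state:
  assumes "q > 0"
  shows "qudit_state q (mixed q)"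
  unfolding qudit_state_def density_on_def
proof (intro conjI allI impI)
  show "mixed q X Y = 0" if "X \<notin> {..<q} \<or> Y \<notin> {..<q}" for X Y
    using that by (auto simp: mixed_def)
  show "trace_on {..<q} (mixed q) = 1" using assms by (simp add: trace_on_def mixed_def)
  show "psd_on {..<q} (mixed q)"
    unfolding psd_on_def
  proof
    fix v :: "nat \<Rightarrow> complex"
    have "(\<Sum>X<q. \<Sum>Y<q. cnj (v X) * mixed q X Y * v Y) =
       (\<Sum>X<q. \<Sum>Y<q. if X = Y then cnj (v X) * v X * complex_of_real (1 / real q) else 0)"
      by (intro sum.cong refl) (auto simp: mixed_def)
    also have "\<dots> = (\<Sum>X<q. cnj (v X) * v X * complex_of_real (1 / real q))" by simp
    also have "\<dots> \<ge> 0"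
    proof (intro sum_nonneg)
      fix X
      have "0 \<le> cnj (v X) * v X" by (simp add: less_eq_complex_def)
      then show "0 \<le> cnj (v X) * v X * complex_of_real (1 / real q)"
        by (rule mult_nonneg_nonneg) (simp add: less_eq_complex_def)
    qed
    finally show "0 \<le> (\<Sum>X<q. \<Sum>Y<q. cnj (v X) * mixed q X Y * v Y)" .
  qed
qed

text \<open>Being diagonal, the mixed state removes the terms with \<open>b \<noteq> b'\<close> from
  \<open>insdel_outer\<close>; what remains has equal weights.\<close>

lemma wt_mixed:
  assumes "b \<in> words q t" "b' \<in> words q t"
  shows "wt (replicate t (mixed q)) b b' = (if b = b' then (1 / of_nat q) ^ t else 0)"
proof (cases "b = b'")
  case True
  have "wt (replicate t (mixed q)) b b' = (\<Prod>i<t. 1 / of_nat q)"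
    unfolding wt_def length_replicate
    using assms True by (intro prod.cong) (auto simp: mixed_def words_def)
  then show ?thesis using True by (simp add: power_divide)
next
  case False
  then obtain i where "i < t" "b ! i \<noteq> b' ! i"
    using assms by (auto simp: words_def list_eq_iff_nth_eq)
  then have "wt (replicate t (mixed q)) b b' = 0"
    unfolding wt_def length_replicate by (intro prod_zero) (auto simp: mixed_def)
  then show ?thesis using False by simp
qed

lemma card_tsubsets_pos: "t \<le> n \<Longrightarrow> card (tsubsets n t) > 0"
proof -
  assume "t \<le> n"
  then have "{1..t} \<in> tsubsets n t" by (auto simp: tsubsets_def)
  then show ?thesis using finite_tsubsets card_gt_0_iff by blast
qed

definition unif :: "nat \<Rightarrow> nat \<Rightarrow> real" where
  "unif n t = 1 / real (card (tsubsets n t))"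

lemma unif_pos: "t \<le> n \<Longrightarrow> unif n t > 0"
  using card_tsubsets_pos by (simp add: unif_def)

lemma sum_unif: "t \<le> n \<Longrightarrow> (\<Sum>P\<in>tsubsets n t. unif n t) = 1"
  using card_tsubsets_pos[of t n] by (simp add: unif_def card_gt_0_iff)

text \<open>A point mass, written as a uniform measure on a singleton so that integrability and
  integrals reduce to the finite case.\<close>

definition mixed_measure :: "nat \<Rightarrow> nat \<Rightarrow> (nat \<Rightarrow> nat \<Rightarrow> complex) list measure" where
  "mixed_measure q t = uniform_count_measure {replicate t (mixed q)}"

lemma integral_mixed_measure:
  fixes g :: "_ \<Rightarrow> complex"
  shows "integral\<^sup>L (mixed_measure q t) g = g (replicate t (mixed q))"
  unfolding mixed_measure_def uniform_count_measure_def
  by (subst lebesgue_integral_point_measure_finite) auto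

lemma uniform_ins_params:
  assumes "q > 0"
  shows "ins_params q m t (mixed_measure q t) (\<lambda>_ _. unif (m + t) t)"
  unfolding ins_params_def
proof (intro conjI)
  show "prob_space (mixed_measure q t)"
    unfolding mixed_measure_def by (rule prob_space_uniform_count_measure) auto
  show "\<forall>\<sigma>\<in>space (mixed_measure q t). length \<sigma> = t \<and> (\<forall>s\<in>set \<sigma>. qudit_state q s)"
    using mixed_state[OF assms] by (auto simp: mixed_measure_def space_uniform_count_measure)
  show "\<forall>\<sigma>\<in>space (mixed_measure q t). (\<forall>P\<in>tsubsets (m + t) t. 0 \<le> unif (m + t) t) \<and>
     (\<Sum>P\<in>tsubsets (m + t) t. unif (m + t) t) = 1"
    using sum_unif[of t "m + t"] by (auto simp: unif_def)
  show "\<forall>\<rho>\<in>ops q m. \<forall>X Y. integrable (mixed_measure q t)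
        (\<lambda>\<sigma>. \<Sum>P\<in>tsubsets (m + t) t. complex_of_real (unif (m + t) t) * Ins_P q m P \<sigma> \<rho> X Y)"
    unfolding mixed_measure_def uniform_count_measure_def
    by (intro ballI allI integrable_point_measure_finite) simp
qed

lemma uniform_del_params: "t \<le> N \<Longrightarrow> del_params N t (\<lambda>_. unif N t)"
  using sum_unif[of t N] unif_pos[of t N] by (simp add: del_params_def)

type_synonym err_index = "nat set \<times> nat set \<times> nat list \<times> nat list"

definition err_indices :: "nat \<Rightarrow> nat \<Rightarrow> nat \<Rightarrow> nat \<Rightarrow> err_index set" where
  "err_indices q N t1 t2 = tsubsets N t2 \<times> tsubsets (N - t2 + t1) t1 \<times> words q t2 \<times> words q t1"

definition err_vec :: "nat \<Rightarrow> nat \<Rightarrow> nat \<Rightarrow> err_index \<Rightarrow> vec \<Rightarrow> vec" where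
  "err_vec q N M = (\<lambda>(P, Q, a, b). err q N M (err_rel (zpos P) a (zpos Q) b))"

lemma err_vec_supp: "err_vec q N M i c \<in> supp_space (words q M)"
  by (auto simp: err_vec_def err_supp split: prod.splits)

lemma finite_err_indices [simp]: "finite (err_indices q N t1 t2)"
  by (simp add: err_indices_def)

lemma uniform_insdel_outer:
  assumes c: "c \<in> supp_space (words q N)" and t2: "t2 \<le> N"
  shows "ins_chan q (N - t2) t1 (mixed_measure q t1) (\<lambda>_ _. unif (N - t2 + t1) t1)
     (del_chan q N t2 (\<lambda>_. unif N t2) (outer c c)) =
    (\<lambda>Z Z'. \<Sum>i\<in>err_indices q N t1 t2.
       complex_of_real (unif (N - t2 + t1) t1 * unif N t2 * (1 / real q) ^ t1) *
       outer (err_vec q N (N - t2 + t1) i c) (err_vec q N (N - t2 + t1) i c) Z Z')"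
proof (intro ext)
  fix Z Z'
  let ?M = "N - t2 + t1" and ?\<sigma> = "replicate t1 (mixed q)"
  define h where "h = (\<lambda>P Q a b. outer (err q N ?M (err_rel (zpos P) a (zpos Q) b) c)
      (err q N ?M (err_rel (zpos P) a (zpos Q) b) c) Z Z')"
  have o: "outer c c \<in> ops q N" by (rule outer_ops[OF c c])
  have ic: "Ins_P q (N - t2) Q ?\<sigma> (Era_P q N P (outer c c)) Z Z' =
      (\<Sum>a\<in>words q t2. \<Sum>b\<in>words q t1. complex_of_real ((1 / real q) ^ t1) * h P Q a b)"
    if "P \<in> tsubsets N t2" "Q \<in> tsubsets ?M t1" for P Q
  proof -
    have "Ins_P q (N - t2) Q ?\<sigma> (Era_P q N P (outer c c)) Z Z' =
      (\<Sum>a\<in>words q t2. \<Sum>b\<in>words q t1. \<Sum>b'\<in>words q t1. wt ?\<sigma> b b' *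
       outer (err q N ?M (err_rel (zpos P) a (zpos Q) b) c) (err q N ?M (err_rel (zpos P) a (zpos Q) b') c) Z Z')"
      by (rule insdel_outer[OF that(1) t2 that(2) _ o]) simp
    also have "\<dots> = (\<Sum>a\<in>words q t2. \<Sum>b\<in>words q t1. \<Sum>b'\<in>words q t1.
        if b = b' then complex_of_real ((1 / real q) ^ t1) * h P Q a b else 0)"
      by (intro sum.cong refl) (auto simp: wt_mixed h_def)
    finally show ?thesis by simp
  qed
  have "ins_chan q (N - t2) t1 (mixed_measure q t1) (\<lambda>_ _. unif ?M t1)
     (del_chan q N t2 (\<lambda>_. unif N t2) (outer c c)) Z Z' =
    (\<Sum>Q\<in>tsubsets ?M t1. complex_of_real (unif ?M t1) *
       Ins_P q (N - t2) Q ?\<sigma> (del_chan q N t2 (\<lambda>_. unif N t2) (outer c c)) Z Z')"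
    unfolding ins_chan_def integral_mixed_measure ..
  also have "\<dots> = (\<Sum>Q\<in>tsubsets ?M t1. \<Sum>P\<in>tsubsets N t2. complex_of_real (unif ?M t1 * unif N t2) *
       (\<Sum>a\<in>words q t2. \<Sum>b\<in>words q t1. complex_of_real ((1 / real q) ^ t1) * h P Q a b))"
    by (intro sum.cong refl) (simp add: Ins_P_del_chan[OF _ _ o] ic sum_distrib_left mult.assoc cong: sum.cong)
  also have "\<dots> = (\<Sum>P\<in>tsubsets N t2. \<Sum>Q\<in>tsubsets ?M t1. complex_of_real (unif ?M t1 * unif N t2) *
       (\<Sum>a\<in>words q t2. \<Sum>b\<in>words q t1. complex_of_real ((1 / real q) ^ t1) * h P Q a b))"
    by (rule sum.swap)
  also have "\<dots> = (\<Sum>P\<in>tsubsets N t2. \<Sum>Q\<in>tsubsets ?M t1. \<Sum>a\<in>words q t2. \<Sum>b\<in>words q t1.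
       complex_of_real (unif ?M t1 * unif N t2 * (1 / real q) ^ t1) * h P Q a b)"
    by (simp add: sum_distrib_left mult.assoc)
  also have "\<dots> = (\<Sum>i\<in>err_indices q N t1 t2. complex_of_real (unif ?M t1 * unif N t2 * (1 / real q) ^ t1) *
       outer (err_vec q N ?M i c) (err_vec q N ?M i c) Z Z')"
    unfolding err_indices_def h_def err_vec_def by (simp add: sum.cartesian_product')
  finally show "ins_chan q (N - t2) t1 (mixed_measure q t1) (\<lambda>_ _. unif ?M t1)
     (del_chan q N t2 (\<lambda>_. unif N t2) (outer c c)) Z Z' =
    (\<Sum>i\<in>err_indices q N t1 t2. complex_of_real (unif ?M t1 * unif N t2 * (1 / real q) ^ t1) *
       outer (err_vec q N ?M i c) (err_vec q N ?M i c) Z Z')" .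
qed

lemma is_subspace_iff: "is_subspace q N C \<longleftrightarrow> lin_sub (words q N) C"
  by (simp add: is_subspace_def lin_sub_def)

text \<open>Two sums of nonnegative terms vanish. The recovered \<open>outer c c\<close> has value 0
  at \<open>d\<close>, so every single error of \<open>c\<close> is recovered to value 0 at
  \<open>d\<close>. The recovered \<open>outer d d\<close> has trace and value at \<open>d\<close>
  both equal to 1, so every single error of \<open>d\<close> keeps its full weight at
  \<open>d\<close>. These are the assumptions of
  \<open>recovered_apart_imp_orthogonal\<close>.\<close>

lemma insdel_code_orth_unit:
  assumes q: "q > 0" and t2: "t2 < N" and C: "is_subspace q N C" and code: "insdel_code q N t1 t2 C"
    and c: "c \<in> C" "ip (words q N) c c = 1" and d: "d \<in> C" "ip (words q N) d d = 1"
    and cd: "ip (words q N) c d = 0"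
    and ij: "i \<in> err_indices q N t1 t2" "j \<in> err_indices q N t1 t2"
  shows "ip (words q (N - t2 + t1)) (err_vec q N (N - t2 + t1) i c) (err_vec q N (N - t2 + t1) j d) = 0"
proof -
  let ?M = "N - t2 + t1" and ?E = "err_indices q N t1 t2"
  let ?u = "err_vec q N ?M"
  define \<omega> where "\<omega> = unif ?M t1 * unif N t2 * (1 / real q) ^ t1"
  have \<omega>: "\<omega> > 0" unfolding \<omega>_def using unif_pos[of t1 ?M] unif_pos[of t2 N] t2 q by simp
  then have \<omega>': "0 \<le> complex_of_real \<omega>" by (simp add: less_eq_complex_def)
  have "\<exists>R. qchannel q ?M N R \<and> (\<forall>\<rho>. density q N \<rho> \<and> supported_on C \<rho> \<longrightarrow>
      R (ins_chan q (N - t2) t1 (mixed_measure q t1) (\<lambda>_ _. unif ?M t1) (del_chan q N t2 (\<lambda>_. unif N t2) \<rho>)) = \<rho>)"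
    using code uniform_ins_params[OF q, of "N - t2" t1] uniform_del_params[of t2 N] t2
    unfolding insdel_code_def by simp
  then obtain R where R: "qchannel q ?M N R" and rec: "\<And>\<rho>. density q N \<rho> \<Longrightarrow> supported_on C \<rho> \<Longrightarrow>
      R (ins_chan q (N - t2) t1 (mixed_measure q t1) (\<lambda>_ _. unif ?M t1) (del_chan q N t2 (\<lambda>_. unif N t2) \<rho>)) = \<rho>"
    by blast
  have sub: "x \<in> supp_space (words q N)" if "x \<in> C" for x
    using C that by (auto simp: is_subspace_def supp_space_def)
  have uo: "outer (?u k x) (?u k x) \<in> ops q ?M" for k x
    by (rule outer_ops[OF err_vec_supp err_vec_supp])
  have recx: "R (\<lambda>Z Z'. \<Sum>k\<in>?E. complex_of_real \<omega> * outer (?u k x) (?u k x) Z Z') = outer x x"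
    if x: "x \<in> C" "ip (words q N) x x = 1" for x
  proof -
    have "density q N (outer x x)"
      unfolding density_def density_on_def
      using outer_ops[OF sub sub] x psd_outer[of "words q N" x] by (auto simp: trace_outer ops_def)
    moreover have "supported_on C (outer x x)"
      unfolding supported_on_def
    proof
      fix Y
      have "(\<lambda>X. cnj (x Y) * x X + 0 * x X) \<in> C" using C x(1) unfolding is_subspace_iff by (intro lin_sub_comb)
      then show "(\<lambda>X. outer x x X Y) \<in> C" by (simp add: outer_def mult.commute)
    qed
    ultimately show ?thesis
      using rec[of "outer x x"] unfolding uniform_insdel_outer[OF sub[OF x(1)] less_imp_le[OF t2]] \<omega>_def by blast
  qed
  have qsum: "qform (words q N) (outer x x) d = (\<Sum>k\<in>?E. complex_of_real \<omega> * qform (words q N) (R (outer (?u k x) (?u k x))) d)"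
    if x: "x \<in> C" "ip (words q N) x x = 1" for x
    unfolding recx[OF x, symmetric] qchannel_sum[OF R finite_err_indices uo] by (rule qform_sum)
  have psd: "psd_on (words q N) (R (outer (?u k x) (?u k x)))" for k x
    by (rule qchannel_psd[OF R uo psd_outer])
  have pos: "0 \<le> qform (words q N) (R (outer (?u k x) (?u k x))) d" for k x
    using psd unfolding psd_on_qform by blast
  have "(\<Sum>k\<in>?E. complex_of_real \<omega> * qform (words q N) (R (outer (?u k c) (?u k c))) d) = 0"
    using qsum[OF c] by (simp add: qform_outer cd)
  then have "complex_of_real \<omega> * qform (words q N) (R (outer (?u i c) (?u i c))) d = 0"
    using ij(1) \<omega>' pos by (subst (asm) sum_nonneg_eq_0_iff) (auto intro!: mult_nonneg_nonneg)
  then have 1: "qform (words q N) (R (outer (?u i c) (?u i c))) d = 0" using \<omega> by simp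
  \<comment> \<open>The weight of the \<open>k\<close>-th error of \<open>d\<close> that recovery
    would move away from \<open>d\<close>.\<close>
  define \<delta> where "\<delta> = (\<lambda>k. ip (words q ?M) (?u k d) (?u k d) - qform (words q N) (R (outer (?u k d) (?u k d))) d)"
  have \<delta>pos: "0 \<le> \<delta> k" for k
    using qform_le_trace[OF finite_words psd sub[OF d(1)] d(2), of k d] qchannel_trace[OF R uo]
    unfolding \<delta>_def by (simp add: trace_outer)
  have "(\<Sum>k\<in>?E. complex_of_real \<omega> * ip (words q ?M) (?u k d) (?u k d)) =
      trace_on (words q ?M) (\<lambda>Z Z'. \<Sum>k\<in>?E. complex_of_real \<omega> * outer (?u k d) (?u k d) Z Z')"
    by (simp add: trace_sum trace_outer)
  also have "\<dots> = trace_on (words q N) (outer d d)"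
    unfolding recx[OF d, symmetric] by (rule qchannel_trace[OF R, symmetric]) (rule ops_sum[OF uo])
  also have "\<dots> = 1" by (simp add: trace_outer d)
  also have "\<dots> = (\<Sum>k\<in>?E. complex_of_real \<omega> * qform (words q N) (R (outer (?u k d) (?u k d))) d)"
    using qsum[OF d] by (simp add: qform_outer d)
  finally have "(\<Sum>k\<in>?E. complex_of_real \<omega> * \<delta> k) = 0"
    unfolding \<delta>_def by (simp add: algebra_simps sum_subtractf)
  then have "complex_of_real \<omega> * \<delta> j = 0"
    using ij(2) \<omega>' \<delta>pos by (subst (asm) sum_nonneg_eq_0_iff) (auto intro!: mult_nonneg_nonneg)
  then have 2: "qform (words q N) (R (outer (?u j d) (?u j d))) d = ip (words q ?M) (?u j d) (?u j d)"
    using \<omega> by (simp add: \<delta>_def)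
  show ?thesis
    by (rule recovered_apart_imp_orthogonal[OF R err_vec_supp err_vec_supp sub[OF d(1)] d(2) 1 2])
qed

lemma script_err_vec:
  assumes e: "script q (N - t2) t2 t1 e" and t2: "t2 \<le> N"
  obtains i where "i \<in> err_indices q N t1 t2"
    "\<And>c. err q N (N - t2 + t1) (runs e) c = err_vec q N (N - t2 + t1) i c"
proof
  let ?M = "N - t2 + t1"
  have k: "keeps e + length (dels e) = N" "keeps e + length (inss e) = ?M" "length (dels e) = t2" "length (inss e) = t1"
    using e t2 by (auto simp: script_def)
  show "(Suc ` del_pos e, Suc ` ins_pos e, dels e, inss e) \<in> err_indices q N t1 t2"
    unfolding err_indices_def using del_pos_card[of e] ins_pos_card[of e] e k
    by (auto intro!: Suc_image_tsubsets simp: words_def script_def simp del: image_Suc_lessThan)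
  show "err q N ?M (runs e) c = err_vec q N ?M (Suc ` del_pos e, Suc ` ins_pos e, dels e, inss e) c" for c
    unfolding err_vec_def
    by (simp, rule err_cong, rule runs_iff_err_rel) (use k in \<open>auto simp: words_def\<close>)
qed

lemma rel_form_scale:
  "rel_form q N r (\<lambda>X. a * c X) (\<lambda>X. b * d X) = cnj a * b * rel_form q N r c d"
  by (simp add: rel_form_def sum_distrib_left mult_ac)

lemma normalize_vec:
  assumes "lin_sub I C" "c \<in> C" "ip I c c \<noteq> 0"
  obtains s where "s \<noteq> 0" "(\<lambda>X. s * c X) \<in> C" "ip I (\<lambda>X. s * c X) (\<lambda>X. s * c X) = 1"
proof -
  define r where "r = (\<Sum>x\<in>I. (cmod (c x))\<^sup>2)"
  have r: "ip I c c = complex_of_real r" unfolding r_def by (rule ip_self)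
  have "r \<ge> 0" unfolding r_def by (intro sum_nonneg) auto
  then have r0: "r > 0" using assms(3) r by (cases "r = 0") auto
  define s where "s = complex_of_real (1 / sqrt r)"
  have "(\<lambda>X. s * c X + 0 * c X) \<in> C" by (rule lin_sub_comb[OF assms(1,2,2)])
  moreover have "ip I (\<lambda>X. s * c X) (\<lambda>X. s * c X) = complex_of_real (1 / sqrt r * (1 / sqrt r) * r)"
    unfolding ip_scale_left ip_scale_right r s_def of_real_mult by (simp only: complex_cnj_complex_of_real mult_ac)
  moreover have "1 / sqrt r * (1 / sqrt r) * r = 1" using r0 by (simp add: field_simps)
  ultimately show thesis using that[of s] r0 by (simp add: s_def)
qed

lemma insdel_code_imp_pair_orth:
  assumes q: "q > 0" and t2: "t2 < N" and C: "is_subspace q N C" and code: "insdel_code q N t1 t2 C"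
    and c: "c \<in> C" and d: "d \<in> C" and cd: "ip (words q N) c d = 0"
  shows "pair_orth q N t1 t2 c d"
  unfolding pair_orth_def
proof (intro allI impI)
  fix e f assume e: "script q (N - t2) t2 t1 e" and f: "script q (N - t2) t2 t1 f"
  have C': "lin_sub (words q N) C" using C by (simp add: is_subspace_iff)
  show "rel_form q N (connects e f) c d = 0"
  proof (cases "ip (words q N) c c = 0 \<or> ip (words q N) d d = 0")
    case True
    then have "(\<forall>X\<in>words q N. c X = 0) \<or> (\<forall>X\<in>words q N. d X = 0)"
      using ip_self_eq_0[OF finite_words] by blast
    then show ?thesis by (auto simp: rel_form_def)
  next
    case False
    obtain s where s: "s \<noteq> 0" "(\<lambda>X. s * c X) \<in> C" "ip (words q N) (\<lambda>X. s * c X) (\<lambda>X. s * c X) = 1"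
      using normalize_vec[OF C' c] False by blast
    obtain t where t: "t \<noteq> 0" "(\<lambda>X. t * d X) \<in> C" "ip (words q N) (\<lambda>X. t * d X) (\<lambda>X. t * d X) = 1"
      using normalize_vec[OF C' d] False by blast
    have st: "ip (words q N) (\<lambda>X. s * c X) (\<lambda>X. t * d X) = 0"
      unfolding ip_scale_left ip_scale_right cd by simp
    obtain i where i: "i \<in> err_indices q N t1 t2"
      "\<And>c. err q N (N - t2 + t1) (runs e) c = err_vec q N (N - t2 + t1) i c"
      using script_err_vec[OF e less_imp_le[OF t2]] by blast
    obtain j where j: "j \<in> err_indices q N t1 t2"
      "\<And>c. err q N (N - t2 + t1) (runs f) c = err_vec q N (N - t2 + t1) j c"
      using script_err_vec[OF f less_imp_le[OF t2]] by blast
    have "rel_form q N (connects e f) (\<lambda>X. s * c X) (\<lambda>X. t * d X) = 0"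
      unfolding ip_err_script[OF e f, symmetric] i(2) j(2)
      by (rule insdel_code_orth_unit[OF q t2 C code s(2,3) t(2,3) st i(1) j(1)])
    then show ?thesis unfolding rel_form_scale using s(1) t(1) by simp
  qed
qed

section \<open>Orthogonality implies recovery\<close>

lemma kraus_map_sum:
  "kraus_map q m n S K (\<lambda>Z Z'. \<Sum>j\<in>J. k j * A j Z Z') = (\<lambda>X Y. \<Sum>j\<in>J. k j * kraus_map q m n S K (A j) X Y)"
proof (intro ext)
  fix X Y
  have "(\<Sum>i\<in>S. \<Sum>Z\<in>words q m. \<Sum>Z'\<in>words q m. K i X Z * (\<Sum>j\<in>J. k j * A j Z Z') * cnj (K i Y Z'))
    = (\<Sum>i\<in>S. \<Sum>Z\<in>words q m. \<Sum>Z'\<in>words q m. \<Sum>j\<in>J. k j * (K i X Z * A j Z Z' * cnj (K i Y Z')))"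
    by (simp add: sum_distrib_left sum_distrib_right mult_ac)
  also have "\<dots> = (\<Sum>i\<in>S. \<Sum>j\<in>J. \<Sum>Z\<in>words q m. \<Sum>Z'\<in>words q m. k j * (K i X Z * A j Z Z' * cnj (K i Y Z')))"
    by (intro sum.cong[OF refl] sum3_rotate)
  also have "\<dots> = (\<Sum>j\<in>J. k j * (\<Sum>i\<in>S. \<Sum>Z\<in>words q m. \<Sum>Z'\<in>words q m. K i X Z * A j Z Z' * cnj (K i Y Z')))"
    by (subst sum.swap) (simp add: sum_distrib_left)
  finally show "kraus_map q m n S K (\<lambda>Z Z'. \<Sum>j\<in>J. k j * A j Z Z') X Y = (\<Sum>j\<in>J. k j * kraus_map q m n S K (A j) X Y)"
    by (auto simp: kraus_map_def)
qed

lemma kraus_map_integral: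
  assumes "\<And>Z Z'. integrable \<mu> (\<lambda>s. F s Z Z')"
  shows "kraus_map q m n S K (\<lambda>Z Z'. integral\<^sup>L \<mu> (\<lambda>s. F s Z Z')) = (\<lambda>X Y. integral\<^sup>L \<mu> (\<lambda>s. kraus_map q m n S K (F s) X Y))"
proof (intro ext)
  fix X Y
  have i: "integrable \<mu> (\<lambda>s. K i X Z * F s Z Z' * cnj (K i Y Z'))" for i Z Z'
    using assms by simp
  have "(\<Sum>i\<in>S. \<Sum>Z\<in>words q m. \<Sum>Z'\<in>words q m. K i X Z * integral\<^sup>L \<mu> (\<lambda>s. F s Z Z') * cnj (K i Y Z')) =
    (\<Sum>i\<in>S. \<Sum>Z\<in>words q m. \<Sum>Z'\<in>words q m. integral\<^sup>L \<mu> (\<lambda>s. K i X Z * F s Z Z' * cnj (K i Y Z')))"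
    using assms by simp
  also have "\<dots> = integral\<^sup>L \<mu> (\<lambda>s. \<Sum>i\<in>S. \<Sum>Z\<in>words q m. \<Sum>Z'\<in>words q m. K i X Z * F s Z Z' * cnj (K i Y Z'))"
    using i by (simp add: Bochner_Integration.integral_sum)
  finally show "kraus_map q m n S K (\<lambda>Z Z'. integral\<^sup>L \<mu> (\<lambda>s. F s Z Z')) X Y = integral\<^sup>L \<mu> (\<lambda>s. kraus_map q m n S K (F s) X Y)"
    by (auto simp: kraus_map_def)
qed

lemma kraus_map_outer:
  "kraus_map q m n S K (outer u v) X Y = (if X \<in> words q n \<and> Y \<in> words q n then
     (\<Sum>k\<in>S. (\<Sum>Z\<in>words q m. K k X Z * u Z) * cnj (\<Sum>Z\<in>words q m. K k Y Z * v Z)) else 0)"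
  by (simp add: kraus_map_def outer_def sum_product mult_ac)

text \<open>Invert the isometries \<open>f g\<close> of \<open>knill_laflamme_isometries\<close>,
  which have orthogonal ranges. An error \<open>i\<close> on the left and \<open>j\<close> on the
  right then contribute the sum of \<open>L i g * cnj (L j g)\<close> over \<open>G\<close>; this
  \<kappa> does not depend on the codewords.\<close>

lemma knill_laflamme_recovery:
  fixes V :: "'j \<Rightarrow> vec \<Rightarrow> vec"
  assumes q: "q > 0" and J: "finite J" and A: "finite A" "orthonormal (words q N) A" "A \<subseteq> supp_space (words q N)"
    and V: "\<And>j a. j \<in> J \<Longrightarrow> a \<in> A \<Longrightarrow> V j a \<in> supp_space (words q M)"
    and gram: "\<And>i j a b. i \<in> J \<Longrightarrow> j \<in> J \<Longrightarrow> a \<in> A \<Longrightarrow> b \<in> A \<Longrightarrow>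
       ip (words q M) (V i a) (V j b) = (if a = b then \<Gamma> i j else 0)"
  obtains S :: "(vec + vec) set" and K \<kappa> where
    "qchannel q M N (kraus_map q M N S K)"
    "\<And>i j a b. i \<in> J \<Longrightarrow> j \<in> J \<Longrightarrow> a \<in> A \<Longrightarrow> b \<in> A \<Longrightarrow>
       kraus_map q M N S K (outer (V i a) (V j b)) = (\<lambda>X Y. \<kappa> i j * outer a b X Y)"
proof -
  obtain G :: "vec set" and f L where G: "finite G"
    and f: "\<And>g h a b. g \<in> G \<Longrightarrow> h \<in> G \<Longrightarrow> a \<in> A \<Longrightarrow> b \<in> A \<Longrightarrow> ip (words q M) (f g a) (f h b) = of_bool (g = h \<and> a = b)"
    and fs: "\<And>g a. g \<in> G \<Longrightarrow> a \<in> A \<Longrightarrow> f g a \<in> supp_space (words q M)"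
    and VL: "\<And>j a. j \<in> J \<Longrightarrow> a \<in> A \<Longrightarrow> V j a = (\<lambda>x. \<Sum>g\<in>G. L j g * f g a x)"
  proof (rule knill_laflamme_isometries[of "words q M" J A V \<Gamma>, OF finite_words J])
    fix G :: "vec set" and f L
    assume "finite G"
      "\<And>g h a b. g \<in> G \<Longrightarrow> h \<in> G \<Longrightarrow> a \<in> A \<Longrightarrow> b \<in> A \<Longrightarrow> ip (words q M) (f g a) (f h b) = of_bool (g = h \<and> a = b)"
      "\<And>g a. g \<in> G \<Longrightarrow> a \<in> A \<Longrightarrow> f g a \<in> supp_space (words q M)"
      "\<And>j a. j \<in> J \<Longrightarrow> a \<in> A \<Longrightarrow> V j a = (\<lambda>x. \<Sum>g\<in>G. L j g * f g a x)"
    then show thesis by (rule that[of G f L])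
  qed (simp_all add: V gram)
  define F where "F = (\<lambda>(g, a). f g a) ` (G \<times> A)"
  have inj: "inj_on (\<lambda>(g, a). f g a) (G \<times> A)"
  proof (rule inj_onI, clarify)
    fix g a h b assume ga: "g \<in> G" "a \<in> A" "h \<in> G" "b \<in> A" "f g a = f h b"
    then have "of_bool (g = h \<and> a = b) = (1::complex)"
      using f[OF ga(1,3,2,4)] f[OF ga(1,1,2,2)] by simp
    then show "g = h \<and> a = b" by (simp split: if_splits)
  qed
  have F: "finite F" "orthonormal (words q M) F" "F \<subseteq> supp_space (words q M)"
    using G A fs f inj unfolding F_def orthonormal_def by (auto simp: inj_on_def)
  obtain B where B: "finite B" "orthonormal (words q M) B" "F \<subseteq> B"
    and Bfull: "\<And>w. w \<in> supp_space (words q M) \<Longrightarrow> w = (\<lambda>x. \<Sum>b\<in>B. ip (words q M) b w * b x)"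
    by (rule orthonormal_basis_extend[OF finite_words lin_sub_supp_space F]) blast
  \<comment> \<open>An arbitrary basis word, legal because \<open>q > 0\<close>, that serves as
    output on the complement of all error spaces.\<close>
  define X0 where "X0 = replicate N (0::nat)"
  have X0: "X0 \<in> words q N" using q by (simp add: X0_def words_def)
  \<comment> \<open>\<open>Inl g\<close> undoes \<open>f g\<close>; \<open>Inr b\<close> sends the
    leftover basis vector \<open>b\<close> to \<open>X0\<close>. The second kind only completes the
    operators to a trace-preserving map, since it annihilates every \<open>V j a\<close>.\<close>
  define S where "S = G <+> (B - F)"
  define K where "K = case_sum (\<lambda>g X Z. \<Sum>a\<in>A. a X * cnj (f g a Z)) (\<lambda>b X Z. of_bool (X = X0) * cnj (b Z))"
  have resolution: "(\<Sum>k\<in>S. \<Sum>X\<in>words q N. K k X Z * cnj (K k X Z')) = of_bool (Z = Z')"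
    if Z: "Z \<in> words q M" "Z' \<in> words q M" for Z Z'
  proof -
    have 1: "(\<Sum>X\<in>words q N. K (Inl g) X Z * cnj (K (Inl g) X Z')) = (\<Sum>a\<in>A. f g a Z' * cnj (f g a Z))" for g
    proof -
      have "(\<Sum>X\<in>words q N. K (Inl g) X Z * cnj (K (Inl g) X Z')) =
        (\<Sum>X\<in>words q N. \<Sum>a\<in>A. \<Sum>a'\<in>A. cnj (f g a Z) * f g a' Z' * (cnj (a' X) * a X))"
        by (simp add: K_def sum_product mult_ac)
      also have "\<dots> = (\<Sum>a\<in>A. \<Sum>a'\<in>A. \<Sum>X\<in>words q N. cnj (f g a Z) * f g a' Z' * (cnj (a' X) * a X))"
        by (rule sum3_rotate[symmetric])
      also have "\<dots> = (\<Sum>a\<in>A. \<Sum>a'\<in>A. cnj (f g a Z) * f g a' Z' * ip (words q N) a' a)"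
        by (simp add: ip_def sum_distrib_left)
      also have "\<dots> = (\<Sum>a\<in>A. \<Sum>a'\<in>A. if a = a' then f g a Z' * cnj (f g a Z) else 0)"
        using A(2) by (intro sum.cong refl) (auto simp: orthonormal_def)
      also have "\<dots> = (\<Sum>a\<in>A. f g a Z' * cnj (f g a Z))" using A(1) by simp
      finally show ?thesis .
    qed
    have 2: "(\<Sum>X\<in>words q N. K (Inr b) X Z * cnj (K (Inr b) X Z')) = b Z' * cnj (b Z)" for b
    proof -
      have "(\<Sum>X\<in>words q N. K (Inr b) X Z * cnj (K (Inr b) X Z')) = (\<Sum>X\<in>words q N. if X = X0 then b Z' * cnj (b Z) else 0)"
        unfolding K_def by (intro sum.cong) auto
      then show ?thesis using X0 by simp
    qed
    have "(\<Sum>k\<in>S. \<Sum>X\<in>words q N. K k X Z * cnj (K k X Z')) =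
      (\<Sum>g\<in>G. \<Sum>a\<in>A. f g a Z' * cnj (f g a Z)) + (\<Sum>b\<in>B - F. b Z' * cnj (b Z))"
      unfolding S_def using G B(1) by (subst sum.Plus) (auto simp: 1 2)
    also have "(\<Sum>g\<in>G. \<Sum>a\<in>A. f g a Z' * cnj (f g a Z)) = (\<Sum>b\<in>F. b Z' * cnj (b Z))"
      unfolding F_def sum.reindex[OF inj] by (simp add: sum.cartesian_product case_prod_unfold)
    also have "\<dots> + (\<Sum>b\<in>B - F. b Z' * cnj (b Z)) = (\<Sum>b\<in>B. b Z' * cnj (b Z))"
      using sum.subset_diff[OF B(3,1), of "\<lambda>b. b Z' * cnj (b Z)"] by (simp add: add.commute)
    also have "\<dots> = of_bool (Z' = Z)" using full_basis_resolution[OF finite_words Bfull Z(2,1)] .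
    finally show ?thesis by (simp add: eq_commute)
  qed
  have ch: "qchannel q M N (kraus_map q M N S K)"
    by (rule qchannel_kraus[OF resolution])
  have Tf1: "(\<Sum>Z\<in>words q M. K (Inl h) X Z * f g a Z) = (if h = g then a X else 0)"
    if "h \<in> G" "g \<in> G" "a \<in> A" for h g a X
  proof -
    have "(\<Sum>Z\<in>words q M. K (Inl h) X Z * f g a Z) = (\<Sum>Z\<in>words q M. \<Sum>a'\<in>A. a' X * (cnj (f h a' Z) * f g a Z))"
      by (simp add: K_def sum_distrib_right mult.assoc)
    also have "\<dots> = (\<Sum>a'\<in>A. a' X * ip (words q M) (f h a') (f g a))"
      by (subst sum.swap) (simp add: ip_def sum_distrib_left)
    also have "\<dots> = (\<Sum>a'\<in>A. if a' = a then (if h = g then a X else 0) else 0)"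
      using that by (intro sum.cong refl) (auto simp: f)
    also have "\<dots> = (if h = g then a X else 0)" using A(1) that by simp
    finally show ?thesis .
  qed
  have Tf2: "(\<Sum>Z\<in>words q M. K (Inr b) X Z * f g a Z) = 0"
    if "b \<in> B - F" "g \<in> G" "a \<in> A" for b g a X
  proof -
    have "f g a \<in> F" using that unfolding F_def by auto
    then have "b \<in> B" "f g a \<in> B" "b \<noteq> f g a" using that B(3) by auto
    then have "ip (words q M) b (f g a) = 0" using B(2) by (simp add: orthonormal_def)
    then show ?thesis by (simp add: K_def ip_def sum_distrib_left[symmetric] mult.assoc)
  qed
  have TV: "(\<Sum>Z\<in>words q M. K k X Z * V j a Z) = (\<Sum>g\<in>G. L j g * (\<Sum>Z\<in>words q M. K k X Z * f g a Z))"
    if "j \<in> J" "a \<in> A" for k j a X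
  proof -
    have "(\<Sum>Z\<in>words q M. K k X Z * V j a Z) = (\<Sum>Z\<in>words q M. \<Sum>g\<in>G. L j g * (K k X Z * f g a Z))"
      by (simp add: VL[OF that] sum_distrib_left mult_ac)
    also have "\<dots> = (\<Sum>g\<in>G. L j g * (\<Sum>Z\<in>words q M. K k X Z * f g a Z))"
      by (subst sum.swap) (simp add: sum_distrib_left)
    finally show ?thesis .
  qed
  have TV1: "(\<Sum>Z\<in>words q M. K (Inl h) X Z * V j a Z) = L j h * a X" if "j \<in> J" "a \<in> A" "h \<in> G" for h j a X
  proof -
    have "(\<Sum>Z\<in>words q M. K (Inl h) X Z * V j a Z) = (\<Sum>g\<in>G. if h = g then L j g * a X else 0)"
      unfolding TV[OF that(1,2)] using that by (intro sum.cong refl) (auto simp: Tf1)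
    then show ?thesis using G that by simp
  qed
  have TV2: "(\<Sum>Z\<in>words q M. K (Inr b) X Z * V j a Z) = 0" if "j \<in> J" "a \<in> A" "b \<in> B - F" for b j a X
    unfolding TV[OF that(1,2)] using that by (simp add: Tf2)
  have out: "kraus_map q M N S K (outer (V i a) (V j b)) = (\<lambda>X Y. (\<Sum>g\<in>G. L i g * cnj (L j g)) * outer a b X Y)"
    if ij: "i \<in> J" "j \<in> J" and ab: "a \<in> A" "b \<in> A" for i j a b
  proof (intro ext)
    fix X Y
    show "kraus_map q M N S K (outer (V i a) (V j b)) X Y = (\<Sum>g\<in>G. L i g * cnj (L j g)) * outer a b X Y"
    proof (cases "X \<in> words q N \<and> Y \<in> words q N")
      case True
      have "kraus_map q M N S K (outer (V i a) (V j b)) X Y =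
        (\<Sum>k\<in>S. (\<Sum>Z\<in>words q M. K k X Z * V i a Z) * cnj (\<Sum>Z\<in>words q M. K k Y Z * V j b Z))"
        using True by (simp add: kraus_map_outer)
      also have "\<dots> = (\<Sum>g\<in>G. (L i g * a X) * cnj (L j g * b Y))"
        unfolding S_def using G B(1) ij ab by (subst sum.Plus) (auto simp: TV1 TV2 simp del: cnj_sum)
      also have "\<dots> = (\<Sum>g\<in>G. L i g * cnj (L j g)) * outer a b X Y"
        unfolding sum_distrib_right by (intro sum.cong refl) (simp add: outer_def mult_ac)
      finally show ?thesis .
    next
      case False
      then have "outer a b X Y = 0" using A(3) ab unfolding supp_space_def outer_def by auto
      then show ?thesis using False by (auto simp: kraus_map_outer)
    qed
  qed
  show thesis by (rule that[OF ch out])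
qed

section \<open>Linearity and trace of erasures and insertions\<close>

lemma Era_P_eval:
  assumes P: "P \<in> tsubsets N t" "t \<le> N" and \<rho>: "\<rho> \<in> ops q N"
  shows "Era_P q N P \<rho> W W' = (if W \<in> words q (N - t) \<and> W' \<in> words q (N - t)
    then \<Sum>a\<in>words q t. \<rho> (mrg (sorted_list_of_set P) a W) (mrg (sorted_list_of_set P) a W') else 0)"
proof (cases "W \<in> words q (N - t) \<and> W' \<in> words q (N - t)")
  case True
  note ps = sorted_list_tsubsets[OF P(1)]
  show ?thesis using era_seq_eval[OF ps(1), of "N - t" W q W' \<rho>] ps True P(2) by (simp add: Era_P_def)
next
  case False
  then show ?thesis using Era_P_ops[OF P(1) \<rho>] by (auto simp: ops_def)
qed

lemma Era_P_sum:
  assumes "P \<in> tsubsets N t" "t \<le> N" "\<And>j. j \<in> J \<Longrightarrow> A j \<in> ops q N"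
  shows "Era_P q N P (\<lambda>X Y. \<Sum>j\<in>J. k j * A j X Y) = (\<lambda>W W'. \<Sum>j\<in>J. k j * Era_P q N P (A j) W W')"
proof (intro ext)
  fix W W'
  show "Era_P q N P (\<lambda>X Y. \<Sum>j\<in>J. k j * A j X Y) W W' = (\<Sum>j\<in>J. k j * Era_P q N P (A j) W W')"
  proof (cases "W \<in> words q (N - t) \<and> W' \<in> words q (N - t)")
    case True
    let ?ps = "sorted_list_of_set P"
    have "Era_P q N P (\<lambda>X Y. \<Sum>j\<in>J. k j * A j X Y) W W' =
        (\<Sum>a\<in>words q t. \<Sum>j\<in>J. k j * A j (mrg ?ps a W) (mrg ?ps a W'))"
      using True by (simp add: Era_P_eval[OF assms(1,2) ops_sum[OF assms(3)]])
    also have "\<dots> = (\<Sum>j\<in>J. k j * (\<Sum>a\<in>words q t. A j (mrg ?ps a W) (mrg ?ps a W')))"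
      by (subst sum.swap) (simp add: sum_distrib_left)
    also have "\<dots> = (\<Sum>j\<in>J. k j * Era_P q N P (A j) W W')"
      using True by (intro sum.cong refl) (simp add: Era_P_eval[OF assms(1,2) assms(3)])
    finally show ?thesis .
  next
    case False
    have "Era_P q N P (A j) W W' = 0" if "j \<in> J" for j
      using False by (subst Era_P_eval[OF assms(1,2) assms(3)[OF that]]) auto
    moreover have "Era_P q N P (\<lambda>X Y. \<Sum>j\<in>J. k j * A j X Y) W W' = 0"
      using False by (subst Era_P_eval[OF assms(1,2) ops_sum[OF assms(3)]]) auto
    ultimately show ?thesis by simp
  qed
qed

lemma words_mrg_sum:
  assumes P: "P \<in> tsubsets n t" "t \<le> n"
  shows "(\<Sum>X\<in>words q n. f X) = (\<Sum>a\<in>words q t. \<Sum>W\<in>words q (n - t). f (mrg (sorted_list_of_set P) a W))"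
proof -
  let ?ps = "sorted_list_of_set P"
  note ps = sorted_list_tsubsets[OF P(1)]
  have iff: "mrg ?ps a W = X \<longleftrightarrow> nths X (zpos P) = a \<and> nths X (- zpos P) = W"
    if "X \<in> words q n" "a \<in> words q t" "W \<in> words q (n - t)" for X a W
    using mrg_eq_iff[OF ps(1), of X a W] that ps P(2) by (simp add: words_def)
  have mw: "mrg ?ps a W \<in> words q n" if "a \<in> words q t" "W \<in> words q (n - t)" for a W
    using mrg_words[OF ps(1), of "n - t" a q W] that ps P(2) by simp
  have "(\<Sum>a\<in>words q t. \<Sum>W\<in>words q (n - t). f (mrg ?ps a W)) =
    (\<Sum>(a, W)\<in>words q t \<times> words q (n - t). f (mrg ?ps a W))"
    by (simp add: sum.cartesian_product)
  also have "\<dots> = (\<Sum>X\<in>words q n. f X)"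
  proof (rule sum.reindex_bij_witness[of _ "\<lambda>X. (nths X (zpos P), nths X (- zpos P))" "\<lambda>(a, W). mrg ?ps a W"])
    fix X assume X: "X \<in> words q n"
    have w: "nths X (zpos P) \<in> words q t" "nths X (- zpos P) \<in> words q (n - t)"
      using nths_words[OF zpos_tsubsets[OF P(1)] X] .
    show "(nths X (zpos P), nths X (- zpos P)) \<in> words q t \<times> words q (n - t)" using w by simp
    show "(case (nths X (zpos P), nths X (- zpos P)) of (a, W) \<Rightarrow> mrg ?ps a W) = X"
      using iff[OF X w] by simp
  next
    fix aW assume aW: "aW \<in> words q t \<times> words q (n - t)"
    then obtain a W where a: "aW = (a, W)" "a \<in> words q t" "W \<in> words q (n - t)" by blast
    show "(case aW of (a, W) \<Rightarrow> mrg ?ps a W) \<in> words q n" using mw a by simp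
    show "(nths (case aW of (a, W) \<Rightarrow> mrg ?ps a W) (zpos P), nths (case aW of (a, W) \<Rightarrow> mrg ?ps a W) (- zpos P)) = aW"
      using iff[OF mw[OF a(2,3)] a(2,3)] a(1) by simp
  qed auto
  finally show ?thesis by simp
qed

lemma sum_wt_diag:
  assumes "\<forall>s\<in>set \<sigma>. qudit_state q s"
  shows "(\<Sum>b\<in>words q (length \<sigma>). wt \<sigma> b b) = 1"
  using assms
proof (induction \<sigma> rule: rev_induct)
  case Nil
  then show ?case by (simp add: wt_def)
next
  case (snoc s \<sigma>)
  have "(\<Sum>x<q. s x x) = 1" using snoc.prems by (simp add: qudit_state_def density_on_def trace_on_def)
  have "(\<Sum>b\<in>words q (length (\<sigma> @ [s])). wt (\<sigma> @ [s]) b b) = (\<Sum>b\<in>words q (length \<sigma>). \<Sum>x<q. s x x * wt \<sigma> b b)"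
    unfolding length_append_singleton words_snoc_sum
    by (intro sum.cong refl wt_snoc) (auto simp: words_def)
  also have "\<dots> = 1" using snoc \<open>(\<Sum>x<q. s x x) = 1\<close> by (simp add: sum_distrib_right[symmetric])
  finally show ?case .
qed

lemma trace_Era_P:
  assumes P: "P \<in> tsubsets N t" "t \<le> N" and \<rho>: "\<rho> \<in> ops q N"
  shows "trace_on (words q (N - t)) (Era_P q N P \<rho>) = trace_on (words q N) \<rho>"
  unfolding trace_on_def words_mrg_sum[OF P]
  by (subst sum.swap) (simp add: Era_P_eval[OF assms])

lemma trace_Ins_P:
  assumes Q: "Q \<in> tsubsets (m + t) t" and \<sigma>: "length \<sigma> = t" "\<forall>s\<in>set \<sigma>. qudit_state q s" and \<rho>: "\<rho> \<in> ops q m"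
  shows "trace_on (words q (m + t)) (Ins_P q m Q \<sigma> \<rho>) = trace_on (words q m) \<rho>"
proof -
  let ?ps = "sorted_list_of_set Q"
  note ps = sorted_list_tsubsets[OF Q]
  have "trace_on (words q (m + t)) (Ins_P q m Q \<sigma> \<rho>) =
    (\<Sum>Z\<in>words q (m + t). wt \<sigma> (nths Z (zpos Q)) (nths Z (zpos Q)) * \<rho> (nths Z (- zpos Q)) (nths Z (- zpos Q)))"
    unfolding trace_on_def by (intro sum.cong refl) (simp add: Ins_P_eval[OF Q \<sigma>(1) \<rho>])
  also have "\<dots> = (\<Sum>a\<in>words q t. \<Sum>W\<in>words q m. wt \<sigma> a a * \<rho> W W)"
    unfolding words_mrg_sum[OF Q le_add2] add_diff_cancel_right'
  proof (intro sum.cong refl)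
    fix a W assume "a \<in> words q t" "W \<in> words q m"
    then have "length a = length ?ps" "length W = m" unfolding ps(3) by (auto simp: words_def)
    note len = this(1) mrg_length[OF this(1), of W, unfolded ps(3) this(2)]
    have "set ?ps \<subseteq> {1..length (mrg ?ps a W)}" unfolding len(2) ps(2) by (rule ps(4))
    from mrg_eq_iff[OF ps(1) this len(1) mrg_length[OF len(1), symmetric]]
    have "nths (mrg ?ps a W) (zpos Q) = a \<and> nths (mrg ?ps a W) (- zpos Q) = W" unfolding ps(2) by blast
    then show "wt \<sigma> (nths (mrg ?ps a W) (zpos Q)) (nths (mrg ?ps a W) (zpos Q)) *
        \<rho> (nths (mrg ?ps a W) (- zpos Q)) (nths (mrg ?ps a W) (- zpos Q)) = wt \<sigma> a a * \<rho> W W" by simp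
  qed
  also have "\<dots> = (\<Sum>a\<in>words q t. wt \<sigma> a a) * (\<Sum>W\<in>words q m. \<rho> W W)"
    by (simp add: sum_product)
  finally show ?thesis using sum_wt_diag[OF \<sigma>(2)] \<sigma>(1) by (simp add: trace_on_def)
qed

text \<open>A script is reconstructed from one related pair of words; if there is no such pair, the
  error vector is zero and orthogonality is immediate.\<close>

lemma err_vec_cases:
  assumes i: "i \<in> err_indices q N t1 t2"
  shows "(\<forall>c. err_vec q N (N - t2 + t1) i c = (\<lambda>_. 0)) \<or>
    (\<exists>e. script q (N - t2) t2 t1 e \<and> (\<forall>c. err_vec q N (N - t2 + t1) i c = err q N (N - t2 + t1) (runs e) c))"
proof -
  let ?M = "N - t2 + t1"
  obtain P Q a b where i_eq: "i = (P, Q, a, b)" by (metis prod_cases4)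
  then have P: "P \<in> tsubsets N t2" and Q: "Q \<in> tsubsets ?M t1" and a: "a \<in> words q t2" and b: "b \<in> words q t1"
    using i by (auto simp: err_indices_def)
  let ?r = "err_rel (zpos P) a (zpos Q) b"
  show ?thesis
  proof (cases "\<exists>X0\<in>words q N. \<exists>Z0\<in>words q ?M. ?r X0 Z0")
    case True
    then obtain X0 Z0 where XZ: "X0 \<in> words q N" "Z0 \<in> words q ?M" "?r X0 Z0" by blast
    then have eq: "nths X0 (- zpos P) = nths Z0 (- zpos Q)" "nths X0 (zpos P) = a" "nths Z0 (zpos Q) = b"
      by (auto simp: err_rel_def)
    obtain e where e: "dels e = a" "inss e = b" "keeps e = length (nths X0 (- zpos P))"
      "\<And>X Z. length X = length X0 \<Longrightarrow> length Z = length Z0 \<Longrightarrow> runs e X Z \<longleftrightarrow> ?r X Z"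
      using err_rel_script[OF eq(1)] unfolding eq(2,3) by blast
    have "script q (N - t2) t2 t1 e"
      using nths_words(2)[OF zpos_tsubsets[OF P] XZ(1)] a b e by (auto simp: script_def words_def)
    moreover have "err q N ?M ?r c = err q N ?M (runs e) c" for c
      by (rule err_cong) (use e(4) XZ in \<open>auto simp: words_def\<close>)
    ultimately show ?thesis unfolding i_eq err_vec_def by auto
  next
    case False
    then have "err q N ?M ?r c = (\<lambda>_. 0)" for c
      by (intro ext) (auto simp: err_def intro!: sum.neutral)
    then show ?thesis unfolding i_eq err_vec_def by auto
  qed
qed

lemma pair_orth_err_vec:
  assumes "pair_orth q N t1 t2 c d" "i \<in> err_indices q N t1 t2" "j \<in> err_indices q N t1 t2"
  shows "ip (words q (N - t2 + t1)) (err_vec q N (N - t2 + t1) i c) (err_vec q N (N - t2 + t1) j d) = 0"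
  using err_vec_cases[OF assms(2)] err_vec_cases[OF assms(3)]
proof (elim disjE exE conjE)
  fix e f
  assume "script q (N - t2) t2 t1 e" "script q (N - t2) t2 t1 f"
    "\<forall>c. err_vec q N (N - t2 + t1) i c = err q N (N - t2 + t1) (runs e) c"
    "\<forall>c. err_vec q N (N - t2 + t1) j c = err q N (N - t2 + t1) (runs f) c"
  then show ?thesis using assms(1) ip_err_script unfolding pair_orth_def by simp
qed (auto simp: ip_def)

lemma err_lin: "err q N M r (\<lambda>X. s * c X + t * d X) = (\<lambda>Z. s * err q N M r c Z + t * err q N M r d Z)"
  by (intro ext) (simp add: err_def sum.distrib sum_distrib_left algebra_simps del: sum_mult_of_bool_eq sum_of_bool_mult_eq)

lemma err_vec_lin: "err_vec q N M i (\<lambda>X. s * c X + t * d X) = (\<lambda>Z. s * err_vec q N M i c Z + t * err_vec q N M i d Z)"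
  by (cases i) (simp add: err_vec_def err_lin)

text \<open>Off-diagonal values vanish by assumption. Diagonal values agree because the sum and the
  difference of two orthonormal vectors are again orthogonal.\<close>

lemma orth_imp_knill_laflamme:
  assumes C: "lin_sub I C" and A: "orthonormal I A" "A \<subseteq> C"
    and lin: "\<And>i c d s t. T i (\<lambda>X. s * c X + t * d X) = (\<lambda>Z. s * T i c Z + t * T i d Z)"
    and orth: "\<And>c d i j. c \<in> C \<Longrightarrow> d \<in> C \<Longrightarrow> ip I c d = 0 \<Longrightarrow> i \<in> J \<Longrightarrow> j \<in> J \<Longrightarrow> ip H (T i c) (T j d) = 0"
  shows "\<exists>\<Gamma>. \<forall>i\<in>J. \<forall>j\<in>J. \<forall>a\<in>A. \<forall>b\<in>A. ip H (T i a) (T j b) = (if a = b then \<Gamma> i j else 0)"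
proof (cases "A = {}")
  case False
  then obtain a0 where a0: "a0 \<in> A" by blast
  have ab: "ip H (T i a) (T j b) = 0" if "i \<in> J" "j \<in> J" "a \<in> A" "b \<in> A" "a \<noteq> b" for i j a b
    using that A orth[of a b i j] unfolding orthonormal_def by auto
  have aa: "ip H (T i a) (T j a) = ip H (T i a0) (T j a0)" if ij: "i \<in> J" "j \<in> J" and a: "a \<in> A" for i j a
  proof (cases "a = a0")
    case False
    \<comment> \<open>The form at \<open>(x, y)\<close> is its value at \<open>(a, a)\<close> minus
      its value at \<open>(a0, a0)\<close>, up to cross terms that vanish. The explicit factors fit
      the two-term shape of \<open>lin_sub_comb\<close> and \<open>lin\<close>.\<close>
    define x y where "x = (\<lambda>X. 1 * a X + 1 * a0 X)" and "y = (\<lambda>X. 1 * a X + (-1) * a0 X)"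
    have xy: "x \<in> C" "y \<in> C" unfolding x_def y_def by (rule lin_sub_comb[OF C]; use A(2) a a0 in blast)+
    have "ip I a a = 1" "ip I a0 a0 = 1" "ip I a a0 = 0" "ip I a0 a = 0"
      using A(1) a a0 False unfolding orthonormal_def by auto
    then have "ip I x y = 0" unfolding x_def y_def ip_lin_right ip_lin_left by simp
    then have "ip H (T i x) (T j y) = 0" using orth xy ij by blast
    then show ?thesis unfolding x_def y_def lin ip_lin_right ip_lin_left
      using ab[OF ij a a0] ab[OF ij a0 a] False by simp
  qed simp
  show ?thesis using ab aa by (intro exI[of _ "\<lambda>i j. ip H (T i a0) (T j a0)"]) auto
qed simp

text \<open>Being supported on \<open>C\<close> constrains the columns only; hermiticity carries the
  constraint over to the rows, so both sides can be expanded in the basis.\<close>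

lemma density_expand:
  assumes full: "\<And>w. w \<in> C \<Longrightarrow> w = (\<lambda>x. \<Sum>b\<in>A. ip (words q N) b w * b x)"
    and C: "lin_sub (words q N) C" and \<rho>: "density q N \<rho>" "supported_on C \<rho>"
  obtains r where "\<rho> = (\<lambda>X Y. \<Sum>(a, b)\<in>A \<times> A. r (a, b) * outer a b X Y)"
proof -
  \<comment> \<open>The matrix \<rho> applied to \<open>a\<close>, a combination of columns and
    hence in \<open>C\<close>. By hermiticity its conjugate entries are the coefficients of the
    columns of \<rho>.\<close>
  define \<gamma> where "\<gamma> = (\<lambda>a Y. \<Sum>X\<in>words q N. a X * \<rho> Y X)"
  have col: "(\<lambda>X. \<rho> X Y) \<in> C" for Y using \<rho>(2) by (simp add: supported_on_def)
  have \<gamma>C: "\<gamma> a \<in> C" for a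
    unfolding \<gamma>_def using lin_sub_sum[OF C finite_words, of q N "\<lambda>X Y. \<rho> Y X" a] col by simp
  have zero: "\<rho> X Y = 0" if "X \<notin> words q N \<or> Y \<notin> words q N" for X Y
    using \<rho>(1) that by (simp add: density_def density_on_def)
  have herm: "\<rho> X Y = cnj (\<rho> Y X)" for X Y
  proof (cases "X \<in> words q N \<and> Y \<in> words q N")
    case True
    then show ?thesis using psd_hermitian[OF finite_words, of q N \<rho> Y X] \<rho>(1)
      by (simp add: density_def density_on_def)
  next
    case False
    then show ?thesis using zero[of X Y] zero[of Y X] by auto
  qed
  have ipcol: "ip (words q N) a (\<lambda>X. \<rho> X Y) = cnj (\<gamma> a Y)" for a Y
    unfolding ip_def \<gamma>_def cnj_sum
  proof (intro sum.cong refl)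
    fix X show "cnj (a X) * \<rho> X Y = cnj (a X * \<rho> Y X)" using herm[of X Y] by simp
  qed
  define r where "r = (\<lambda>(a, b). cnj (ip (words q N) b (\<gamma> a)))"
  have "\<rho> X Y = (\<Sum>(a, b)\<in>A \<times> A. r (a, b) * outer a b X Y)" for X Y
  proof -
    have "\<rho> X Y = (\<Sum>a\<in>A. cnj (\<gamma> a Y) * a X)"
      using fun_cong[OF full[OF col[of Y]], of X] by (simp add: ipcol)
    also have "\<dots> = (\<Sum>a\<in>A. \<Sum>b\<in>A. cnj (ip (words q N) b (\<gamma> a)) * (a X * cnj (b Y)))"
    proof (intro sum.cong refl)
      fix a
      have "\<gamma> a Y = (\<Sum>b\<in>A. ip (words q N) b (\<gamma> a) * b Y)"
        using fun_cong[OF full[OF \<gamma>C[of a]], of Y] .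
      then have *: "cnj (\<gamma> a Y) = (\<Sum>b\<in>A. cnj (ip (words q N) b (\<gamma> a)) * cnj (b Y))" by simp
      show "cnj (\<gamma> a Y) * a X = (\<Sum>b\<in>A. cnj (ip (words q N) b (\<gamma> a)) * (a X * cnj (b Y)))"
        unfolding * sum_distrib_right by (simp only: mult_ac)
    qed
    finally show ?thesis by (simp add: sum.cartesian_product r_def outer_def)
  qed
  then show thesis using that by blast
qed

text \<open>The recovery is built from the basis errors and a basis of \<open>C\<close> alone,
  independently of \<mu>, \<open>p\<close> and \<open>pd\<close>. It restores \<rho> exactly for
  each fixed \<open>P\<close>, \<open>Q\<close> and product state (\<open>single\<close>), so
  averaging over all of them changes nothing.\<close>

lemma pair_orth_imp_insdel_code:
  assumes q: "q > 0" and s2: "s2 < N" and sub: "is_subspace q N C"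
    and orth: "\<And>c d. c \<in> C \<Longrightarrow> d \<in> C \<Longrightarrow> ip (words q N) c d = 0 \<Longrightarrow> pair_orth q N s1 s2 c d"
  shows "insdel_code q N s1 s2 C"
  unfolding insdel_code_def
proof (intro allI impI, elim conjE)
  fix \<mu> p pd
  assume ip: "ins_params q (N - s2) s1 \<mu> p" and dp: "del_params N s2 pd"
  let ?M = "N - s2 + s1" and ?J = "err_indices q N s1 s2"
  let ?T = "err_vec q N ?M"
  have C: "lin_sub (words q N) C" using sub by (simp add: is_subspace_iff)
  have CS: "C \<subseteq> supp_space (words q N)" using C by (auto simp: lin_sub_def supp_space_def)
  obtain A where A: "finite A" "orthonormal (words q N) A" "A \<subseteq> C"
    and full: "\<And>w. w \<in> C \<Longrightarrow> w = (\<lambda>x. \<Sum>b\<in>A. ip (words q N) b w * b x)"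
    by (rule orthonormal_basis_extend[OF finite_words C, of "{}"]) (auto simp: orthonormal_def)
  have AS: "A \<subseteq> supp_space (words q N)" using A(3) CS by blast
  have "\<exists>\<Gamma>. \<forall>i\<in>?J. \<forall>j\<in>?J. \<forall>a\<in>A. \<forall>b\<in>A. ip (words q ?M) (?T i a) (?T j b) = (if a = b then \<Gamma> i j else 0)"
    by (rule orth_imp_knill_laflamme[OF C A(2,3)]) (auto simp: err_vec_lin orth pair_orth_err_vec)
  then obtain \<Gamma> where \<Gamma>: "\<And>i j a b. i \<in> ?J \<Longrightarrow> j \<in> ?J \<Longrightarrow> a \<in> A \<Longrightarrow> b \<in> A \<Longrightarrow>
      ip (words q ?M) (?T i a) (?T j b) = (if a = b then \<Gamma> i j else 0)" by blast
  obtain S :: "(vec + vec) set" and K \<kappa> where ch: "qchannel q ?M N (kraus_map q ?M N S K)"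
    and rec: "\<And>i j a b. i \<in> ?J \<Longrightarrow> j \<in> ?J \<Longrightarrow> a \<in> A \<Longrightarrow> b \<in> A \<Longrightarrow>
       kraus_map q ?M N S K (outer (?T i a) (?T j b)) = (\<lambda>X Y. \<kappa> i j * outer a b X Y)"
    using knill_laflamme_recovery[of q ?J A N ?T ?M \<Gamma>, OF q finite_err_indices A(1,2) AS err_vec_supp \<Gamma>] by blast
  let ?R = "kraus_map q ?M N S K"
  have "?R (ins_chan q (N - s2) s1 \<mu> p (del_chan q N s2 pd \<rho>)) = \<rho>"
    if \<rho>: "density q N \<rho>" "supported_on C \<rho>" for \<rho>
  proof -
    have \<rho>o: "\<rho> \<in> ops q N" using \<rho>(1) by (auto simp: density_def density_on_def ops_def)
    have tr: "trace_on (words q N) \<rho> = 1" using \<rho>(1) by (simp add: density_def density_on_def)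
    obtain r where r: "\<rho> = (\<lambda>X Y. \<Sum>(a, b)\<in>A \<times> A. r (a, b) * outer a b X Y)"
      by (rule density_expand[OF full C \<rho>])
    then have r': "\<rho> = (\<lambda>X Y. \<Sum>k\<in>A \<times> A. r k * outer (fst k) (snd k) X Y)"
      by (simp add: case_prod_unfold)
    have oo: "outer (fst k) (snd k) \<in> ops q N" if "k \<in> A \<times> A" for k
      using that AS by (intro outer_ops) auto
    have single: "?R (Ins_P q (N - s2) Q \<sigma> (Era_P q N P \<rho>)) = \<rho>"
      if P: "P \<in> tsubsets N s2" and Q: "Q \<in> tsubsets ?M s1" and \<sigma>: "length \<sigma> = s1" "\<forall>s\<in>set \<sigma>. qudit_state q s"
      for P Q \<sigma>
    proof -
      define idx where "idx = words q s2 \<times> words q s1 \<times> words q s1"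
      \<comment> \<open>The errors on the left and on the right of a term share positions and
        deleted letters, but may insert different letters.\<close>
      define l m where "l = (\<lambda>(a, b, b' :: nat list). (P, Q, a, b) :: err_index)" and "m = (\<lambda>(a, b :: nat list, b'). (P, Q, a, b') :: err_index)"
      define w where "w = (\<lambda>(a :: nat list, b, b'). wt \<sigma> b b')"
      define \<kappa>' where "\<kappa>' = (\<Sum>x\<in>idx. w x * \<kappa> (l x) (m x))"
      have lr: "l x \<in> ?J" "m x \<in> ?J" if "x \<in> idx" for x
        using that P Q unfolding idx_def l_def m_def err_indices_def by auto
      have "Ins_P q (N - s2) Q \<sigma> (Era_P q N P (outer a b)) =
          (\<lambda>Z Z'. \<Sum>x\<in>idx. w x * outer (?T (l x) a) (?T (m x) b) Z Z')" if "outer a b \<in> ops q N" for a b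
      proof (intro ext)
        fix Z Z'
        show "Ins_P q (N - s2) Q \<sigma> (Era_P q N P (outer a b)) Z Z' =
          (\<Sum>x\<in>idx. w x * outer (?T (l x) a) (?T (m x) b) Z Z')"
          using insdel_outer[OF P less_imp_le[OF s2] Q \<sigma>(1) that, of Z Z']
          unfolding idx_def l_def m_def w_def err_vec_def by (simp add: sum.cartesian_product')
      qed
      then have Rab: "?R (Ins_P q (N - s2) Q \<sigma> (Era_P q N P (outer a b))) = (\<lambda>X Y. \<kappa>' * outer a b X Y)"
        if "a \<in> A" "b \<in> A" for a b
        using oo[of "(a, b)"] that
        by (simp add: kraus_map_sum rec lr \<kappa>'_def sum_distrib_right mult.assoc cong: sum.cong)
      have Eo: "Era_P q N P (outer (fst k) (snd k)) \<in> ops q (N - s2)" if "k \<in> A \<times> A" for k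
        by (rule Era_P_ops[OF P oo[OF that]])
      have "Ins_P q (N - s2) Q \<sigma> (Era_P q N P \<rho>) =
        (\<lambda>Z Z'. \<Sum>k\<in>A \<times> A. r' k * Ins_P q (N - s2) Q \<sigma> (Era_P q N P (outer (fst k) (snd k))) Z Z')"
        if "\<rho> = (\<lambda>X Y. \<Sum>k\<in>A \<times> A. r' k * outer (fst k) (snd k) X Y)" for r'
      proof -
        have "Era_P q N P \<rho> = (\<lambda>W W'. \<Sum>k\<in>A \<times> A. r' k * Era_P q N P (outer (fst k) (snd k)) W W')"
          unfolding that by (rule Era_P_sum[OF P less_imp_le[OF s2] oo])
        then show ?thesis by (simp only:) (intro ext Ins_P_sum[OF Q \<sigma>(1) Eo])
      qed
      from this[OF r'] have "?R (Ins_P q (N - s2) Q \<sigma> (Era_P q N P \<rho>)) = (\<lambda>X Y. \<kappa>' * \<rho> X Y)"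
        by (subst (2) r') (auto simp: kraus_map_sum Rab sum_distrib_left mult_ac intro!: ext sum.cong)
      moreover have "trace_on (words q N) (?R (Ins_P q (N - s2) Q \<sigma> (Era_P q N P \<rho>))) = 1"
      proof -
        have "Ins_P q (N - s2) Q \<sigma> (Era_P q N P \<rho>) \<in> ops q ?M"
          using Ins_P_eval[OF Q \<sigma>(1) Era_P_ops[OF P \<rho>o]] by (auto simp: ops_def)
        from qchannel_trace[OF ch this] show ?thesis
          using trace_Ins_P[OF Q \<sigma> Era_P_ops[OF P \<rho>o]] trace_Era_P[OF P less_imp_le[OF s2] \<rho>o] tr by simp
      qed
      \<comment> \<open>Erasure, insertion and recovery all preserve the trace, and \<rho> has trace
        1; this fixes the scalar.\<close>
      ultimately have "\<kappa>' = 1" using tr by (simp add: trace_on_def sum_distrib_left[symmetric])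
      then show ?thesis using \<open>?R (Ins_P q (N - s2) Q \<sigma> (Era_P q N P \<rho>)) = (\<lambda>X Y. \<kappa>' * \<rho> X Y)\<close> by simp
    qed
    define F where "F = (\<lambda>\<sigma> Z Z'. \<Sum>Q\<in>tsubsets ?M s1. complex_of_real (p \<sigma> Q) *
        Ins_P q (N - s2) Q \<sigma> (del_chan q N s2 pd \<rho>) Z Z')"
    have RF: "?R (F \<sigma>) = \<rho>" if \<sigma>: "\<sigma> \<in> space \<mu>" for \<sigma>
    proof -
      have \<sigma>1: "length \<sigma> = s1" "\<forall>s\<in>set \<sigma>. qudit_state q s" and p1: "(\<Sum>Q\<in>tsubsets ?M s1. p \<sigma> Q) = 1"
        using ip \<sigma> unfolding ins_params_def by auto
      have del: "?R (Ins_P q (N - s2) Q \<sigma> (del_chan q N s2 pd \<rho>)) = \<rho>" if Q: "Q \<in> tsubsets ?M s1" for Q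
      proof -
        have "Ins_P q (N - s2) Q \<sigma> (del_chan q N s2 pd \<rho>) =
          (\<lambda>Z Z'. \<Sum>P\<in>tsubsets N s2. complex_of_real (pd P) * Ins_P q (N - s2) Q \<sigma> (Era_P q N P \<rho>) Z Z')"
          by (intro ext Ins_P_del_chan[OF Q \<sigma>1(1) \<rho>o])
        then have "?R (Ins_P q (N - s2) Q \<sigma> (del_chan q N s2 pd \<rho>)) =
           (\<lambda>X Y. \<Sum>P\<in>tsubsets N s2. complex_of_real (pd P) * \<rho> X Y)"
          by (simp add: kraus_map_sum single Q \<sigma>1 cong: sum.cong)
        also have "\<dots> = \<rho>"
          using dp by (simp add: del_params_def sum_distrib_right[symmetric] of_real_sum[symmetric] del: of_real_sum)
        finally show ?thesis .
      qed
      have "?R (F \<sigma>) = (\<lambda>X Y. \<Sum>Q\<in>tsubsets ?M s1. complex_of_real (p \<sigma> Q) * \<rho> X Y)"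
        unfolding F_def kraus_map_sum by (simp add: del cong: sum.cong)
      also have "\<dots> = \<rho>"
        using p1 by (simp add: sum_distrib_right[symmetric] of_real_sum[symmetric] del: of_real_sum)
      finally show ?thesis .
    qed
    \<comment> \<open>\<open>ins_params\<close> grants integrability for every operator on
      \<open>N - s2\<close> qudits, in particular for the state after the deletions; this allows the
      recovery to move inside the integral.\<close>
    have int: "integrable \<mu> (\<lambda>\<sigma>. F \<sigma> Z Z')" for Z Z'
      using ip del_chan_ops[OF \<rho>o, of s2 pd] unfolding ins_params_def F_def by blast
    interpret prob_space \<mu> using ip unfolding ins_params_def by blast
    have "?R (ins_chan q (N - s2) s1 \<mu> p (del_chan q N s2 pd \<rho>)) = ?R (\<lambda>Z Z'. integral\<^sup>L \<mu> (\<lambda>\<sigma>. F \<sigma> Z Z'))"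
      unfolding ins_chan_def F_def ..
    also have "\<dots> = (\<lambda>X Y. integral\<^sup>L \<mu> (\<lambda>\<sigma>. ?R (F \<sigma>) X Y))"
      by (rule kraus_map_integral[OF int])
    also have "\<dots> = (\<lambda>X Y. integral\<^sup>L \<mu> (\<lambda>\<sigma>. \<rho> X Y))"
      by (intro ext Bochner_Integration.integral_cong refl) (simp add: RF)
    also have "\<dots> = \<rho>" by (simp add: prob_space)
    finally show ?thesis .
  qed
  then show "\<exists>R. qchannel q ?M N R \<and> (\<forall>\<rho>. density q N \<rho> \<and> supported_on C \<rho> \<longrightarrow>
      R (ins_chan q (N - s2) s1 \<mu> p (del_chan q N s2 pd \<rho>)) = \<rho>)"
    using ch by blast
qed

theorem theorem2p5:
  fixes q N t1 t2 s1 s2 :: nat and C :: "vec set"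
  assumes "q \<ge> 2" and "N > 0"
    and "t2 < N" and "s2 < N" and "t1 + t2 = s1 + s2"
    and "is_subspace q N C"
    and "insdel_code q N t1 t2 C"
  shows "insdel_code q N s1 s2 C"
proof -
  have q: "q > 0" using assms(1) by simp
  show ?thesis
  proof (rule pair_orth_imp_insdel_code[OF q assms(4,6)])
    fix c d assume "c \<in> C" "d \<in> C" "ip (words q N) c d = 0"
    from insdel_code_imp_pair_orth[OF q assms(3,6,7) this]
    show "pair_orth q N s1 s2 c d" by (rule pair_orth_transfer[OF _ assms(3,4,5) q])
  qed
qed

end
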